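(* Let $K_\star$ be as defined below and let $0<K<K_\star$. There is $L_0$ such that for all $L\ge L_0$ and all $n$ with $-1<n\le -1+KL^{-d/(d+1)}$, the constant function $m\equiv n$ is the unique minimizer of the variational problem defining $f_L(n)$.
   Context: Let $d\ge2$ and $L>0$. $\Omega$ is the flat torus $\mathbb R^d/(L\mathbb Z)^d$. Let $F(m)=\frac14(m^2-1)^2$ and, for $m\in H^1(\Omega)$, $\mathcal F(m)=\frac12\int_\Omega|\nabla m|^2\,dx+\int_\Omega F(m)\,dx$. For $-1<n<1$, $f_L(n)=\inf\{\mathcal F(m): m\in H^1(\Omega),\ L^{-d}\int_\Omega m\,dx=n\}$; a minimizer is an admissible $m$ with $\mathcal F(m)=f_L(n)$. Let $\sigma_d$ be the area of the unit sphere in $\mathbb R^d$, $S=\int_{-1}^1\sqrt{2F(h)}\,dh=2^{3/2}/3$, $\chi=1/F''(-1)=1/2$. Define $D(K)=\frac{2}{d\chi S}(\sigma_d/d)^{-1/d}(K/2)^{(d+1)/d}$, $C_\star=\frac1d\big(\frac{d+1}{2}\big)^{(d+1)/d}$, and let $K_\star$ be the unique positive solution of $D(K_\star)=C_\star$, namely $K_\star=(d+1)(\sigma_d/d)^{1/(d+1)}(\chi S/2)^{d/(d+1)}$. *)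

theory Defs
  imports "HOL-Analysis.Analysis"
begin

definition Fdw :: "real \<Rightarrow> real" where
  "Fdw m = (m^2 - 1)^2 / 4"

definition sphere_area :: "nat \<Rightarrow> real" where
  "sphere_area d = 2 * pi powr (real d / 2) / Gamma (real d / 2)"

definition S_const :: real where "S_const = 2 powr (3/2) / 3"
definition chi_const :: real where "chi_const = 1/2"

definition D_fun :: "nat \<Rightarrow> real \<Rightarrow> real" where
  "D_fun d K = 2 / (real d * chi_const * S_const) * (sphere_area d / real d) powr (-1 / real d)
      * (K / 2) powr ((real d + 1) / real d)"

definition C_star :: "nat \<Rightarrow> real" where
  "C_star d = 1 / real d * ((real d + 1) / 2) powr ((real d + 1) / real d)"

definition K_star :: "nat \<Rightarrow> real" where
  "K_star d = (real d + 1) * (sphere_area d / real d) powr (1 / (real d + 1))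
      * (chi_const * S_const / 2) powr (real d / (real d + 1))"

text \<open>Fundamental cell [0,L]^d of the torus (R/LZ)^d.\<close>
definition cell :: "real \<Rightarrow> (real^'d) set" where
  "cell L = cbox 0 (\<chi> i. L)"

text \<open>L-periodicity in every coordinate direction (functions on the torus).\<close>
definition periodic_L :: "real \<Rightarrow> (real^'d \<Rightarrow> 'b) \<Rightarrow> bool" where
  "periodic_L L f \<longleftrightarrow> (\<forall>x i. f (x + L *\<^sub>R axis i 1) = f x)"

definition test_fun :: "real \<Rightarrow> (real^'d \<Rightarrow> real) \<Rightarrow> (real^'d \<Rightarrow> real^'d) \<Rightarrow> bool" where
  "test_fun L \<phi> G \<longleftrightarrow> periodic_L L \<phi> \<and>
     (\<forall>x. (\<phi> has_derivative (\<lambda>h. G x \<bullet> h)) (at x)) \<and> continuous_on UNIV G"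

text \<open>m \<in> H^1 of the torus with weak gradient g: both periodic, square integrable
  on the cell, and the integration-by-parts identity against all periodic test functions.\<close>
definition torus_H1 :: "real \<Rightarrow> (real^'d \<Rightarrow> real) \<Rightarrow> (real^'d \<Rightarrow> real^'d) \<Rightarrow> bool" where
  "torus_H1 L m g \<longleftrightarrow>
     periodic_L L m \<and> periodic_L L g \<and>
     m \<in> borel_measurable (lebesgue_on (cell L)) \<and>
     g \<in> borel_measurable (lebesgue_on (cell L)) \<and>
     integrable (lebesgue_on (cell L)) (\<lambda>x. (m x)^2) \<and>
     integrable (lebesgue_on (cell L)) (\<lambda>x. (norm (g x))^2) \<and>
     (\<forall>\<phi> G i. test_fun L \<phi> G \<longrightarrow>
        integral\<^sup>L (lebesgue_on (cell L)) (\<lambda>x. m x * G x $ i)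
          = - integral\<^sup>L (lebesgue_on (cell L)) (\<lambda>x. g x $ i * \<phi> x))"

text \<open>The energy (possibly infinite, hence in ennreal).\<close>
definition energy :: "real \<Rightarrow> (real^'d \<Rightarrow> real) \<Rightarrow> (real^'d \<Rightarrow> real^'d) \<Rightarrow> ennreal" where
  "energy L m g = (\<integral>\<^sup>+ x. ennreal (1/2 * (norm (g x))^2 + Fdw (m x)) \<partial>lebesgue_on (cell L))"

definition admissible :: "real \<Rightarrow> real \<Rightarrow> (real^'d::finite \<Rightarrow> real) \<Rightarrow> (real^'d \<Rightarrow> real^'d) \<Rightarrow> bool" where
  "admissible L n m g \<longleftrightarrow> torus_H1 L m g \<and>
     integral\<^sup>L (lebesgue_on (cell L)) m / L ^ CARD('d) = n"

definition f_L :: "'d::finite itself \<Rightarrow> real \<Rightarrow> real \<Rightarrow> ennreal" where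
  "f_L _ L n = Inf {energy L m g | (m :: real^'d \<Rightarrow> real) g. admissible L n m g}"

definition is_minimizer :: "real \<Rightarrow> real \<Rightarrow> (real^'d::finite \<Rightarrow> real) \<Rightarrow> (real^'d \<Rightarrow> real^'d) \<Rightarrow> bool" where
  "is_minimizer L n m g \<longleftrightarrow> admissible L n m g \<and> energy L m g = f_L TYPE('d) L n"

end

(*
  Let u = m - n and a = -2 n. Because F is quartic, the energy excess of m over the constant n is
  int |grad u|^2/2 + u^2 (u - a)^2/4 - (1 - n^2)/2 u^2 with int u = 0, and (1 - n^2)/2 is of order
  L^(-d/(d+1)). So it suffices to show the coercivity bound
  int |grad u|^2/2 + W(u) >= l int u^2, W(u) = u^2 (u - a)^2/4, with l = K' L^(-d/(d+1)) and K < K' < K_star.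
  The Modica-Mortola inequality |grad u|^2/2 + W(u) >= |grad Phi(u)| and a sharp isoperimetric
  inequality for small sets on the torus bound the surface energy of the droplet {u > a - eps} of
  volume V from below by S times the isoperimetric function of V. The mean-zero constraint forces
  the background to pay about 4 V^2/L^d, and the gain is about 4 l V. Young's inequality for these
  three terms gives exactly the threshold K_star.

  The isoperimetric inequality comes from the Brunn-Minkowski inequality in R^d applied to the
  superlevel sets of a function cut off outside a translated cell; averaging over the translations
  turns the boundary terms into (2d/L) int f, which is of lower order.

  The coercivity bound is proved for C^1 functions and transferred to H^1 by convolution with a periodic
  trigonometric kernel. Weak convergence is enough: the gradient and quartic terms decrease by
  Jensen's inequality, and the concave quadratic term is only needed up to lower semicontinuity of
  the L^2 norm.
*)
theory Submission
  imports Defs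
begin

section \<open>The Brunn--Minkowski inequality for open sets\<close>

text \<open>For a droplet of volume V = r^d, put X = r L^(-d/(d+1)). The three competing terms
  V^2/L^d, V^((d-1)/d) and L^(-d/(d+1)) V are then r^(d-1) times X^(d+1), 1 and X. This balance
  fixes the exponent d/(d+1), and the comparison becomes an inequality in X alone that holds for
  every volume, large or small. The boundary error (2d/L) int f is smaller than \<open>l\<close> int
  f by the factor L^(-1/(d+1)). It is charged only where u > eps: inside the droplet to the bulk
  gain, in the transition layer to the slack left by truncating the Modica-Mortola density near the
  wells. All losses are governed by one parameter eps, fixed from K' < \<open>K_star\<close> by
  continuity at eps = 0 before L is taken large. The room between K and K' gives uniqueness, because
  the excess is at least (K' - K) L^(-d/(d+1)) int u^2. In the passage to H^1 the quadratic terms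
  are moved to the other side, where they carry the positive coefficient 1/2 + c and an affine
  minorant of the square suffices.\<close>

abbreviation msum :: "'a::euclidean_space set \<Rightarrow> 'a set \<Rightarrow> 'a set" where
  "msum A B \<equiv> {x + y | x y. x \<in> A \<and> y \<in> B}"

text \<open>\<open>N\<close> is an upper bound on the number of disjoint boxes, so that the induction of
  Hadwiger and Ohmann can run on it.\<close>
definition box_union :: "nat \<Rightarrow> 'a::euclidean_space set \<Rightarrow> bool" where
  "box_union N A \<longleftrightarrow> (\<exists>\<D>. finite \<D> \<and> card \<D> \<le> N \<and> disjoint \<D> \<and>
     (\<forall>K\<in>\<D>. K \<noteq> {} \<and> (\<exists>a b. K = box a b)) \<and> A = \<Union>\<D>)"

lemma box_union_open: "box_union N A \<Longrightarrow> open A"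
  unfolding box_union_def by (auto intro!: open_Union)

lemma box_union_bounded: "box_union N A \<Longrightarrow> bounded A"
  unfolding box_union_def by (auto intro!: bounded_Union)

lemma box_Int_halfspace_lt:
  assumes "i \<in> Basis"
  shows "\<exists>a' b'. box a b \<inter> {x. x \<bullet> i < c} = box a' (b'::'a::euclidean_space)"
proof -
  have "box a b \<inter> {x. x \<bullet> i < c} = box a (\<Sum>j\<in>Basis. (if j = i then min (b\<bullet>i) c else b\<bullet>j) *\<^sub>R j)"
    using assms by (intro set_eqI) (auto simp: mem_box)
  then show ?thesis by blast
qed

lemma box_Int_halfspace_gt:
  assumes "i \<in> Basis"
  shows "\<exists>a' b'. box a b \<inter> {x. x \<bullet> i > c} = box a' (b'::'a::euclidean_space)"
proof -
  have "box a b \<inter> {x. x \<bullet> i > c} = box (\<Sum>j\<in>Basis. (if j = i then max (a\<bullet>i) c else a\<bullet>j) *\<^sub>R j) b"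
    using assms by (intro set_eqI) (auto simp: mem_box)
  then show ?thesis by blast
qed

text \<open>Only boxes that meet \<open>H\<close> survive the cut, so it suffices to count a
  subfamily containing all of them. This is what makes the number of boxes drop in
  \<open>box_union_split\<close>.\<close>

lemma box_union_cut_subfamily:
  fixes \<D> :: "'a::euclidean_space set set"
  assumes fin: "finite \<D>" and disj: "disjoint \<D>" and K: "\<forall>K\<in>\<D>. K \<noteq> {} \<and> (\<exists>a b. K = box a b)"
    and H: "\<And>a b. \<exists>a' b'. box a b \<inter> H = box a' (b'::'a)" and \<E>: "\<E> \<subseteq> \<D>" "\<And>K. K \<in> \<D> - \<E> \<Longrightarrow> K \<inter> H = {}"
  shows "box_union (card \<E>) (\<Union>\<D> \<inter> H)"
proof -
  have "finite \<E>" using fin \<E>(1) finite_subset by blast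
  let ?F = "(\<lambda>K. K \<inter> H) ` \<E> - {{}}"
  have "card ?F \<le> card \<E>"
    using \<open>finite \<E>\<close> by (meson card_image_le card_mono Diff_subset finite_imageI le_trans)
  moreover have "disjoint ?F"
  proof (rule pairwiseI)
    fix X Y assume "X \<in> ?F" "Y \<in> ?F" "X \<noteq> Y"
    then obtain K K' where *: "K \<in> \<D>" "K' \<in> \<D>" "X = K \<inter> H" "Y = K' \<inter> H" "K \<noteq> K'" using \<E>(1) by auto
    then have "disjnt K K'" using disj by (auto simp: pairwise_def)
    then show "disjnt X Y" using * by (auto simp: disjnt_def)
  qed
  moreover have "\<forall>K\<in>?F. K \<noteq> {} \<and> (\<exists>a b. K = box a b)"
    using K H \<E>(1) by (auto; metis subsetD)
  moreover have "\<Union>\<D> \<inter> H = \<Union>?F" using \<E> by blast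
  ultimately show ?thesis unfolding box_union_def using \<open>finite \<E>\<close> by (intro exI[of _ ?F]) auto
qed

lemma box_union_cut:
  assumes "box_union N A" and H: "\<And>a b. \<exists>a' b'. box a b \<inter> H = box a' (b'::'a::euclidean_space)"
  shows "box_union N (A \<inter> H)"
proof -
  obtain \<D> where D: "finite \<D>" "card \<D> \<le> N" "disjoint \<D>"
     "\<forall>K\<in>\<D>. K \<noteq> {} \<and> (\<exists>a b. K = box a b)" "A = \<Union>\<D>"
    using assms(1) unfolding box_union_def by blast
  have "box_union (card \<D>) (A \<inter> H)"
    using box_union_cut_subfamily[OF D(1,3,4) H, of \<D>] D(5) by auto
  then show ?thesis using D(2) unfolding box_union_def by (meson le_trans)
qed

text \<open>Two disjoint nonempty open boxes are separated by a coordinate hyperplane. Each of them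
  lies wholly on one side, so each half of the union loses at least one box and neither half is
  empty.\<close>

lemma box_union_split:
  fixes A :: "'a::euclidean_space set"
  assumes "box_union N A" "A \<noteq> {}"
  shows "(\<exists>a b. A = box a b) \<or>
    (\<exists>i\<in>Basis. \<exists>c. N > 0 \<and> box_union (N - 1) (A \<inter> {x. x \<bullet> i < c}) \<and> box_union (N - 1) (A \<inter> {x. x \<bullet> i > c})
       \<and> A \<inter> {x. x \<bullet> i < c} \<noteq> {} \<and> A \<inter> {x. x \<bullet> i > c} \<noteq> {})"
proof -
  obtain \<D> where D: "finite \<D>" "card \<D> \<le> N" "disjoint \<D>"
     "\<forall>K\<in>\<D>. K \<noteq> {} \<and> (\<exists>a b. K = box a b)" "A = \<Union>\<D>"
    using assms(1) unfolding box_union_def by blast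
  obtain K where "K \<in> \<D>" using assms(2) D(5) by auto
  show ?thesis
  proof (cases "\<D> = {K}")
    case True
    then show ?thesis using D by auto
  next
    case False
    then obtain K' where K': "K' \<in> \<D>" "K' \<noteq> K" using \<open>K \<in> \<D>\<close> by auto
    have dis: "K \<inter> K' = {}" using D(3) \<open>K \<in> \<D>\<close> K' by (auto simp: pairwise_def disjnt_def)
    obtain a b c d where ab: "K = box a b" and cd: "K' = box c d" using D(4) \<open>K \<in> \<D>\<close> K' by meson
    have ne: "box a b \<noteq> {}" "box c d \<noteq> {}" using ab cd D(4) \<open>K \<in> \<D>\<close> K' by auto
    have ne': "\<forall>i\<in>Basis. a\<bullet>i < b\<bullet>i" "\<forall>i\<in>Basis. c\<bullet>i < d\<bullet>i" using ne by (auto simp: box_ne_empty)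
    obtain i where i: "i \<in> Basis" "b\<bullet>i \<le> c\<bullet>i \<or> d\<bullet>i \<le> a\<bullet>i"
      using dis ne' unfolding ab cd disjoint_interval by force
    have main: "\<exists>i\<in>Basis. \<exists>c. N > 0 \<and> box_union (N - 1) (A \<inter> {x. x \<bullet> i < c}) \<and> box_union (N - 1) (A \<inter> {x. x \<bullet> i > c})
       \<and> A \<inter> {x. x \<bullet> i < c} \<noteq> {} \<and> A \<inter> {x. x \<bullet> i > c} \<noteq> {}"
      if PQ: "P \<in> \<D>" "Q \<in> \<D>" "P \<subseteq> {x. x \<bullet> i < c}" "Q \<subseteq> {x. x \<bullet> i > c}" for P Q c
    proof -
      have cardlt: "card (\<D> - {X}) \<le> N - 1" if "X \<in> \<D>" for X using that D(1,2) by simp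
      have "N > 0" using D(1,2) PQ(1) card_gt_0_iff by (metis empty_iff less_le_trans)
      moreover have "box_union (card (\<D> - {Q})) (A \<inter> {x. x \<bullet> i < c})" unfolding D(5)
        by (rule box_union_cut_subfamily[OF D(1,3,4) box_Int_halfspace_lt[OF i(1)]]) (use PQ in force)+
      moreover have "box_union (card (\<D> - {P})) (A \<inter> {x. x \<bullet> i > c})" unfolding D(5)
        by (rule box_union_cut_subfamily[OF D(1,3,4) box_Int_halfspace_gt[OF i(1)]]) (use PQ in force)+
      ultimately have "N > 0" "box_union (N-1) (A \<inter> {x. x \<bullet> i < c})" "box_union (N-1) (A \<inter> {x. x \<bullet> i > c})"
        using cardlt PQ(1,2) unfolding box_union_def by (meson le_trans)+
      moreover have "P \<noteq> {}" "Q \<noteq> {}" using D(4) PQ by auto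
      ultimately show ?thesis using i(1) PQ D(5) by blast
    qed
    from i(2) have "(\<exists>c. K \<subseteq> {x. x \<bullet> i < c} \<and> K' \<subseteq> {x. x \<bullet> i > c}) \<or> (\<exists>c. K' \<subseteq> {x. x \<bullet> i < c} \<and> K \<subseteq> {x. x \<bullet> i > c})"
    proof
      assume "b\<bullet>i \<le> c\<bullet>i"
      then have "K \<subseteq> {x. x \<bullet> i < c\<bullet>i} \<and> K' \<subseteq> {x. x \<bullet> i > c\<bullet>i}" using i(1) unfolding ab cd by (auto simp: mem_box) force
      then show ?thesis by blast
    next
      assume "d\<bullet>i \<le> a\<bullet>i"
      then have "K' \<subseteq> {x. x \<bullet> i < a\<bullet>i} \<and> K \<subseteq> {x. x \<bullet> i > a\<bullet>i}" using i(1) unfolding ab cd by (auto simp: mem_box) force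
      then show ?thesis by blast
    qed
    then show ?thesis using main \<open>K \<in> \<D>\<close> K'(1) by meson
  qed
qed

section \<open>Dividing a set by a coordinate hyperplane in a given proportion\<close>

lemma measure_cut:
  fixes B :: "'a::euclidean_space set"
  assumes "open B" "bounded B" "i \<in> Basis"
  shows "measure lebesgue B = measure lebesgue (B \<inter> {x. x \<bullet> i < c}) + measure lebesgue (B \<inter> {x. x \<bullet> i > c})"
proof -
  let ?m = "measure lebesgue :: 'a set \<Rightarrow> real"
  have o: "open (B \<inter> {x. x \<bullet> i < c})" "open (B \<inter> {x. x \<bullet> i > c})"
    using assms by (auto intro!: open_Int open_halfspace_component_lt open_halfspace_component_gt)
  have m: "B \<inter> {x. x \<bullet> i < c} \<in> lmeasurable" "B \<inter> {x. x \<bullet> i > c} \<in> lmeasurable"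
    by (auto intro!: lmeasurable_open o bounded_Int assms)
  have "?m B = ?m ((B \<inter> {x. x \<bullet> i < c}) \<union> (B \<inter> {x. x \<bullet> i > c}))"
  proof (rule measure_negligible_symdiff[symmetric])
    show "B \<in> lmeasurable" using assms lmeasurable_open by blast
    show "negligible (sym_diff B ((B \<inter> {x. x \<bullet> i < c}) \<union> (B \<inter> {x. x \<bullet> i > c})))"
      by (rule negligible_subset[OF negligible_standard_hyperplane[OF assms(3), of c]]) auto
  qed
  also have "\<dots> = ?m (B \<inter> {x. x \<bullet> i < c}) + ?m (B \<inter> {x. x \<bullet> i > c})"
    using m by (intro measure_Un_AE) (auto intro!: AE_I2)
  finally show ?thesis .
qed

text \<open>The indicators converge off the null hyperplane through \<open>c\<close> and are
  dominated by the indicator of \<open>B\<close>. The continuity feeds the intermediate value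
  argument in \<open>balanced_cut\<close>.\<close>

lemma continuous_measure_halfspace:
  fixes B :: "'a::euclidean_space set"
  assumes "open B" "bounded B" "i \<in> Basis"
  shows "continuous_on UNIV (\<lambda>c. measure lebesgue (B \<inter> {x. x \<bullet> i < c}))"
proof -
  let ?m = "measure lebesgue :: 'a set \<Rightarrow> real"
  have B: "B \<in> lmeasurable" using assms lmeasurable_open by blast
  have "(\<lambda>n. ?m (B \<inter> {x. x \<bullet> i < X n})) \<longlonglongrightarrow> ?m (B \<inter> {x. x \<bullet> i < c})"
    if X: "X \<longlonglongrightarrow> c" for X c
  proof -
    have ms: "B \<inter> {x. x \<bullet> i < c} \<in> lmeasurable" for c
      by (intro lmeasurable_open bounded_Int disjI1 assms(2) open_Int assms(1) open_halfspace_component_lt)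
    have eq: "?m (B \<inter> {x. x \<bullet> i < c}) = integral\<^sup>L lebesgue (indicator (B \<inter> {x. x \<bullet> i < c}))" for c
      using ms[of c] by simp
    show ?thesis unfolding eq
    proof (rule integral_dominated_convergence[where w="indicator B"])
      show "integrable lebesgue (indicator B :: 'a \<Rightarrow> real)" using B lmeasurable_iff_integrable by blast
      have "negligible {x::'a. x \<bullet> i = c}" using assms(3) by blast
      then have "AE x in lebesgue. x \<bullet> i \<noteq> c"
        unfolding negligible_iff_null_sets using AE_not_in by force
      then show "AE x in lebesgue. (\<lambda>n. indicat_real (B \<inter> {x. x \<bullet> i < X n}) x) \<longlonglongrightarrow> indicat_real (B \<inter> {x. x \<bullet> i < c}) x"
      proof (eventually_elim)
        fix x :: 'a assume "x \<bullet> i \<noteq> c"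
        then consider "x \<bullet> i < c" | "x \<bullet> i > c" by linarith
        then have "\<forall>\<^sub>F n in sequentially. indicat_real (B \<inter> {x. x \<bullet> i < c}) x = indicat_real (B \<inter> {x. x \<bullet> i < X n}) x"
        proof cases
          case 1
          then show ?thesis using order_tendstoD(1)[OF X 1] by (auto elim!: eventually_mono simp: indicator_def)
        next
          case 2
          then show ?thesis using order_tendstoD(2)[OF X 2] by (auto elim!: eventually_mono simp: indicator_def)
        qed
        then show "(\<lambda>n. indicat_real (B \<inter> {x. x \<bullet> i < X n}) x) \<longlonglongrightarrow> indicat_real (B \<inter> {x. x \<bullet> i < c}) x"
          by (rule Lim_transform_eventually[OF tendsto_const])
      qed
    qed (use ms in \<open>auto intro!: AE_I2 simp: indicator_def fmeasurableD\<close>)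
  qed
  then show ?thesis unfolding continuous_on_sequentially comp_def by auto
qed

lemma balanced_cut:
  fixes B :: "'a::euclidean_space set"
  assumes "open B" "bounded B" "i \<in> Basis" "0 \<le> l" "l \<le> 1"
  shows "\<exists>c. measure lebesgue (B \<inter> {x. x \<bullet> i < c}) = l * measure lebesgue B \<and>
             measure lebesgue (B \<inter> {x. x \<bullet> i > c}) = (1 - l) * measure lebesgue B"
proof -
  let ?m = "measure lebesgue :: 'a set \<Rightarrow> real"
  obtain r where r: "\<And>x. x \<in> B \<Longrightarrow> norm x < r" "r > 0" using assms(2) bounded_pos_less by blast
  have xi: "\<bar>x \<bullet> i\<bar> < r" if "x \<in> B" for x
    using r that Basis_le_norm[OF assms(3), of x] by force
  have "\<exists>c\<ge>-r. c \<le> r \<and> ?m (B \<inter> {x. x \<bullet> i < c}) = l * ?m B"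
  proof (rule IVT')
    have "B \<inter> {x. x \<bullet> i < - r} = {}" "B \<inter> {x. x \<bullet> i < r} = B" using xi by fastforce+
    then show "?m (B \<inter> {x. x \<bullet> i < - r}) \<le> l * ?m B"
       "l * ?m B \<le> ?m (B \<inter> {x. x \<bullet> i < r})"
      using assms by (auto simp: mult_left_le_one_le)
    show "- r \<le> r" using r by simp
    show "continuous_on {- r..r} (\<lambda>c. ?m (B \<inter> {x. x \<bullet> i < c}))"
      using continuous_measure_halfspace[OF assms(1-3)] continuous_on_subset by blast
  qed
  then obtain c where c: "?m (B \<inter> {x. x \<bullet> i < c}) = l * ?m B" by blast
  then show ?thesis using measure_cut[OF assms(1-3), of c] by (intro exI[of _ c]) (auto simp: algebra_simps)
qed

text \<open>With the power on the left, the right side is linear in the measure, so the inequalities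
  for the two pieces of a cut can simply be added.\<close>

definition brunn_minkowski :: "'a::euclidean_space set \<Rightarrow> 'a set \<Rightarrow> bool" where
  "brunn_minkowski A B \<longleftrightarrow> (root DIM('a) (measure lebesgue A) + root DIM('a) (measure lebesgue B)) ^ DIM('a)
      \<le> measure lebesgue (msum A B)"

lemma msum_commute: "msum A B = msum B A"
  by (intro set_eqI iffI; clarsimp; metis add.commute)

lemma brunn_minkowski_commute: "brunn_minkowski A B \<longleftrightarrow> brunn_minkowski B A"
  unfolding brunn_minkowski_def by (subst msum_commute) (simp add: add.commute)

lemma open_msum: "open A \<Longrightarrow> open (msum A B)"
proof -
  assume "open A"
  have "msum A B = (\<Union>y\<in>B. (\<lambda>x. y + x) ` A)"
    by (intro set_eqI iffI; clarsimp simp: image_iff; metis add.commute)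
  then show ?thesis using \<open>open A\<close> by (auto intro!: open_UN open_translation)
qed

lemma bounded_msum: "bounded A \<Longrightarrow> bounded B \<Longrightarrow> bounded (msum A B)"
  using bounded_plus[of A B] by (rule bounded_subset) force+

lemma measure_open_pos: "open A \<Longrightarrow> bounded A \<Longrightarrow> A \<noteq> {} \<Longrightarrow> measure lebesgue (A::'a::euclidean_space set) > 0"
  using open_not_negligible[of A] negligible_iff_measure lmeasurable_open
  by (metis measure_nonneg order_less_le)

text \<open>The Minkowski sum contains a box with sides \<open>X i + Y i\<close>. The
  arithmetic-geometric mean inequality is applied to the ratios \<open>X i / (X i + Y i)\<close> and
  to \<open>Y i / (X i + Y i)\<close>, whose averages add up to 1.\<close>

lemma brunn_minkowski_box:
  fixes a b c d :: "'a::euclidean_space"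
  assumes "box a b \<noteq> {}" "box c d \<noteq> {}"
  shows "brunn_minkowski (box a b) (box c d)"
proof -
  let ?n = "DIM('a)"
  have ab: "\<And>i. i\<in>Basis \<Longrightarrow> a\<bullet>i < b\<bullet>i" "\<And>i. i\<in>Basis \<Longrightarrow> c\<bullet>i < d\<bullet>i" using assms by (auto simp: box_ne_empty)
  define X where "X i = (b - a) \<bullet> i" for i
  define Y where "Y i = (d - c) \<bullet> i" for i
  have XY: "X i > 0" "Y i > 0" if "i \<in> Basis" for i using ab that by (auto simp: X_def Y_def inner_diff_left)
  have sub: "box (a+c) (b+d) \<subseteq> msum (box a b) (box c d)"
  proof
    fix z assume z: "z \<in> box (a+c) (b+d)"
    \<comment> \<open>In each coordinate the offset of \<open>z\<close> from the corner
      \<open>a + c\<close> is shared between the two summands in the ratio of their side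
      lengths.\<close>
    define x where "x = (\<Sum>i\<in>Basis. (a\<bullet>i + (z\<bullet>i - a\<bullet>i - c\<bullet>i) * (X i / (X i + Y i))) *\<^sub>R i)"
    have xi: "x \<bullet> i = a\<bullet>i + (z\<bullet>i - a\<bullet>i - c\<bullet>i) * (X i / (X i + Y i))" if "i \<in> Basis" for i
      using that by (simp add: x_def)
    have *: "a\<bullet>i < x\<bullet>i \<and> x\<bullet>i < b\<bullet>i \<and> c\<bullet>i < (z-x)\<bullet>i \<and> (z-x)\<bullet>i < d\<bullet>i" if i: "i \<in> Basis" for i
    proof -
      define w where "w = z\<bullet>i - a\<bullet>i - c\<bullet>i"
      have w: "0 < w" "w < X i + Y i" using z i by (auto simp: mem_box w_def X_def Y_def inner_diff_left inner_add_left algebra_simps)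
      have p: "X i > 0" "Y i > 0" using XY i by auto
      have 1: "0 < w * (X i / (X i + Y i))" using w p by simp
      have 2: "w * (X i / (X i + Y i)) < X i" using w p mult_strict_right_mono[OF w(2) p(1)] by (simp add: field_simps)
      have 3: "w - w * (X i / (X i + Y i)) = w * (Y i / (X i + Y i))" using p by (simp add: field_simps)
      have 4: "0 < w * (Y i / (X i + Y i))" using w p by simp
      have 5: "w * (Y i / (X i + Y i)) < Y i" using w p mult_strict_right_mono[OF w(2) p(2)] by (simp add: field_simps)
      have xw: "x\<bullet>i = a\<bullet>i + w * (X i / (X i + Y i))" using xi[OF i] w_def by simp
      have zw: "(z-x)\<bullet>i = c\<bullet>i + w * (Y i / (X i + Y i))" using 3 xw by (simp add: inner_diff_left w_def)
      show ?thesis unfolding xw zw using 1 2 4 5 by (auto simp: X_def Y_def inner_diff_left)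
    qed
    then have "x \<in> box a b" "z - x \<in> box c d" by (auto simp: mem_box)
    moreover have "z = x + (z - x)" by simp
    ultimately show "z \<in> msum (box a b) (box c d)" by blast
  qed
  have m1: "measure lebesgue (box a b) = prod X Basis" "measure lebesgue (box c d) = prod Y Basis"
    using ab by (auto simp: X_def Y_def measure_lborel_box_eq less_imp_le)
  have m2: "measure lebesgue (box (a+c) (b+d)) = (\<Prod>i\<in>Basis. X i + Y i)"
    using ab by (auto simp: X_def Y_def measure_lborel_box_eq less_imp_le inner_add_left inner_diff_left add_mono intro!: prod.cong)
  let ?P = "\<Prod>i\<in>Basis. X i + Y i"
  have P: "?P > 0" using XY by (intro prod_pos) (auto intro: add_pos_pos)
  have rt: "root ?n x = x powr (1 / ?n)" if "x \<ge> 0" for x using that by (simp add: root_powr_inverse powr_def)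
  have amgm: "root ?n (prod Z Basis / ?P) \<le> (\<Sum>i\<in>Basis. Z i / (X i + Y i)) / ?n"
    if Z: "\<And>i. i \<in> Basis \<Longrightarrow> Z i \<ge> 0" for Z :: "'a \<Rightarrow> real"
  proof -
    have nn: "0 \<le> Z i / (X i + Y i)" if "i\<in>Basis" for i using XY[OF that] Z[OF that] by simp
    have "root ?n (prod Z Basis / ?P) = (\<Prod>i\<in>Basis. Z i / (X i + Y i)) powr (1 / ?n)"
      unfolding prod_dividef[symmetric] by (rule rt) (auto intro!: prod_nonneg nn)
    also have "\<dots> \<le> (\<Sum>i\<in>Basis. (Z i / (X i + Y i)) / ?n)"
      by (rule arith_geom_mean) (use nn in auto)
    finally show ?thesis by (simp add: sum_divide_distrib)
  qed
  have "root ?n (prod X Basis / ?P) + root ?n (prod Y Basis / ?P) \<le> (\<Sum>i\<in>Basis. X i / (X i + Y i)) / ?n + (\<Sum>i\<in>Basis. Y i / (X i + Y i)) / ?n"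
    by (intro add_mono amgm) (use XY in \<open>auto intro: less_imp_le\<close>)
  also have "\<dots> = (\<Sum>i\<in>(Basis::'a set). 1) / ?n"
    unfolding add_divide_distrib[symmetric] sum.distrib[symmetric]
    by (intro arg_cong2[where f="(/)"] sum.cong refl) (use XY in \<open>force simp: field_simps\<close>)
  also have "\<dots> = 1" by simp
  finally have "(root ?n (prod X Basis) + root ?n (prod Y Basis)) / root ?n ?P \<le> 1"
    by (simp add: real_root_divide add_divide_distrib)
  then have le: "root ?n (prod X Basis) + root ?n (prod Y Basis) \<le> root ?n ?P"
    using P by (simp add: field_simps)
  have nn: "prod X Basis \<ge> 0" "prod Y Basis \<ge> 0" using XY by (auto intro!: prod_nonneg intro: less_imp_le)
  have "(root ?n (prod X Basis) + root ?n (prod Y Basis)) ^ ?n \<le> (root ?n ?P) ^ ?n"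
    by (intro power_mono le add_nonneg_nonneg real_root_ge_zero nn)
  also have "\<dots> = ?P" using P by (simp add: real_root_pow_pos)
  also have "\<dots> \<le> measure lebesgue (msum (box a b) (box c d))"
    unfolding m2[symmetric] by (rule measure_mono_fmeasurable[OF sub]) (auto intro!: lmeasurable_open bounded_msum open_msum)
  finally show ?thesis unfolding brunn_minkowski_def m1 .
qed

text \<open>Cut \<open>A\<close> by a coordinate hyperplane and \<open>B\<close> by a parallel one dividing it in the same
  proportion: the Minkowski sums of corresponding halves lie on different sides of a hyperplane, and
  by homogeneity the inequalities for the halves add up to the one for \<open>A\<close> and \<open>B\<close>.\<close>
lemma brunn_minkowski_glue:
  fixes A B :: "'a::euclidean_space set"
  assumes A: "open A" "bounded A" and B: "open B" "bounded B" "B \<noteq> {}" and i: "i \<in> Basis"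
    and ne: "A \<inter> {x. x \<bullet> i < c} \<noteq> {}" "A \<inter> {x. x \<bullet> i > c} \<noteq> {}"
    and IH1: "\<And>c'. B \<inter> {x. x \<bullet> i < c'} \<noteq> {} \<Longrightarrow> brunn_minkowski (A \<inter> {x. x \<bullet> i < c}) (B \<inter> {x. x \<bullet> i < c'})"
    and IH2: "\<And>c'. B \<inter> {x. x \<bullet> i > c'} \<noteq> {} \<Longrightarrow> brunn_minkowski (A \<inter> {x. x \<bullet> i > c}) (B \<inter> {x. x \<bullet> i > c'})"
  shows "brunn_minkowski A B"
proof -
  let ?n = "DIM('a)" and ?m = "measure lebesgue :: 'a set \<Rightarrow> real"
  define A1 where "A1 = A \<inter> {x. x \<bullet> i < c}"
  define A2 where "A2 = A \<inter> {x. x \<bullet> i > c}"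
  have o12: "open A1" "open A2" "bounded A1" "bounded A2"
    unfolding A1_def A2_def by (auto intro!: open_Int A open_halfspace_component_lt open_halfspace_component_gt bounded_Int)
  have pos: "?m A1 > 0" "?m A2 > 0" using measure_open_pos[OF o12(1,3)] measure_open_pos[OF o12(2,4)] ne unfolding A1_def A2_def by blast+
  have sumA: "?m A = ?m A1 + ?m A2" unfolding A1_def A2_def by (rule measure_cut[OF A i])
  define l where "l = ?m A1 / ?m A"
  have l: "0 < l" "l < 1" "?m A1 = l * ?m A" "?m A2 = (1 - l) * ?m A"
    using pos sumA by (auto simp: l_def field_simps)
  obtain c' where c': "?m (B \<inter> {x. x \<bullet> i < c'}) = l * ?m B" "?m (B \<inter> {x. x \<bullet> i > c'}) = (1 - l) * ?m B"
    using balanced_cut[OF B(1,2) i, of l] l by auto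
  define B1 where "B1 = B \<inter> {x. x \<bullet> i < c'}"
  define B2 where "B2 = B \<inter> {x. x \<bullet> i > c'}"
  have mB: "?m B > 0" using B measure_open_pos by blast
  have "B1 \<noteq> {}" "B2 \<noteq> {}" using c' mB l unfolding B1_def B2_def by (auto simp: zero_less_mult_iff)
  then have bm: "brunn_minkowski A1 B1" "brunn_minkowski A2 B2" using IH1 IH2 unfolding A1_def A2_def B1_def B2_def by auto
  have oB: "open B1" "open B2" "bounded B1" "bounded B2"
    unfolding B1_def B2_def by (auto intro!: open_Int B open_halfspace_component_lt open_halfspace_component_gt bounded_Int)
  define T where "T = (root ?n (?m A) + root ?n (?m B)) ^ ?n"
  have scale: "(root ?n (s * ?m A) + root ?n (s * ?m B)) ^ ?n = s * T" if "s \<ge> 0" for s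
    using that by (simp add: real_root_mult T_def power_mult_distrib flip: distrib_left)
  have "T = l * T + (1 - l) * T" by (simp add: algebra_simps)
  also have "\<dots> \<le> ?m (msum A1 B1) + ?m (msum A2 B2)"
    using bm scale[of l] scale[of "1-l"] l c' unfolding brunn_minkowski_def B1_def[symmetric] B2_def[symmetric] by (simp add: add_mono)
  also have "\<dots> = ?m (msum A1 B1 \<union> msum A2 B2)"
  proof (rule measure_Un_AE[symmetric])
    have "msum A1 B1 \<inter> msum A2 B2 = {}"
      by (auto simp: A1_def A2_def B1_def B2_def) (metis add_strict_mono inner_add_left order_less_asym)
    then show "AE x in lebesgue. x \<notin> msum A1 B1 \<or> x \<notin> msum A2 B2" by (intro AE_I2) blast
  qed (intro lmeasurable_open bounded_msum open_msum o12 oB)+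
  also have "\<dots> \<le> ?m (msum A B)"
  proof (rule measure_mono_fmeasurable)
    show "msum A1 B1 \<union> msum A2 B2 \<subseteq> msum A B" unfolding A1_def A2_def B1_def B2_def by blast
    show "msum A1 B1 \<union> msum A2 B2 \<in> sets lebesgue"
      by (intro sets.Un fmeasurableD lmeasurable_open bounded_msum open_msum o12 oB)
    show "msum A B \<in> lmeasurable"
      by (intro lmeasurable_open bounded_msum open_msum A B)
  qed
  finally show ?thesis unfolding brunn_minkowski_def T_def .
qed

text \<open>Induction on the total number of boxes. Whichever set has at least two boxes is split so
  that both halves have fewer; the parallel cut of the other set does not increase its count,
  wherever it falls.\<close>

lemma brunn_minkowski_box_union:
  fixes A B :: "'a::euclidean_space set"
  assumes "box_union N A" "box_union M B" "A \<noteq> {}" "B \<noteq> {}"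
  shows "brunn_minkowski A B"
  using assms
proof (induction "N + M" arbitrary: N M A B rule: less_induct)
  case less
  note ob = box_union_open[OF less.prems(1)] box_union_bounded[OF less.prems(1)]
    box_union_open[OF less.prems(2)] box_union_bounded[OF less.prems(2)]
  consider (split1) i c where "i \<in> Basis" "N > 0" "box_union (N - 1) (A \<inter> {x. x \<bullet> i < c})"
      "box_union (N - 1) (A \<inter> {x. x \<bullet> i > c})" "A \<inter> {x. x \<bullet> i < c} \<noteq> {}" "A \<inter> {x. x \<bullet> i > c} \<noteq> {}"
    | (split2) i c where "i \<in> Basis" "M > 0" "box_union (M - 1) (B \<inter> {x. x \<bullet> i < c})"
      "box_union (M - 1) (B \<inter> {x. x \<bullet> i > c})" "B \<inter> {x. x \<bullet> i < c} \<noteq> {}" "B \<inter> {x. x \<bullet> i > c} \<noteq> {}"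
    | (boxes) a b c d where "A = box a b" "B = box c d"
    using box_union_split[OF less.prems(1,3)] box_union_split[OF less.prems(2,4)] by metis
  then show ?case
  proof cases
    case split1
    have "N - 1 + M < N + M" using split1 by simp
    note IH = less.hyps[OF this]
    show ?thesis
      by (rule brunn_minkowski_glue[OF ob less.prems(4) split1(1,5,6)])
        (rule IH[OF split1(3) box_union_cut[OF less.prems(2) box_Int_halfspace_lt[OF split1(1)]] split1(5)]
          IH[OF split1(4) box_union_cut[OF less.prems(2) box_Int_halfspace_gt[OF split1(1)]] split1(6)], assumption)+
  next
    case split2
    have "M - 1 + N < N + M" using split2 by simp
    note IH = less.hyps[OF this]
    show ?thesis
      by (subst brunn_minkowski_commute, rule brunn_minkowski_glue[OF ob(3,4,1,2) less.prems(3) split2(1,5,6)])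
        (rule IH[OF split2(3) box_union_cut[OF less.prems(1) box_Int_halfspace_lt[OF split2(1)]] split2(5)]
          IH[OF split2(4) box_union_cut[OF less.prems(1) box_Int_halfspace_gt[OF split2(1)]] split2(6)], assumption)+
  next
    case boxes
    then show ?thesis using brunn_minkowski_box less.prems by blast
  qed
qed

section \<open>From unions of boxes to open sets, and the parallel-set inequality\<close>

text \<open>Finite unions of closed boxes exhaust \<open>A\<close> in measure. A division makes such
  a union nonoverlapping, and passing to interiors removes only the null boundaries.\<close>

lemma box_union_approx:
  fixes A :: "'a::euclidean_space set"
  assumes "open A" "bounded A" "A \<noteq> {}" "e > 0"
  shows "\<exists>N A'. box_union N A' \<and> A' \<subseteq> A \<and> A' \<noteq> {} \<and> measure lebesgue A' > measure lebesgue A - e"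
proof -
  let ?m = "measure lebesgue :: 'a set \<Rightarrow> real"
  obtain \<D> where D: "countable \<D>" "\<D> \<subseteq> Pow A" "\<And>X. X \<in> \<D> \<Longrightarrow> \<exists>a b. X = cbox a b" "\<Union>\<D> = A"
    using open_countable_Union_open_cbox[OF assms(1)] by metis
  have "\<D> \<noteq> {}" using D(4) assms(3) by auto
  define F where "F n = (\<Union>k\<le>n. from_nat_into \<D> k)" for n
  have Fk: "\<exists>a b. from_nat_into \<D> k = cbox a b" for k using D(3) from_nat_into[OF \<open>\<D> \<noteq> {}\<close>] by blast
  have meas: "range F \<subseteq> sets lebesgue"
  proof -
    have "from_nat_into \<D> k \<in> sets lebesgue" for k using Fk[of k] by auto
    then show ?thesis unfolding F_def by blast
  qed
  have UF: "(\<Union>n. F n) = A"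
  proof -
    have "(\<Union>n. F n) = \<Union>(range (from_nat_into \<D>))" unfolding F_def by auto
    then show ?thesis using range_from_nat_into[OF \<open>\<D> \<noteq> {}\<close> D(1)] D(4) by simp
  qed
  have Afin: "A \<in> lmeasurable" using assms lmeasurable_open by blast
  have "(\<lambda>n. ?m (F n)) \<longlonglongrightarrow> ?m (\<Union>n. F n)"
    by (rule Lim_measure_incseq[OF meas])
      (use Afin UF in \<open>auto simp: incseq_def F_def fmeasurable_def intro: order_trans\<close>)
  then have lim: "(\<lambda>n. ?m (F n)) \<longlonglongrightarrow> ?m A" using UF by simp
  \<comment> \<open>The cap by the measure of \<open>A\<close> forces the approximating set to have
    positive measure, hence to be nonempty.\<close>
  define e' where "e' = min e (?m A)"
  have e': "e' > 0" "e' \<le> e" "e' \<le> ?m A" using assms measure_open_pos[of A] by (auto simp: e'_def)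
  obtain n where n: "?m (F n) > ?m A - e'"
    using order_tendstoD(1)[OF lim, of "?m A - e'"] e' by (auto simp: eventually_sequentially)
  obtain p where p: "p division_of (\<Union>(from_nat_into \<D> ` {..n}))"
    using elementary_unions_intervals[of "from_nat_into \<D> ` {..n}"] Fk by (metis (no_types, lifting) finite_atMost finite_imageI imageE)
  have pF: "p division_of F n" using p unfolding F_def .
  define A' where "A' = \<Union>(interior ` p - {{}})"
  have fin: "finite p" using pF by blast
  have bu: "box_union (card (interior ` p - {{}})) A'"
    unfolding box_union_def A'_def
  proof (intro exI[of _ "interior ` p - {{}}"] conjI ballI)
    show "disjoint (interior ` p - {{}})"
      using pF unfolding division_of_def pairwise_def disjnt_def by (metis (no_types, lifting) Diff_iff imageE)
    show "\<exists>a b. K = box a b" if "K \<in> interior ` p - {{}}" for K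
      using that division_ofD(4)[OF pF] interior_cbox by (metis DiffD1 imageE)
  qed (use fin in auto)
  have sub: "A' \<subseteq> F n" unfolding A'_def using division_ofD(2)[OF pF] interior_subset by blast
  have FA: "F n \<subseteq> A" using UF by blast
  have "?m A' = ?m (F n)"
  proof (rule measure_negligible_symdiff)
    show "F n \<in> lmeasurable" using FA Afin meas by (meson fmeasurableI2 range_subsetD)
    have "sym_diff (F n) A' \<subseteq> \<Union>((\<lambda>K. K - interior K) ` p)"
    proof
      fix y assume "y \<in> sym_diff (F n) A'"
      then have y: "y \<in> F n" "y \<notin> A'" using sub by auto
      then obtain K where "K \<in> p" "y \<in> K" using division_ofD(6)[OF pF] by blast
      moreover have "y \<notin> interior K" using y(2) \<open>K \<in> p\<close> unfolding A'_def by auto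
      ultimately show "y \<in> \<Union>((\<lambda>K. K - interior K) ` p)" by blast
    qed
    moreover have "negligible (\<Union>((\<lambda>K. K - interior K) ` p))"
    proof (rule negligible_Union)
      show "negligible t" if "t \<in> (\<lambda>K. K - interior K) ` p" for t
      proof -
        from that obtain K where K: "t = K - interior K" "K \<in> p" by (rule imageE)
        then obtain a b where "K = cbox a b" using division_ofD(4)[OF pF] by blast
        with K(1) have "t = K - interior K" "K = cbox a b" by auto
        then show ?thesis using null_sets_cbox_Diff_box[of a b]
          by (metis interior_cbox negligible_iff_null_sets null_sets_completionI)
      qed
    qed (use fin in auto)
    ultimately show "negligible (sym_diff (F n) A')" using negligible_subset by blast
  qed
  then have "?m A' > ?m A - e'" using n by simp
  then have m: "?m A' > ?m A - e" "?m A' > 0" using e' by auto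
  then have "A' \<noteq> {}" by auto
  then show ?thesis using bu m sub FA by blast
qed

theorem brunn_minkowski_open:
  fixes A B :: "'a::euclidean_space set"
  assumes "open A" "bounded A" "A \<noteq> {}" "open B" "bounded B" "B \<noteq> {}"
  shows "(root DIM('a) (measure lebesgue A) + root DIM('a) (measure lebesgue B)) ^ DIM('a)
      \<le> measure lebesgue (msum A B)"
proof -
  let ?n = "DIM('a)" and ?m = "measure lebesgue :: 'a set \<Rightarrow> real"
  \<comment> \<open>\<open>max 0\<close> keeps the base nonnegative, so that the power is monotone
    even when \<open>e\<close> exceeds a measure.\<close>
  define h where "h e = (root ?n (max 0 (?m A - e)) + root ?n (max 0 (?m B - e))) ^ ?n" for e
  have "h e \<le> ?m (msum A B)" if "e > 0" for e
  proof -
    obtain N A' where A': "box_union N A'" "A' \<subseteq> A" "A' \<noteq> {}" "?m A' > ?m A - e"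
      using box_union_approx[OF assms(1-3) \<open>e > 0\<close>] by blast
    obtain M B' where B': "box_union M B'" "B' \<subseteq> B" "B' \<noteq> {}" "?m B' > ?m B - e"
      using box_union_approx[OF assms(4-6) \<open>e > 0\<close>] by blast
    have "h e \<le> (root ?n (?m A') + root ?n (?m B')) ^ ?n"
      unfolding h_def using A' B' by (intro power_mono add_mono) (auto intro!: real_root_le_mono add_nonneg_nonneg)
    also have "\<dots> \<le> ?m (msum A' B')" using brunn_minkowski_box_union[OF A'(1) B'(1) A'(3) B'(3)] unfolding brunn_minkowski_def .
    also have "\<dots> \<le> ?m (msum A B)"
    proof (rule measure_mono_fmeasurable)
      show "msum A' B' \<subseteq> msum A B" using A' B' by blast
      have "open (msum A' B')" using A' box_union_open open_msum by blast
      then show "msum A' B' \<in> sets lebesgue" by simp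
      show "msum A B \<in> lmeasurable" by (intro lmeasurable_open bounded_msum open_msum assms)
    qed
    finally show ?thesis .
  qed
  moreover have "(h \<longlongrightarrow> (root ?n (max 0 (?m A - 0)) + root ?n (max 0 (?m B - 0))) ^ ?n) (at_right 0)"
    unfolding h_def by (intro tendsto_intros)
  ultimately show ?thesis
    by (intro tendsto_upperbound[of h _ "at_right 0"]) (auto intro!: eventually_at_right_less[THEN eventually_mono])
qed

text \<open>Brunn-Minkowski with a ball of radius \<open>t\<close>, keeping only the first-order
  term of the binomial expansion. The coefficient of \<open>t\<close> is the perimeter of the ball
  with the volume of \<open>A\<close>, which is why the constant is sharp.\<close>

lemma measure_parallel_set_ge:
  fixes A :: "'a::euclidean_space set"
  assumes "open A" "bounded A" "A \<noteq> {}" "t > 0"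
  shows "measure lebesgue A + real DIM('a) * t * root DIM('a) (unit_ball_vol DIM('a)) * root DIM('a) (measure lebesgue A) ^ (DIM('a) - 1)
      \<le> measure lebesgue (msum A (ball 0 t))"
proof -
  let ?m = "measure lebesgue :: 'a set \<Rightarrow> real"
  let ?n = "DIM('a)"
  obtain k where k: "?n = Suc k" using DIM_positive[where 'a='a] by (metis Suc_pred)
  define x where "x = root ?n (?m A)"
  define y where "y = root ?n (?m (ball (0::'a) t))"
  have xy: "x \<ge> 0" "y \<ge> 0" by (auto simp: x_def y_def)
  have "y = root ?n (unit_ball_vol ?n) * t"
    using assms(4) by (simp add: y_def content_ball real_root_mult real_root_power_cancel)
  moreover have "x ^ ?n = ?m A" by (simp add: x_def real_root_pow_pos2)
  moreover have "(x + y) ^ ?n \<ge> x ^ ?n + ?n * x ^ k * y"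
  proof -
    have "(x + y) ^ Suc k \<ge> x ^ Suc k + Suc k * x ^ k * y" for k
    proof (induction k)
      case (Suc k)
      have "(x + y) ^ Suc (Suc k) \<ge> (x + y) * (x ^ Suc k + Suc k * x ^ k * y)"
        using Suc xy by (simp add: mult_left_mono)
      moreover have "(x + y) * (x ^ Suc k + Suc k * x ^ k * y) = x ^ Suc (Suc k) + Suc (Suc k) * x ^ Suc k * y + Suc k * x ^ k * y * y"
        by (simp add: algebra_simps)
      moreover have "Suc k * x ^ k * y * y \<ge> 0" using xy by simp
      ultimately show ?case by linarith
    qed simp
    then show ?thesis unfolding k by simp
  qed
  moreover have "(x + y) ^ ?n \<le> ?m (msum A (ball 0 t))"
    unfolding x_def y_def by (rule brunn_minkowski_open) (use assms in auto)
  ultimately show ?thesis unfolding k x_def by (simp add: algebra_simps)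
qed

section \<open>Periodic functions\<close>

lemma periodic_LD: "periodic_L L f \<Longrightarrow> f (x + L *\<^sub>R axis i 1) = f x"
  by (simp add: periodic_L_def)

lemma periodic_int_multiple:
  fixes f :: "real^'d \<Rightarrow> 'b"
  assumes "periodic_L L f"
  shows "f (x + (L * of_int k) *\<^sub>R axis i 1) = f x"
proof -
  have nat: "f (y + (L * of_nat m) *\<^sub>R axis i 1) = f y" for y m
  proof (induction m)
    case (Suc m)
    have "f (y + (L * of_nat (Suc m)) *\<^sub>R axis i 1) = f ((y + (L * of_nat m) *\<^sub>R axis i 1) + L *\<^sub>R axis i 1)"
      by (simp add: algebra_simps)
    then show ?case using periodic_LD[OF assms] Suc by simp
  qed simp
  show ?thesis
  proof (cases "k \<ge> 0")
    case True
    then show ?thesis using nat[of x "nat k"] by simp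
  next
    case False
    then have "(x + (L * of_int k) *\<^sub>R axis i 1) + (L * of_nat (nat (-k))) *\<^sub>R axis i 1 = x"
      by (simp add: algebra_simps flip: scaleR_add_left)
    then show ?thesis using nat[of "x + (L * of_int k) *\<^sub>R axis i 1" "nat (-k)"] by metis
  qed
qed

lemma periodic_lattice:
  fixes f :: "real^'d \<Rightarrow> 'b"
  assumes "periodic_L L f"
  shows "f (x + (\<chi> i. L * of_int (k i))) = f x"
proof -
  have "f (x + (\<Sum>i\<in>S. (L * of_int (k i)) *\<^sub>R axis i 1)) = f x" if "finite S" for S
    using that
  proof (induction S)
    case (insert i S)
    have "f (x + (\<Sum>i\<in>insert i S. (L * of_int (k i)) *\<^sub>R axis i 1))
        = f ((x + (\<Sum>i\<in>S. (L * of_int (k i)) *\<^sub>R axis i 1)) + (L * of_int (k i)) *\<^sub>R axis i 1)"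
      using insert by (simp add: algebra_simps)
    then show ?case using periodic_int_multiple[OF assms] insert by simp
  qed simp
  from this[of UNIV] show ?thesis
    using basis_expansion[of "\<chi> i. L * of_int (k i)"] by (simp add: scalar_mult_eq_scaleR)
qed

lemma periodic_representative:
  fixes x :: "real^'d"
  assumes "L > 0"
  obtains k :: "'d \<Rightarrow> int" where "\<And>i. 0 \<le> (x + (\<chi> i. L * of_int (k i))) $ i" "\<And>i. (x + (\<chi> i. L * of_int (k i))) $ i < L"
proof
  fix i
  let ?k = "\<lambda>i. - \<lfloor>x $ i / L\<rfloor>"
  have "of_int \<lfloor>x $ i / L\<rfloor> \<le> x $ i / L" "x $ i / L < of_int \<lfloor>x $ i / L\<rfloor> + 1" by linarith+
  then have "of_int \<lfloor>x $ i / L\<rfloor> * L \<le> x $ i" "x $ i < (of_int \<lfloor>x $ i / L\<rfloor> + 1) * L"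
    using assms by (metis mult.commute pos_le_divide_eq, metis mult.commute pos_divide_less_eq)
  then show "0 \<le> (x + (\<chi> i. L * of_int (?k i))) $ i" "(x + (\<chi> i. L * of_int (?k i))) $ i < L"
    by (auto simp: algebra_simps)
qed

abbreviation cell_integral :: "real \<Rightarrow> (real^'d \<Rightarrow> 'b::{banach,second_countable_topology}) \<Rightarrow> 'b" where
  "cell_integral L \<equiv> integral\<^sup>L (lebesgue_on (cell L))"

lemma mem_cell: "x \<in> cell L \<longleftrightarrow> (\<forall>i. 0 \<le> x $ i \<and> x $ i \<le> L)"
  by (auto simp: cell_def mem_box_cart)

text \<open>Compactness on an enlarged cube: a lattice translation moves \<open>x\<close> into the
  cell, and a point \<open>y\<close> closer than \<open>L\<close> then stays in the cube of side
  \<open>3 * L\<close>.\<close>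

lemma periodic_uniformly_continuous:
  fixes f :: "real^'d \<Rightarrow> 'b::metric_space"
  assumes "L > 0" "periodic_L L f" "continuous_on UNIV f" "e > 0"
  shows "\<exists>d>0. \<forall>x y. dist x y < d \<longrightarrow> dist (f x) (f y) < e"
proof -
  let ?C = "cbox (\<chi> i. -L) (\<chi> i. 2*L) :: (real^'d) set"
  have "uniformly_continuous_on ?C f"
    by (rule compact_uniformly_continuous) (use assms continuous_on_subset in auto)
  then obtain d where d: "d > 0" "\<And>x y. x \<in> ?C \<Longrightarrow> y \<in> ?C \<Longrightarrow> dist y x < d \<Longrightarrow> dist (f y) (f x) < e"
    unfolding uniformly_continuous_on_def using assms(4) by metis
  show ?thesis
  proof (intro exI[of _ "min d L"] conjI allI impI)
    fix x y :: "real^'d" assume xy: "dist x y < min d L"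
    obtain k :: "'d \<Rightarrow> int" where k: "\<And>i. 0 \<le> (x + (\<chi> i. L * of_int (k i))) $ i" "\<And>i. (x + (\<chi> i. L * of_int (k i))) $ i < L"
      using periodic_representative[OF assms(1)] by metis
    let ?v = "\<chi> i. L * of_int (k i)"
    have "x + ?v \<in> ?C" using k assms(1)
    proof -
      have "- L \<le> (x + ?v) $ i \<and> (x + ?v) $ i \<le> 2 * L" for i using k[of i] assms(1) by linarith
      then show ?thesis by (simp add: mem_box_cart)
    qed
    moreover have "y + ?v \<in> ?C"
    proof -
      have "\<bar>x $ i - y $ i\<bar> < L" for i
        using component_le_norm_cart[of "x - y" i] xy by (simp add: dist_norm)
      then have "-L \<le> (y + ?v) $ i \<and> (y + ?v) $ i \<le> 2 * L" for i
        using k[of i] by (auto simp: abs_less_iff) (smt (verit, best))+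
      then show ?thesis by (simp add: mem_box_cart)
    qed
    moreover have "dist (x + ?v) (y + ?v) < d" using xy by simp
    ultimately have "dist (f (x + ?v)) (f (y + ?v)) < e" using d(2) by blast
    then show "dist (f x) (f y) < e" using periodic_lattice[OF assms(2)] by simp
  qed (use d assms in auto)
qed

lemma periodic_bounded:
  fixes f :: "real^'d \<Rightarrow> 'b::metric_space"
  assumes "L > 0" "periodic_L L f" "continuous_on UNIV f"
  shows "bounded (range f)"
proof -
  have "range f = f ` (cell L)"
  proof -
    have "f x \<in> f ` cell L" for x
    proof -
      obtain k :: "'d \<Rightarrow> int" where k: "\<And>i. 0 \<le> (x + (\<chi> i. L * of_int (k i))) $ i" "\<And>i. (x + (\<chi> i. L * of_int (k i))) $ i < L"
        using periodic_representative[OF assms(1)] by metis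
      then have "x + (\<chi> i. L * of_int (k i)) \<in> cell L" by (simp add: mem_cell less_imp_le)
      then show ?thesis using periodic_lattice[OF assms(2)] by (metis imageI)
    qed
    then show ?thesis by auto
  qed
  moreover have "compact (f ` cell L)"
    by (rule compact_continuous_image) (use assms continuous_on_subset in \<open>auto simp: cell_def\<close>)
  ultimately show ?thesis using compact_imp_bounded by simp
qed

lemma periodic_gradient:
  fixes f :: "real^'d \<Rightarrow> real"
  assumes "periodic_L L f" "\<And>x. (f has_derivative (\<lambda>h. G x \<bullet> h)) (at x)"
  shows "periodic_L L G"
  unfolding periodic_L_def
proof (intro allI)
  fix x :: "real^'d" and i
  have "((\<lambda>y. f (y + L *\<^sub>R axis i 1)) has_derivative (\<lambda>h. G (x + L *\<^sub>R axis i 1) \<bullet> h)) (at x)"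
    by (rule has_derivative_compose[where f="\<lambda>y. y + L *\<^sub>R axis i 1" and f'="\<lambda>h. h", OF _ assms(2), simplified])
       (auto intro!: derivative_eq_intros)
  then have "(f has_derivative (\<lambda>h. G (x + L *\<^sub>R axis i 1) \<bullet> h)) (at x)"
    by (simp add: periodic_LD[OF assms(1)])
  then have "(\<lambda>h. G (x + L *\<^sub>R axis i 1) \<bullet> h) = (\<lambda>h. G x \<bullet> h)"
    using assms(2) has_derivative_unique by blast
  then show "G (x + L *\<^sub>R axis i 1) = G x" by (metis vector_eq_rdot)
qed

lemma continuous_on_gradient:
  fixes f :: "real^'d \<Rightarrow> real"
  assumes "\<And>x. (f has_derivative (\<lambda>h. G x \<bullet> h)) (at x)"
  shows "continuous_on UNIV f"
  using assms by (intro continuous_at_imp_continuous_on) (auto intro: has_derivative_continuous)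

lemma continuous_bounded_on_cell:
  fixes f :: "real^'d \<Rightarrow> 'b::real_normed_vector"
  assumes "continuous_on UNIV f"
  obtains B where "\<And>x. x \<in> cell L \<Longrightarrow> norm (f x) \<le> B"
proof -
  have "compact (f ` cell L)"
    by (rule compact_continuous_image) (use assms continuous_on_subset in \<open>auto simp: cell_def\<close>)
  then show ?thesis using that compact_imp_bounded bounded_iff by (metis (no_types, lifting) imageI)
qed

lemma AE_cell_in_box: "AE x in lborel. x \<in> cell L \<longrightarrow> x \<in> box 0 ((\<chi> i. L)::real^'d)"
proof -
  have "AE x in lborel. x \<notin> cbox 0 (\<chi> i. L) - box 0 ((\<chi> i. L)::real^'d)"
    using null_sets_cbox_Diff_box AE_not_in by blast
  then show ?thesis by eventually_elim (auto simp: cell_def)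
qed

text \<open>Mean value inequality on a ball where uniform continuity keeps the gradient within
  \<open>e\<close> of \<open>G x\<close>. Uniformity in \<open>x\<close> is the point: it lets the
  expansion be integrated over the cell or inserted under a convolution.\<close>

lemma periodic_C1_uniform_expansion:
  fixes f :: "real^'d \<Rightarrow> real"
  assumes "L > 0" and per: "periodic_L L f" and der: "\<And>x. (f has_derivative (\<lambda>h. G x \<bullet> h)) (at x)"
    and cont: "continuous_on UNIV G" and "e > 0"
  shows "\<exists>d>0. \<forall>x h. norm h < d \<longrightarrow> \<bar>f (x + h) - f x - G x \<bullet> h\<bar> \<le> e * norm h"
proof -
  obtain d where d: "d > 0" "\<And>x y. dist x y < d \<Longrightarrow> dist (G x) (G y) < e"
    using periodic_uniformly_continuous[OF assms(1) periodic_gradient[OF per der] cont assms(5)] by blast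
  show ?thesis
  proof (intro exI[of _ d] conjI allI impI d(1))
    fix x h :: "real^'d" assume h: "norm h < d"
    have "norm (f (x + h) - f x - G x \<bullet> (x + h - x)) \<le> norm (x + h - x) * e"
    proof (rule differentiable_bound_linearization[where S="ball x d" and f=f and f'="\<lambda>y v. G y \<bullet> v" and ?x0.0=x])
      show "x + t *\<^sub>R (x + h - x) \<in> ball x d" if "t \<in> {0..1}" for t :: real
        using that h mult_left_le_one_le[of "norm h" t] by (auto simp: dist_norm)
      show "(f has_derivative (\<lambda>v. G y \<bullet> v)) (at y within ball x d)" if "y \<in> ball x d" for y
        using der has_derivative_at_withinI by blast
      show "onorm ((\<lambda>v. G y \<bullet> v) - (\<lambda>v. G x \<bullet> v)) \<le> e" if "y \<in> ball x d" for y
      proof (rule onorm_le)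
        fix v
        have "norm (((\<lambda>v. G y \<bullet> v) - (\<lambda>v. G x \<bullet> v)) v) = norm (G y \<bullet> v - G x \<bullet> v)" by simp
        also have "norm (G y \<bullet> v - G x \<bullet> v) \<le> norm (G y - G x) * norm v"
          by (metis inner_diff_left Cauchy_Schwarz_ineq2 real_norm_def)
        also have "\<dots> \<le> e * norm v"
          using d(2)[of y x] that by (intro mult_right_mono) (auto simp: dist_norm dist_commute norm_minus_commute)
        finally show "norm (((\<lambda>v. G y \<bullet> v) - (\<lambda>v. G x \<bullet> v)) v) \<le> e * norm v" .
      qed
    qed (use d in auto)
    then show "\<bar>f (x + h) - f x - G x \<bullet> h\<bar> \<le> e * norm h" by (simp add: mult.commute)
  qed
qed

section \<open>Translation invariance of integrals over one period\<close>

text \<open>Half-open, so that its integer translates tile space without overlap and slabs can be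
  moved around by exact indicator identities.\<close>

definition hcell :: "real \<Rightarrow> (real^'d) set" where
  "hcell L = {x. \<forall>i. 0 \<le> x $ i \<and> x $ i < L}"

lemma sets_hcell [measurable]: "hcell L \<in> sets borel"
  unfolding hcell_def by measurable

lemma sets_cell [measurable]: "cell L \<in> sets borel"
  unfolding cell_def by measurable

lemma nn_integral_hcell:
  fixes h :: "real^'d \<Rightarrow> ennreal"
  shows "(\<integral>\<^sup>+x\<in>cell L. h x \<partial>lborel) = (\<integral>\<^sup>+x\<in>hcell L. h x \<partial>lborel)"
proof (rule nn_integral_cong_AE)
  have sub: "hcell L \<subseteq> (cell L :: (real^'d) set)" "box 0 (\<chi> i. L) \<subseteq> (hcell L :: (real^'d) set)"
    by (auto simp: hcell_def mem_cell mem_box_cart less_imp_le)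
  from AE_cell_in_box[of L] show "AE x in lborel. h x * indicator (cell L) x = h x * indicator (hcell L) x"
    by eventually_elim (use sub in \<open>auto simp: indicator_def\<close>)
qed

lemma nn_integral_lborel_shift:
  fixes g :: "'a::euclidean_space \<Rightarrow> ennreal"
  assumes [measurable]: "g \<in> borel_measurable borel"
  shows "(\<integral>\<^sup>+x. g (x + c) \<partial>lborel) = (\<integral>\<^sup>+x. g x \<partial>lborel)"
proof -
  have "(\<integral>\<^sup>+x. g x \<partial>lborel) = (\<integral>\<^sup>+x. g x \<partial>distr lborel borel ((+) c))"
    by (simp add: lborel_distr_plus)
  also have "\<dots> = (\<integral>\<^sup>+x. g (c + x) \<partial>lborel)" by (subst nn_integral_distr) auto
  finally show ?thesis by (simp add: add.commute)
qed

text \<open>The shifted cell protrudes by the slab between \<open>L\<close> and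
  \<open>L + s\<close>; periodicity moves this slab back to the missing one between 0 and
  \<open>s\<close>.\<close>

lemma nn_integral_periodic_shift1:
  fixes h :: "real^'d \<Rightarrow> ennreal"
  assumes L: "L > 0" and per: "periodic_L L h" and [measurable]: "h \<in> borel_measurable borel" and s: "0 \<le> s" "s \<le> L"
  shows "(\<integral>\<^sup>+x\<in>hcell L. h (x + s *\<^sub>R axis i 1) \<partial>lborel) = (\<integral>\<^sup>+x\<in>hcell L. h x \<partial>lborel)"
proof -
  define e where "e = (axis i 1 :: real^'d)"
  define Q where "Q = (\<lambda>a b. {x::real^'d. (\<forall>j. j \<noteq> i \<longrightarrow> 0 \<le> x $ j \<and> x $ j < L) \<and> a \<le> x $ i \<and> x $ i < b})"
  have [measurable]: "Q a b \<in> sets borel" for a b unfolding Q_def by measurable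
  have hQ: "hcell L = Q 0 L" unfolding hcell_def Q_def by (intro Collect_cong) metis
  have shiftQ: "indicator (Q a b) (x + c *\<^sub>R e) = (indicator (Q (a - c) (b - c)) x :: ennreal)" for a b c x
    unfolding Q_def e_def by (auto simp: indicator_def axis_def)
  have "(\<integral>\<^sup>+x\<in>Q 0 L. h (x + s *\<^sub>R e) \<partial>lborel) = (\<integral>\<^sup>+x. h (x + s *\<^sub>R e) * indicator (Q s (L + s)) (x + s *\<^sub>R e) \<partial>lborel)"
    unfolding shiftQ by simp
  also have "\<dots> = (\<integral>\<^sup>+x. h x * indicator (Q s (L + s)) x \<partial>lborel)"
    by (rule nn_integral_lborel_shift[of "\<lambda>x. h x * indicator (Q s (L+s)) x"]) simp
  also have "\<dots> = (\<integral>\<^sup>+x. h x * indicator (Q s L) x + h x * indicator (Q L (L + s)) x \<partial>lborel)"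
    using s by (intro nn_integral_cong) (auto simp: Q_def indicator_def)
  also have "\<dots> = (\<integral>\<^sup>+x. h x * indicator (Q s L) x \<partial>lborel) + (\<integral>\<^sup>+x. h x * indicator (Q L (L + s)) x \<partial>lborel)"
    by (rule nn_integral_add) auto
  also have "(\<integral>\<^sup>+x. h x * indicator (Q L (L + s)) x \<partial>lborel) = (\<integral>\<^sup>+x. h (x + L *\<^sub>R e) * indicator (Q L (L + s)) (x + L *\<^sub>R e) \<partial>lborel)"
    by (rule nn_integral_lborel_shift[of "\<lambda>x. h x * indicator (Q L (L+s)) x", symmetric]) simp
  also have "\<dots> = (\<integral>\<^sup>+x. h x * indicator (Q 0 s) x \<partial>lborel)"
    unfolding shiftQ by (simp add: e_def periodic_LD[OF per])
  also have "(\<integral>\<^sup>+x. h x * indicator (Q s L) x \<partial>lborel) + \<dots> = (\<integral>\<^sup>+x. h x * indicator (Q s L) x + h x * indicator (Q 0 s) x \<partial>lborel)"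
    by (rule nn_integral_add[symmetric]) auto
  also have "\<dots> = (\<integral>\<^sup>+x. h x * indicator (Q 0 L) x \<partial>lborel)"
    using s by (intro nn_integral_cong) (auto simp: Q_def indicator_def)
  finally show ?thesis unfolding hQ e_def .
qed

lemma periodic_L_shift: "periodic_L L h \<Longrightarrow> periodic_L L (\<lambda>x. h (x + a))"
  unfolding periodic_L_def by (metis add.assoc add.commute)

text \<open>A lattice vector brings the shift into the cell, and the coordinates are then handled
  one at a time by \<open>nn_integral_periodic_shift1\<close>.\<close>

lemma nn_integral_periodic_shift:
  fixes h :: "real^'d \<Rightarrow> ennreal"
  assumes L: "L > 0" and per: "periodic_L L h" and m: "h \<in> borel_measurable borel"
  shows "(\<integral>\<^sup>+x\<in>cell L. h (x + a) \<partial>lborel) = (\<integral>\<^sup>+x\<in>cell L. h x \<partial>lborel)"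
proof -
  have *: "(\<integral>\<^sup>+x\<in>hcell L. h (x + (\<Sum>i\<in>S. s i *\<^sub>R axis i 1)) \<partial>lborel) = (\<integral>\<^sup>+x\<in>hcell L. h x \<partial>lborel)"
    if "finite S" "\<And>i. 0 \<le> s i \<and> s i \<le> L" for S and s :: "'d \<Rightarrow> real"
    using that(1)
  proof (induction S)
    case (insert i S)
    let ?h = "\<lambda>x. h (x + (\<Sum>i\<in>S. s i *\<^sub>R axis i 1))"
    have "(\<integral>\<^sup>+x\<in>hcell L. h (x + (\<Sum>i\<in>insert i S. s i *\<^sub>R axis i 1)) \<partial>lborel) = (\<integral>\<^sup>+x\<in>hcell L. ?h (x + s i *\<^sub>R axis i 1) \<partial>lborel)"
      using insert by (simp add: add.assoc)
    also have "\<dots> = (\<integral>\<^sup>+x\<in>hcell L. ?h x \<partial>lborel)"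
      by (rule nn_integral_periodic_shift1[OF L periodic_L_shift[OF per]]) (use m that in auto)
    finally show ?case using insert by simp
  qed simp
  obtain k :: "'d \<Rightarrow> int" where k: "\<And>i. 0 \<le> (a + (\<chi> i. L * of_int (k i))) $ i" "\<And>i. (a + (\<chi> i. L * of_int (k i))) $ i < L"
    using periodic_representative[OF L] by metis
  let ?v = "a + (\<chi> i. L * of_int (k i))"
  have "h (x + a) = h (x + ?v)" for x
    using periodic_lattice[OF per, of "x + a" k] by (simp add: add.assoc)
  moreover have "?v = (\<Sum>i\<in>UNIV. (?v $ i) *\<^sub>R axis i 1)"
    using basis_expansion[of ?v] by (simp add: scalar_mult_eq_scaleR)
  ultimately have "h (x + a) = h (x + (\<Sum>i\<in>UNIV. (?v $ i) *\<^sub>R axis i 1))" for x by metis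
  then show ?thesis
    unfolding nn_integral_hcell using *[of UNIV "\<lambda>i. ?v $ i"] k by (simp add: less_imp_le)
qed

lemma nn_integral_lebesgue_on_cell:
  fixes h :: "real^'d \<Rightarrow> ennreal"
  assumes "h \<in> borel_measurable borel"
  shows "(\<integral>\<^sup>+x. h x \<partial>lebesgue_on (cell L)) = (\<integral>\<^sup>+x\<in>cell L. h x \<partial>lborel)"
proof -
  have "(\<integral>\<^sup>+x. h x \<partial>lebesgue_on (cell L)) = (\<integral>\<^sup>+x\<in>cell L. h x \<partial>lebesgue)"
    by (rule nn_integral_restrict_space) simp
  also have "\<dots> = (\<integral>\<^sup>+x\<in>cell L. h x \<partial>lborel)"
    by (rule nn_integral_completion)
  finally show ?thesis .
qed

lemma emeasure_cell: "L \<ge> 0 \<Longrightarrow> emeasure lborel (cell L :: (real^'d) set) = ennreal (L ^ CARD('d))"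
proof -
  assume "L \<ge> 0"
  have b: "((\<chi> i. L)::real^'d) \<bullet> b = L" if "b \<in> Basis" for b using that by (auto simp: Basis_vec_def inner_axis)
  show ?thesis unfolding cell_def by (subst emeasure_lborel_cbox) (auto simp: b \<open>L \<ge> 0\<close>)
qed

section \<open>A sharp isoperimetric inequality on the torus\<close>

text \<open>Tonelli for the region below the graph, cut at height \<open>S\<close>. Negative values
  contribute nothing on either side, since \<open>ennreal\<close> sends them to 0 and the range of
  \<open>s\<close> is then empty.\<close>

lemma nn_integral_layer_cake:
  fixes g :: "'a::euclidean_space \<Rightarrow> real"
  assumes [measurable]: "g \<in> borel_measurable borel" "Q \<in> sets borel"
  shows "(\<integral>\<^sup>+s\<in>{0..<S}. emeasure lborel {x\<in>Q. s < g x} \<partial>lborel) = (\<integral>\<^sup>+x\<in>Q. ennreal (min S (g x)) \<partial>lborel)"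
proof -
  have "(\<integral>\<^sup>+s\<in>{0..<S}. emeasure lborel {x\<in>Q. s < g x} \<partial>lborel)
      = (\<integral>\<^sup>+s. (\<integral>\<^sup>+x. indicator {0..<S} s * (indicator Q x * (if s < g x then 1 else 0)) \<partial>lborel) \<partial>lborel)"
  proof (intro nn_integral_cong)
    fix s :: real
    have "emeasure lborel {x\<in>Q. s < g x} = (\<integral>\<^sup>+x. indicator {x\<in>Q. s < g x} x \<partial>lborel)" by simp
    also have "\<dots> = (\<integral>\<^sup>+x. indicator Q x * (if s < g x then 1 else 0) \<partial>lborel)"
      by (intro nn_integral_cong) (auto simp: indicator_def)
    finally show "emeasure lborel {x\<in>Q. s < g x} * indicator {0..<S} s = (\<integral>\<^sup>+x. indicator {0..<S} s * (indicator Q x * (if s < g x then 1 else 0)) \<partial>lborel)"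
      by (subst nn_integral_cmult) (auto simp: mult.commute)
  qed
  also have "\<dots> = (\<integral>\<^sup>+x. (\<integral>\<^sup>+s. indicator {0..<S} s * (indicator Q x * (if s < g x then 1 else 0)) \<partial>lborel) \<partial>lborel)"
    by (rule lborel_pair.Fubini') measurable
  also have "\<dots> = (\<integral>\<^sup>+x\<in>Q. ennreal (min S (g x)) \<partial>lborel)"
  proof (intro nn_integral_cong)
    fix x :: 'a
    have "(\<integral>\<^sup>+s. indicator {0..<S} s * (indicator Q x * (if s < g x then 1 else 0)) \<partial>lborel)
        = (\<integral>\<^sup>+s. indicator Q x * indicator {0..<min S (g x)} s \<partial>lborel)"
      by (intro nn_integral_cong) (auto simp: indicator_def)
    also have "\<dots> = indicator Q x * emeasure lborel {0..<min S (g x)}"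
      by (subst nn_integral_cmult) auto
    also have "emeasure lborel {0..<min S (g x)} = ennreal (min S (g x))"
      by (cases "0 \<le> min S (g x)") (auto simp: ennreal_neg min_def split: if_splits)
    finally show "(\<integral>\<^sup>+s. indicator {0..<S} s * (indicator Q x * (if s < g x then 1 else 0)) \<partial>lborel) = ennreal (min S (g x)) * indicator Q x"
      by (simp add: mult.commute)
  qed
  finally show ?thesis .
qed

lemma emeasure_cube:
  fixes a b :: real
  assumes "a \<le> b"
  shows "emeasure lborel (box (\<chi> i. a) (\<chi> i. b) :: (real^'d) set) = ennreal ((b - a) ^ CARD('d))"
proof -
  have e: "((\<chi> i. c)::real^'d) \<bullet> k = c" if "k \<in> Basis" for k c using that by (auto simp: Basis_vec_def inner_axis)
  show ?thesis by (subst emeasure_lborel_box) (auto simp: e assms inner_diff_left)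
qed

text \<open>For a level \<open>s < S\<close> and a translation \<open>a\<close>, the superlevel set
  of \<open>f\<close> in the open cube has measure at least \<open>V\<close>. Its
  \<open>t\<close>-neighbourhood gains at least \<open>C\<close> in measure and lies in the
  superlevel set of \<open>h\<close> in the cube enlarged by \<open>t\<close>. Integration over
  \<open>s\<close> and then over \<open>a\<close> yields the claim, the enlarged cube accounting for
  the factor \<open>(L + 2 * t) ^ CARD('d)\<close>.\<close>

lemma torus_parallel_inequality:
  fixes f h :: "real^'d \<Rightarrow> real"
  assumes L: "L > 0" and t: "t > 0" and d: "CARD('d) \<ge> 2"
    and per: "periodic_L L f" "periodic_L L h" and cont: "continuous_on UNIV f" "continuous_on UNIV h"
    and f: "\<And>x. 0 \<le> f x" "\<And>x. f x \<le> S" and fh: "\<And>x y. dist x y < t \<Longrightarrow> f y \<le> h x"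
  defines "V \<equiv> measure lebesgue {x\<in>cell L. f x = S}"
  defines "C \<equiv> real CARD('d) * t * root CARD('d) (unit_ball_vol CARD('d)) * root CARD('d) V ^ (CARD('d) - 1)"
  shows "ennreal (L ^ CARD('d)) * ((\<integral>\<^sup>+x\<in>cell L. f x \<partial>lborel) + ennreal (S * C))
      \<le> ennreal ((L + 2 * t) ^ CARD('d)) * (\<integral>\<^sup>+x\<in>cell L. h x \<partial>lborel)"
proof -
  let ?n = "CARD('d)"
  have S: "S \<ge> 0" using f[of 0] by linarith
  have [measurable]: "f \<in> borel_measurable borel" "h \<in> borel_measurable borel"
    using cont by (auto intro: borel_measurable_continuous_onI)
  define Qo where "Qo = (box 0 (\<chi> i. L) :: (real^'d) set)"
  define Qt where "Qt = (box (\<chi> i. -t) (\<chi> i. L + t) :: (real^'d) set)"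
  have [measurable]: "Qo \<in> sets borel" "Qt \<in> sets borel" by (auto simp: Qo_def Qt_def)
  have V0: "V \<ge> 0" unfolding V_def by (rule measure_nonneg)
  have C0: "C \<ge> 0" using t by (auto simp: C_def V_def intro!: mult_nonneg_nonneg)
  have Qo_cell: "(\<integral>\<^sup>+x\<in>Qo. g x \<partial>lborel) = (\<integral>\<^sup>+x\<in>cell L. g x \<partial>lborel)" for g :: "real^'d \<Rightarrow> ennreal"
  proof (rule nn_integral_cong_AE)
    have sub: "Qo \<subseteq> cell L" unfolding Qo_def cell_def by (rule box_subset_cbox)
    from AE_cell_in_box[of L] show "AE x in lborel. g x * indicator Qo x = g x * indicator (cell L) x"
      by eventually_elim (use sub in \<open>auto simp: Qo_def indicator_def\<close>)
  qed
  have level: "emeasure lborel {x\<in>Qo. s < f (x + a)} + ennreal C \<le> emeasure lborel {x\<in>Qt. s < h (x + a)}"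
    if s: "0 \<le> s" "s < S" for s a
  proof -
    define A where "A = {x\<in>Qo. s < f (x + a)}"
    have [measurable]: "A \<in> sets borel" unfolding A_def by measurable
    have fa: "continuous_on UNIV (\<lambda>x. f (x + a))"
      by (rule continuous_on_compose2[OF cont(1)]) (auto intro!: continuous_intros)
    have oA: "open A"
    proof -
      have "open {x. s < f (x + a)}" using fa by (intro open_Collect_less) auto
      then have "open (Qo \<inter> {x. s < f (x + a)})" unfolding Qo_def by blast
      then show ?thesis by (simp add: A_def Int_def)
    qed
    have bA: "bounded A" by (rule bounded_subset[of Qo]) (auto simp: Qo_def A_def)
    have fin: "emeasure lborel X = ennreal (measure lebesgue X)" if "open X" "bounded X" for X :: "(real^'d) set"
      using that emeasure_bounded_finite[of X] by (simp add: emeasure_eq_ennreal_measure less_top)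
    let ?E = "{x. f x = S}"
    have [measurable]: "?E \<in> sets borel" by measurable
    have "emeasure lborel {x\<in>cell L. f x = S} = (\<integral>\<^sup>+x\<in>cell L. indicator ?E x \<partial>lborel)"
    proof -
      have "emeasure lborel {x\<in>cell L. f x = S} = (\<integral>\<^sup>+x. indicator {x\<in>cell L. f x = S} x \<partial>lborel)" by simp
      also have "\<dots> = (\<integral>\<^sup>+x\<in>cell L. indicator ?E x \<partial>lborel)"
        by (intro nn_integral_cong) (auto simp: indicator_def)
      finally show ?thesis .
    qed
    also have "\<dots> = (\<integral>\<^sup>+x\<in>cell L. indicator ?E (x + a) \<partial>lborel)"
      by (rule nn_integral_periodic_shift[OF L, symmetric])
         (use per(1) in \<open>auto simp: periodic_L_def indicator_def\<close>)
    also have "\<dots> = (\<integral>\<^sup>+x\<in>Qo. indicator ?E (x + a) \<partial>lborel)" by (rule Qo_cell[symmetric])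
    also have "\<dots> \<le> (\<integral>\<^sup>+x. indicator A x \<partial>lborel)"
      using s by (intro nn_integral_mono) (auto simp: A_def indicator_def)
    also have "\<dots> = emeasure lborel A" by simp
    finally have le: "emeasure lborel {x\<in>cell L. f x = S} \<le> emeasure lborel A" .
    have VA: "V \<le> measure lebesgue A"
    proof -
      have "{x\<in>cell L. f x = S} \<in> sets borel" by measurable
      then have "V = measure lborel {x\<in>cell L. f x = S}" unfolding V_def by simp
      also have "\<dots> \<le> measure lborel A"
        unfolding Sigma_Algebra.measure_def using emeasure_bounded_finite[OF bA] by (intro enn2real_mono le) auto
      finally show ?thesis by simp
    qed
    let ?M = "msum A (ball 0 t)"
    have "measure lebesgue A + C \<le> measure lebesgue ?M"
    proof (cases "A = {}")
      case True
      then have "V = 0" using VA V0 by simp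
      \<comment> \<open>Dimension at least 2 matters here: the exponent \<open>CARD('d) - 1\<close>
        is positive, so the power of 0 vanishes.\<close>
      then have "C = 0" using d by (simp add: C_def)
      then show ?thesis using True by simp
    next
      case False
      have "C \<le> real ?n * t * root ?n (unit_ball_vol ?n) * root ?n (measure lebesgue A) ^ (?n - 1)"
        unfolding C_def using t VA by (intro mult_left_mono power_mono real_root_le_mono mult_nonneg_nonneg) (use V0 in auto)
      then show ?thesis using measure_parallel_set_ge[OF oA bA False t] by simp
    qed
    then have "ennreal (measure lebesgue A) + ennreal C \<le> ennreal (measure lebesgue ?M)"
      using C0 by (simp flip: ennreal_plus)
    then have "emeasure lborel A + ennreal C \<le> emeasure lborel ?M"
      by (simp only: fin[OF oA bA] fin[OF open_msum[OF oA] bounded_msum[OF bA bounded_ball]])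
    also have "\<dots> \<le> emeasure lborel {x\<in>Qt. s < h (x + a)}"
    proof (rule emeasure_mono)
      show "?M \<subseteq> {x\<in>Qt. s < h (x + a)}"
      proof clarify
        fix x y assume x: "x \<in> A" and y: "y \<in> ball (0::real^'d) t"
        have "\<bar>y $ i\<bar> < t" "0 < x $ i" "x $ i < L" for i
          using component_le_norm_cart[of y i] x y by (auto simp: A_def Qo_def mem_box_cart)
        then have "-t < (x+y) $ i" "(x+y) $ i < L + t" for i
          unfolding vector_add_component by (smt (verit))+
        then have 1: "x + y \<in> Qt" by (simp add: Qt_def mem_box_cart)
        have "f (x + a) \<le> h (x + y + a)" by (rule fh) (use y in \<open>simp add: dist_norm\<close>)
        then show "x + y \<in> Qt \<and> s < h (x + y + a)" using 1 x by (auto simp: A_def)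
      qed
      show "{x\<in>Qt. s < h (x + a)} \<in> sets lborel" by measurable
    qed
    finally show ?thesis unfolding A_def .
  qed
  let ?F = "\<integral>\<^sup>+x\<in>cell L. f x \<partial>lborel" and ?H = "\<integral>\<^sup>+x\<in>cell L. h x \<partial>lborel"
  have slice: "?F + ennreal (S * C) \<le> (\<integral>\<^sup>+x\<in>Qt. h (x + a) \<partial>lborel)" for a
  proof -
    have "?F = (\<integral>\<^sup>+x\<in>cell L. ennreal (f (x + a)) \<partial>lborel)"
      by (rule nn_integral_periodic_shift[OF L, symmetric]) (use per(1) in \<open>auto simp: periodic_L_def\<close>)
    also have "\<dots> = (\<integral>\<^sup>+x\<in>Qo. ennreal (min S (f (x + a))) \<partial>lborel)"
      using f(2) by (simp add: Qo_cell min_absorb2)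
    also have "\<dots> = (\<integral>\<^sup>+s\<in>{0..<S}. emeasure lborel {x\<in>Qo. s < f (x + a)} \<partial>lborel)"
      by (rule nn_integral_layer_cake[symmetric]) auto
    finally have F: "?F = \<dots>" .
    have "ennreal (S * C) = (\<integral>\<^sup>+s\<in>{0..<S}. ennreal C \<partial>lborel)"
      using S C0 by (subst nn_integral_cmult_indicator) (auto simp: ennreal_mult mult.commute)
    then have "?F + ennreal (S * C) = (\<integral>\<^sup>+s. emeasure lborel {x\<in>Qo. s < f (x + a)} * indicator {0..<S} s + ennreal C * indicator {0..<S} s \<partial>lborel)"
      unfolding F by (subst nn_integral_add) auto
    also have "\<dots> \<le> (\<integral>\<^sup>+s\<in>{0..<S}. emeasure lborel {x\<in>Qt. s < h (x + a)} \<partial>lborel)"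
      using level by (intro nn_integral_mono) (auto simp: indicator_def)
    also have "\<dots> = (\<integral>\<^sup>+x\<in>Qt. ennreal (min S (h (x + a))) \<partial>lborel)"
      by (rule nn_integral_layer_cake) auto
    also have "\<dots> \<le> (\<integral>\<^sup>+x\<in>Qt. h (x + a) \<partial>lborel)"
      by (intro nn_integral_mono mult_right_mono ennreal_leI) auto
    finally show ?thesis .
  qed
  \<comment> \<open>Averaging over all translations: for a fixed \<open>x\<close> in the enlarged
    cube, \<open>x + a\<close> runs through a full period, so the inner integral is
    \<open>?H\<close> whatever \<open>x\<close> is.\<close>
  have "ennreal (L ^ ?n) * (?F + ennreal (S * C)) = (\<integral>\<^sup>+a\<in>(cell L :: (real^'d) set). (?F + ennreal (S * C)) \<partial>lborel)"
    using L by (subst nn_integral_cmult_indicator) (auto simp: emeasure_cell mult.commute)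
  also have "\<dots> \<le> (\<integral>\<^sup>+a\<in>cell L. (\<integral>\<^sup>+x\<in>Qt. h (x + a) \<partial>lborel) \<partial>lborel)"
    by (intro nn_integral_mono mult_right_mono slice) auto
  also have "\<dots> = (\<integral>\<^sup>+a. (\<integral>\<^sup>+x. indicator (cell L) a * (ennreal (h (x + a)) * indicator Qt x) \<partial>lborel) \<partial>lborel)"
    by (intro nn_integral_cong, subst nn_integral_cmult) (auto simp: mult.commute)
  also have "\<dots> = (\<integral>\<^sup>+x. (\<integral>\<^sup>+a. indicator (cell L) a * (ennreal (h (x + a)) * indicator Qt x) \<partial>lborel) \<partial>lborel)"
    by (rule lborel_pair.Fubini') measurable
  also have "\<dots> = (\<integral>\<^sup>+x\<in>Qt. ?H \<partial>lborel)"
  proof (intro nn_integral_cong)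
    fix x
    have "(\<integral>\<^sup>+a. indicator (cell L) a * (ennreal (h (x + a)) * indicator Qt x) \<partial>lborel) = (\<integral>\<^sup>+a. indicator Qt x * (ennreal (h (a + x)) * indicator (cell L) a) \<partial>lborel)"
      by (intro nn_integral_cong) (auto simp: mult_ac add.commute)
    also have "\<dots> = indicator Qt x * (\<integral>\<^sup>+a\<in>cell L. h (a + x) \<partial>lborel)"
      by (rule nn_integral_cmult) auto
    also have "(\<integral>\<^sup>+a\<in>cell L. h (a + x) \<partial>lborel) = ?H"
      by (rule nn_integral_periodic_shift[OF L]) (use per(2) in \<open>auto simp: periodic_L_def\<close>)
    finally show "(\<integral>\<^sup>+a. indicator (cell L) a * (ennreal (h (x + a)) * indicator Qt x) \<partial>lborel) = ?H * indicator Qt x"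
      by (simp add: mult.commute)
  qed
  also have "\<dots> = ?H * emeasure lborel Qt" by (rule nn_integral_cmult_indicator) simp
  also have "emeasure lborel Qt = ennreal ((L + 2 * t) ^ ?n)"
    unfolding Qt_def using L t by (subst emeasure_cube) (auto simp: algebra_simps)
  finally show ?thesis by (simp add: mult.commute)
qed

lemma integrable_on_cell:
  fixes f :: "real^'d \<Rightarrow> real"
  assumes "continuous_on UNIV f"
  shows "integrable (lebesgue_on (cell L)) f"
  unfolding cell_def by (rule continuous_imp_integrable) (use assms continuous_on_subset in blast)

lemma nn_integral_cell_eq_integral:
  fixes f :: "real^'d \<Rightarrow> real"
  assumes "continuous_on UNIV f" "\<And>x. f x \<ge> 0"
  shows "(\<integral>\<^sup>+x\<in>cell L. f x \<partial>lborel) = ennreal (cell_integral L f)"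
proof -
  have "(\<lambda>x. ennreal (f x)) \<in> borel_measurable borel"
    using borel_measurable_continuous_onI[OF assms(1)] by simp
  then have "(\<integral>\<^sup>+x\<in>cell L. f x \<partial>lborel) = (\<integral>\<^sup>+x. f x \<partial>lebesgue_on (cell L))"
    by (rule nn_integral_lebesgue_on_cell[symmetric])
  also have "\<dots> = ennreal (cell_integral L f)"
    by (rule nn_integral_eq_integral[OF integrable_on_cell[OF assms(1)]]) (use assms(2) in auto)
  finally show ?thesis .
qed

lemma measure_lebesgue_on_cell:
  assumes "L \<ge> 0"
  shows "measure (lebesgue_on (cell L)) (space (lebesgue_on (cell L)) :: (real^'d) set) = L ^ CARD('d)"
proof -
  let ?M = "lebesgue_on (cell L) :: (real^'d) measure"
  have "emeasure ?M (space ?M) = ennreal (L ^ CARD('d))"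
    using emeasure_cell[OF assms, where 'd='d] by (subst emeasure_restrict_space) auto
  then show ?thesis using assms by (simp add: measure_def)
qed

text \<open>The parallel inequality is divided by \<open>t\<close> and \<open>t\<close> tends to 0.
  The increment of \<open>h\<close> over \<open>f\<close> gives the gradient integral, and the
  derivative of \<open>(1 + 2 * t / L) ^ CARD('d)\<close> at \<open>t = 0\<close> gives the boundary
  term. The left side is \<open>S\<close> times the perimeter of a ball with the volume of the top
  level set.\<close>

theorem torus_isoperimetric:
  fixes f :: "real^'d \<Rightarrow> real"
  assumes L: "L > 0" and d: "CARD('d) \<ge> 2" and per: "periodic_L L f"
    and der: "\<And>x. (f has_derivative (\<lambda>h. G x \<bullet> h)) (at x)" and cG: "continuous_on UNIV G"
    and f: "\<And>x. 0 \<le> f x" "\<And>x. f x \<le> S"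
  shows "S * (real CARD('d) * root CARD('d) (unit_ball_vol CARD('d)) * root CARD('d) (measure lebesgue {x\<in>cell L. f x = S}) ^ (CARD('d) - 1))
    \<le> cell_integral L (\<lambda>x. norm (G x)) + 2 * real CARD('d) / L * cell_integral L f"
proof -
  let ?n = "CARD('d)" and ?M = "lebesgue_on (cell L) :: (real^'d) measure"
  let ?I = "integral\<^sup>L ?M :: (real^'d \<Rightarrow> real) \<Rightarrow> real"
  define W where "W = real ?n * root ?n (unit_ball_vol ?n) * root ?n (measure lebesgue {x\<in>cell L. f x = S}) ^ (?n - 1)"
  define F where "F = integral\<^sup>L ?M f"
  define I where "I = ?I (\<lambda>x. norm (G x))"
  have cf: "continuous_on UNIV f" by (rule continuous_on_gradient[OF der])
  have S: "S \<ge> 0" using f[of 0] by linarith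
  have W0: "W \<ge> 0" unfolding W_def by (auto intro!: mult_nonneg_nonneg)
  have FI: "F \<ge> 0" "I \<ge> 0" unfolding F_def I_def using f by (auto intro!: integral_nonneg_AE)
  have perG: "periodic_L L G" using periodic_gradient[OF per der] .
  have eta: "S * W \<le> 2 * ?n / L * F + I + e * L ^ ?n" if e: "e > 0" for e
  proof -
    obtain delta where delta: "delta > 0" "\<And>x h. norm h < delta \<Longrightarrow> \<bar>f (x + h) - f x - G x \<bullet> h\<bar> \<le> e * norm h"
      using periodic_C1_uniform_expansion[OF L per der cG e] by blast
    have step: "S * W \<le> (1 + 2 * t / L) ^ ?n * (2 * ?n / L * F + I + e * L ^ ?n)" if t: "0 < t" "t < delta" for t
    proof -
      \<comment> \<open>A majorant of \<open>f\<close> on balls of radius \<open>t\<close>: the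
        gradient covers the linear part and \<open>e\<close> the uniform error of the
        expansion.\<close>
      define h where "h x = f x + t * (norm (G x) + e)" for x
      have ch: "continuous_on UNIV h" unfolding h_def using cf cG by (intro continuous_intros)
      have ph: "periodic_L L h" using per perG by (simp add: periodic_L_def h_def)
      have fh: "f y \<le> h x" if "dist x y < t" for x y
      proof -
        have n: "norm (y - x) < t" using that by (simp add: dist_norm norm_minus_commute)
        then have "\<bar>f (x + (y - x)) - f x - G x \<bullet> (y - x)\<bar> \<le> e * norm (y - x)" using delta(2)[of "y - x" x] t by auto
        moreover have "G x \<bullet> (y - x) \<le> norm (G x) * norm (y - x)" by (rule norm_cauchy_schwarz)
        moreover have "norm (G x) * norm (y - x) \<le> norm (G x) * t" "e * norm (y - x) \<le> e * t"
          using n e by (auto intro!: mult_left_mono)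
        ultimately show ?thesis unfolding h_def by (simp add: algebra_simps)
      qed
      have h0: "h x \<ge> 0" for x using fh[of x x] f(1)[of x] t by simp
      have H: "integral\<^sup>L ?M h = F + t * (I + e * L ^ ?n)"
      proof -
        have i: "integrable ?M f" "integrable ?M (\<lambda>x. norm (G x))" "integrable ?M (\<lambda>x. e)"
          using cf cG by (auto intro!: integrable_on_cell continuous_intros)
        have "?I (\<lambda>x. e) = e * L ^ ?n" using measure_lebesgue_on_cell[of L, where 'd='d] L by simp
        then show ?thesis unfolding h_def F_def I_def using i by simp
      qed
      have *: "ennreal (L ^ ?n) * (ennreal F + ennreal (S * (t * W))) \<le> ennreal ((L + 2 * t) ^ ?n) * ennreal (integral\<^sup>L ?M h)"
        using torus_parallel_inequality[OF L t(1) d per ph cf ch f fh]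
        unfolding nn_integral_cell_eq_integral[OF cf f(1)] nn_integral_cell_eq_integral[OF ch h0] F_def W_def
        by (simp add: mult_ac)
      then have "ennreal (L ^ ?n * (F + S * (t * W))) \<le> ennreal ((L + 2 * t) ^ ?n * integral\<^sup>L ?M h)"
      proof -
        have nn: "0 \<le> L ^ ?n" "0 \<le> (L + 2 * t) ^ ?n" "0 \<le> S * (t * W)" using L t S W0 by auto
        show ?thesis using * by (simp only: ennreal_mult'[OF nn(1)] ennreal_mult'[OF nn(2)] ennreal_plus[OF FI(1) nn(3)])
      qed
      moreover have "0 \<le> (L + 2 * t) ^ ?n * integral\<^sup>L ?M h"
        unfolding H using L t FI e by (intro mult_nonneg_nonneg add_nonneg_nonneg) auto
      ultimately have "L ^ ?n * (F + S * (t * W)) \<le> (L + 2 * t) ^ ?n * (F + t * (I + e * L ^ ?n))"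
        by (simp add: H ennreal_le_iff)
      moreover have "L + 2 * t = L * (1 + 2 * t / L)" using L by (simp add: field_simps)
      ultimately have "L ^ ?n * (F + S * (t * W)) \<le> L ^ ?n * ((1 + 2 * t / L) ^ ?n * (F + t * (I + e * L ^ ?n)))"
        by (simp add: power_mult_distrib mult.assoc)
      then have 1: "F + S * (t * W) \<le> (1 + 2 * t / L) ^ ?n * (F + t * (I + e * L ^ ?n))" using L by simp
      define z where "z = 2 * t / L"
      have z: "z \<ge> 0" using t L by (simp add: z_def)
      \<comment> \<open>The bound keeps the factor \<open>(1 + z) ^ m\<close>, so that it can be
        pulled out of the whole right side and tends to 1 with \<open>t\<close>.\<close>
      have zz: "(1 + z) ^ m - 1 \<le> m * z * (1 + z) ^ m" for m
      proof (induction m)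
        case (Suc m)
        have "(1 + z) ^ Suc m - 1 = (1 + z) * ((1 + z) ^ m - 1) + z" by (simp add: algebra_simps)
        also have "\<dots> \<le> (1 + z) * (m * z * (1 + z) ^ m) + z" using Suc z by (simp add: mult_left_mono)
        also have "\<dots> \<le> (1 + z) * (m * z * (1 + z) ^ m) + z * (1 + z) ^ Suc m"
          using mult_left_mono[OF one_le_power[of "1+z" "Suc m"] z] z by simp
        also have "\<dots> = Suc m * z * (1 + z) ^ Suc m" by (simp add: algebra_simps)
        finally show ?case .
      qed simp
      have "((1 + z) ^ ?n - 1) * F \<le> (?n * z * (1 + z) ^ ?n) * F"
        using zz[of ?n] FI(1) by (rule mult_right_mono)
      then have "S * (t * W) \<le> (?n * z * (1 + z) ^ ?n) * F + (1 + z) ^ ?n * (t * (I + e * L ^ ?n))"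
        using 1 unfolding z_def[symmetric] by (simp add: algebra_simps)
      also have "\<dots> = t * ((1 + z) ^ ?n * (2 * ?n / L * F + I + e * L ^ ?n))"
        using L by (simp add: z_def field_simps)
      finally have "t * (S * W) \<le> t * ((1 + z) ^ ?n * (2 * ?n / L * F + I + e * L ^ ?n))" by (simp add: mult_ac)
      then show ?thesis using t(1) by (simp add: z_def)
    qed
    have "((\<lambda>t. (1 + 2 * t / L) ^ ?n * (2 * ?n / L * F + I + e * L ^ ?n)) \<longlongrightarrow> (1 + 2 * 0 / L) ^ ?n * (2 * ?n / L * F + I + e * L ^ ?n)) (at_right 0)"
      using L by (intro tendsto_intros) auto
    moreover have "\<forall>\<^sub>F t in at_right 0. S * W \<le> (1 + 2 * t / L) ^ ?n * (2 * ?n / L * F + I + e * L ^ ?n)"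
      unfolding eventually_at_right_field using delta(1) step by blast
    ultimately have "S * W \<le> (1 + 2 * 0 / L) ^ ?n * (2 * ?n / L * F + I + e * L ^ ?n)"
      by (intro tendsto_lowerbound) auto
    then show ?thesis by simp
  qed
  have "S * W \<le> 2 * ?n / L * F + I"
  proof (rule field_le_epsilon)
    fix eps :: real assume "eps > 0"
    then show "S * W \<le> 2 * ?n / L * F + I + eps" using eta[of "eps / L ^ ?n"] L by simp
  qed
  then show ?thesis unfolding W_def F_def I_def by (simp add: mult_ac add.commute)
qed

section \<open>Lower bound for the energy of smooth functions\<close>

text \<open>The exponent is at least 2, which makes the positive part differentiable across its
  kink. The cases 2 and 3 are the ones occurring in \<open>phase_primitive\<close>.\<close>

lemma DERIV_pos_part_power:
  "((\<lambda>y::real. (max y 0) ^ (k + 2)) has_real_derivative real (k + 2) * (max y 0) ^ (k + 1)) (at y)"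
proof -
  consider "y < 0" | "y = 0" | "y > 0" by linarith
  then show ?thesis
  proof cases
    case 1
    have "((\<lambda>y::real. 0) has_real_derivative 0) (at y)" by simp
    then have "((\<lambda>y::real. (max y 0) ^ (k + 2)) has_real_derivative 0) (at y)"
      by (rule has_field_derivative_transform_within_open[where S="{..<0}"]) (use 1 in auto)
    then show ?thesis using 1 by simp
  next
    case 2
    have "((\<lambda>h::real. (max h 0) ^ (k + 1)) \<longlongrightarrow> (max 0 0) ^ (k + 1)) (at 0)"
      by (intro tendsto_intros)
    moreover have "((max (0 + h) 0) ^ (k + 2) - (max 0 0) ^ (k + 2)) / h = (max h 0) ^ (k + 1)" if "h \<noteq> 0" for h :: real
      using that by (cases "h > 0") (auto simp: max_def)
    ultimately have "((\<lambda>y::real. (max y 0) ^ (k + 2)) has_real_derivative 0) (at 0)"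
      unfolding DERIV_def by (subst tendsto_cong[where g="\<lambda>h. (max h 0) ^ (k + 1)"])
        (auto simp: eventually_at_filter)
    then show ?thesis using 2 by simp
  next
    case 3
    have "((\<lambda>y::real. y ^ (k + 2)) has_real_derivative real (k + 2) * y ^ (k + 1)) (at y)"
      by (rule derivative_eq_intros refl | simp)+
    then have "((\<lambda>y::real. (max y 0) ^ (k + 2)) has_real_derivative real (k + 2) * y ^ (k + 1)) (at y)"
      by (rule has_field_derivative_transform_within_open[where S="{0<..}"]) (use 3 in auto)
    then show ?thesis using 3 by simp
  qed
qed

text \<open>The positive part of \<open>(s - eps) * (eps + b - s) / sqrt 2\<close> and its primitive: the Modica--Mortola
  density \<open>sqrt (2 * W)\<close>, truncated near both wells. Sums of powers of positive parts make the
  primitive visibly continuously differentiable.\<close>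
definition phase_density :: "real \<Rightarrow> real \<Rightarrow> real \<Rightarrow> real" where
  "phase_density eps b s = (b * max (s - eps) 0 - (max (s - eps) 0)^2 + b * max (s - eps - b) 0 + (max (s - eps - b) 0)^2) / sqrt 2"

definition phase_primitive :: "real \<Rightarrow> real \<Rightarrow> real \<Rightarrow> real" where
  "phase_primitive eps b s = (b * (max (s - eps) 0)^2 / 2 - (max (s - eps) 0)^3 / 3
     + b * (max (s - eps - b) 0)^2 / 2 + (max (s - eps - b) 0)^3 / 3) / sqrt 2"

lemma DERIV_phase_primitive: "(phase_primitive eps b has_real_derivative phase_density eps b s) (at s)"
proof -
  have lin: "((\<lambda>s. s - c) has_real_derivative 1) (at s)" for s c :: real by (auto intro!: derivative_eq_intros)
  have 2: "((\<lambda>s. (max (s - c) 0)^2) has_real_derivative 2 * max (s - c) 0) (at s)" for c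
    using DERIV_chain2[OF DERIV_pos_part_power[of 0] lin, of c s] by (simp add: power2_eq_square)
  have 3: "((\<lambda>s. (max (s - c) 0)^3) has_real_derivative 3 * (max (s - c) 0)^2) (at s)" for c
    using DERIV_chain2[OF DERIV_pos_part_power[of 1] lin, of c s] by (simp add: numeral_3_eq_3 numeral_2_eq_2)
  have "((\<lambda>s. ((b / 2) * (max (s - eps) 0)^2 - (1 / 3) * (max (s - eps) 0)^3
      + (b / 2) * (max (s - (eps + b)) 0)^2 + (1 / 3) * (max (s - (eps + b)) 0)^3) / sqrt 2) has_real_derivative
      ((b / 2) * (2 * max (s - eps) 0) - (1 / 3) * (3 * (max (s - eps) 0)^2)
      + (b / 2) * (2 * max (s - (eps + b)) 0) + (1 / 3) * (3 * (max (s - (eps + b)) 0)^2)) / sqrt 2) (at s)"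
    by (intro DERIV_cdivide DERIV_add DERIV_diff DERIV_cmult 2 3)
  moreover have "phase_primitive eps b = (\<lambda>s. ((b / 2) * (max (s - eps) 0)^2 - (1 / 3) * (max (s - eps) 0)^3
      + (b / 2) * (max (s - (eps + b)) 0)^2 + (1 / 3) * (max (s - (eps + b)) 0)^3) / sqrt 2)"
    by (simp add: fun_eq_iff phase_primitive_def diff_diff_eq)
  ultimately show ?thesis by (simp add: phase_density_def diff_diff_eq)
qed

lemma continuous_phase_density: "continuous_on UNIV (phase_density eps b)"
  unfolding phase_density_def by (intro continuous_intros) auto

lemma phase_density_below: "b > 0 \<Longrightarrow> s \<le> eps \<Longrightarrow> phase_density eps b s = 0"
  by (simp add: phase_density_def)

lemma phase_density_above: "b > 0 \<Longrightarrow> s \<ge> eps + b \<Longrightarrow> phase_density eps b s = 0"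
  by (simp add: phase_density_def max_def power2_eq_square algebra_simps)

lemma phase_density_mid: "eps \<le> s \<Longrightarrow> s \<le> eps + b \<Longrightarrow> phase_density eps b s = (s - eps) * (eps + b - s) / sqrt 2"
  by (simp add: phase_density_def max_def power2_eq_square algebra_simps)

lemma phase_primitive_below: "b > 0 \<Longrightarrow> s \<le> eps \<Longrightarrow> phase_primitive eps b s = 0"
  by (simp add: phase_primitive_def)

text \<open>The value is the integral of the truncated density between its zeros \<open>eps\<close>
  and \<open>eps + b\<close>; for \<open>b = 2\<close> it is \<open>S_const\<close>.\<close>

lemma phase_primitive_above: "b > 0 \<Longrightarrow> s \<ge> eps + b \<Longrightarrow> phase_primitive eps b s = b^3 / (6 * sqrt 2)"
proof -
  assume *: "b > 0" "s \<ge> eps + b"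
  define y where "y = s - eps - b"
  have "max (s - eps) 0 = y + b" "max (s - eps - b) 0 = y" using * by (auto simp: y_def)
  then have "phase_primitive eps b s = (b * (y+b)^2 / 2 - (y+b)^3/3 + b*y^2/2 + y^3/3) / sqrt 2" by (simp add: phase_primitive_def)
  also have "b * (y+b)^2 / 2 - (y+b)^3/3 + b*y^2/2 + y^3/3 = b^3/6"
    by (simp add: power2_eq_square power3_eq_cube field_simps)
  finally show ?thesis by simp
qed

lemma phase_primitive_mid:
  assumes "b > 0" "eps < s" "s < eps + b"
  shows "0 \<le> phase_primitive eps b s" "phase_primitive eps b s < b^3 / (6 * sqrt 2)"
proof -
  define y where "y = s - eps"
  have y: "0 < y" "y < b" using assms by (auto simp: y_def)
  have "max (s - eps) 0 = y" "max (s - eps - b) 0 = 0" using assms by (auto simp: y_def)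
  then have eq: "phase_primitive eps b s = (b * y^2 / 2 - y^3 / 3) / sqrt 2" by (simp add: phase_primitive_def)
  have "b * y^2 / 2 - y^3 / 3 = y^2 * (3 * b - 2 * y) / 6" by (simp add: power2_eq_square power3_eq_cube field_simps)
  also have "\<dots> \<ge> 0" using y by (intro divide_nonneg_pos mult_nonneg_nonneg) auto
  finally show "0 \<le> phase_primitive eps b s" unfolding eq by simp
  have "b^3 / 6 - (b * y^2 / 2 - y^3 / 3) = (b - y)^2 * (b + 2 * y) / 6" by (simp add: power2_eq_square power3_eq_cube field_simps)
  also have "\<dots> > 0" using y by (intro divide_pos_pos mult_pos_pos) auto
  finally have "b * y^2 / 2 - y^3 / 3 < b^3 / 6" by simp
  then have "(b * y^2 / 2 - y^3 / 3) / sqrt 2 < b^3 / 6 / sqrt 2" by (rule divide_strict_right_mono) simp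
  then show "phase_primitive eps b s < b^3 / (6 * sqrt 2)" unfolding eq by simp
qed

text \<open>The equivalence identifies the top level set of \<open>phase_primitive eps b\<close>
  along \<open>u\<close> with the droplet, which is the set whose volume enters
  \<open>torus_isoperimetric\<close>.\<close>

lemma phase_primitive_bounds:
  assumes "b > 0"
  shows "0 \<le> phase_primitive eps b s" "phase_primitive eps b s \<le> b^3 / (6 * sqrt 2)"
    "phase_primitive eps b s = b^3 / (6 * sqrt 2) \<longleftrightarrow> s \<ge> eps + b"
proof -
  have p: "b^3 / (6 * sqrt 2) > 0" using assms by simp
  consider "s \<le> eps" | "eps < s" "s < eps + b" | "s \<ge> eps + b" by linarith
  then have "0 \<le> phase_primitive eps b s \<and> phase_primitive eps b s \<le> b^3 / (6 * sqrt 2) \<and> (phase_primitive eps b s = b^3 / (6 * sqrt 2) \<longleftrightarrow> s \<ge> eps + b)"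
  proof cases
    case 1
    then show ?thesis using phase_primitive_below[OF assms 1] p assms by (auto; linarith)
  next
    case 2
    then show ?thesis using phase_primitive_mid[OF assms 2] by linarith
  next
    case 3
    then show ?thesis using phase_primitive_above[OF assms 3] p by simp
  qed
  then show "0 \<le> phase_primitive eps b s" "phase_primitive eps b s \<le> b^3 / (6 * sqrt 2)"
    "phase_primitive eps b s = b^3 / (6 * sqrt 2) \<longleftrightarrow> s \<ge> eps + b" by blast+
qed

lemma phase_density_nonneg: "b > 0 \<Longrightarrow> phase_density eps b s \<ge> 0"
  using phase_density_below[of b s eps] phase_density_above[of b eps s] phase_density_mid[of eps s b]
  by (cases "s \<le> eps"; cases "s \<ge> eps + b") auto

text \<open>Completing the square in the mean-zero background turns the constraint into the linear term
  \<open>- 2 * beta * tau * u\<close>, which integrates to zero; the optimal \<open>tau\<close> is proportional to the droplet volume.\<close>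
lemma pointwise_energy_bound:
  fixes u g :: real
  assumes eps: "0 < eps" "eps \<le> 1/10" and a: "2 - 2 * eps \<le> a" "a \<le> 2" and b: "b = a - 2 * eps"
    and beta: "0 \<le> beta" "beta + l \<le> (2 - 3 * eps)\<^sup>2 / 4" and tau: "0 \<le> tau"
    and l: "0 \<le> l" "(4 + eps) * l \<le> eps\<^sup>2 / 4" and kappa: "0 \<le> kappa" "kappa * (b^3 / (6 * sqrt 2)) \<le> eps * l" and g: "g \<ge> 0"
  shows "g\<^sup>2 / 2 + u\<^sup>2 * (u - a)\<^sup>2 / 4 - l * u\<^sup>2 \<ge> phase_density eps b u * g + kappa * phase_primitive eps b u - 2 * beta * tau * u - beta * tau\<^sup>2
      + indicator {a - eps..} u * (2 * beta * tau * (2 - 3 * eps) - l * ((2 + eps)\<^sup>2 + eps))"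
proof -
  have b0: "b > 0" using b a eps by simp
  have young: "phase_density eps b u * g \<le> g\<^sup>2 / 2 + (phase_density eps b u)\<^sup>2 / 2"
    using sum_squares_bound[of "phase_density eps b u" g] by simp
  have kappaf: "kappa * phase_primitive eps b u \<le> eps * l"
    using mult_left_mono[OF phase_primitive_bounds(2)[OF b0, of eps u] kappa(1)] kappa(2) by linarith
  consider "u \<le> eps" | "eps < u" "u < a - eps" | "a - eps \<le> u" by linarith
  then show ?thesis
  proof cases
    case 1
    \<comment> \<open>Background phase: the distance to the other well is at least
      \<open>2 - 3 * eps\<close>, so the potential is at least \<open>(beta + l) * u^2\<close>.
      After the loss of \<open>l * u^2\<close>, enough remains to complete the square
      \<open>beta * (u + tau)^2\<close>.\<close>
    have ind: "indicator {a - eps..} u = (0::real)" using 1 a eps by (simp add: indicator_def)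
    have "(2 - 3 * eps)\<^sup>2 \<le> (a - u)\<^sup>2" using 1 a eps by (intro power_mono) auto
    then have "(beta + l) \<le> (u - a)\<^sup>2 / 4" using beta by (simp add: power2_commute)
    then have "u\<^sup>2 * (beta + l) \<le> u\<^sup>2 * ((u - a)\<^sup>2 / 4)" by (rule mult_left_mono) simp
    then have "u\<^sup>2 * (u - a)\<^sup>2 / 4 - l * u\<^sup>2 \<ge> beta * u\<^sup>2" by (simp add: algebra_simps)
    moreover have "0 \<le> beta * (u + tau)\<^sup>2" using beta by simp
    moreover have "beta * (u + tau)\<^sup>2 = beta * u\<^sup>2 + 2 * beta * tau * u + beta * tau\<^sup>2" by (simp add: power2_eq_square algebra_simps)
    moreover have "0 \<le> g\<^sup>2 / 2" by simp
    ultimately have "- 2 * beta * tau * u - beta * tau\<^sup>2 \<le> g\<^sup>2 / 2 + u\<^sup>2 * (u - a)\<^sup>2 / 4 - l * u\<^sup>2" by linarith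
    then show ?thesis using phase_density_below[OF b0 1] phase_primitive_below[OF b0 1] ind by simp
  next
    case 2
    have ind: "indicator {a - eps..} u = (0::real)" using 2 by (simp add: indicator_def)
    \<comment> \<open>Transition layer: the potential is \<open>P^2 / 4\<close> and half the squared
      density is \<open>(P - r)^2 / 4\<close>. The shift \<open>r\<close> makes the density vanish
      at \<open>eps\<close> and \<open>a - eps\<close>, and it frees at least
      \<open>eps^2 / 4\<close>, which pays for \<open>l * u^2\<close> and for the
      \<open>kappa\<close> term.\<close>
    define P where "P = u * (a - u)"
    define r where "r = eps * (a - eps)"
    have dens: "phase_density eps b u = (P - r) / sqrt 2"
    proof -
      have "(u - eps) * (eps + b - u) = P - r" by (simp add: P_def r_def b algebra_simps)
      then show ?thesis using phase_density_mid[of eps u b] 2 b by simp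
    qed
    have "P - r \<ge> 0"
    proof -
      have "P - r = (u - eps) * (a - eps - u)" by (simp add: P_def r_def algebra_simps)
      then show ?thesis using 2 by simp
    qed
    moreover have r: "r \<ge> eps" using mult_left_mono[of 1 "a - eps" eps] eps a by (simp add: r_def)
    ultimately have "P\<^sup>2 - (P - r)\<^sup>2 \<ge> eps\<^sup>2"
    proof -
      have "P\<^sup>2 - (P - r)\<^sup>2 = r\<^sup>2 + 2 * r * (P - r)" by (simp add: power2_eq_square algebra_simps)
      also have "\<dots> \<ge> r\<^sup>2" using \<open>P - r \<ge> 0\<close> r eps by simp
      also have "r\<^sup>2 \<ge> eps\<^sup>2" using r eps by (intro power_mono) auto
      finally show ?thesis .
    qed
    moreover have "(phase_density eps b u)\<^sup>2 / 2 = (P - r)\<^sup>2 / 4" unfolding dens by (simp add: power_divide)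
    moreover have "u\<^sup>2 * (u - a)\<^sup>2 / 4 = P\<^sup>2 / 4" by (simp add: P_def power_mult_distrib power2_commute)
    ultimately have 1: "u\<^sup>2 * (u - a)\<^sup>2 / 4 \<ge> (phase_density eps b u)\<^sup>2 / 2 + eps\<^sup>2 / 4" by simp
    have "u\<^sup>2 \<le> 2\<^sup>2" using 2 eps a by (intro power_mono) auto
    then have "l * u\<^sup>2 \<le> l * 4" using l by (intro mult_left_mono) auto
    moreover have "0 \<le> 2 * beta * tau * u" "0 \<le> beta * tau\<^sup>2" using beta tau 2 eps by auto
    ultimately show ?thesis using young 1 kappaf l(2) ind by (simp add: algebra_simps)
  next
    case 3
    have ind: "indicator {a - eps..} u = (1::real)" using 3 by (simp add: indicator_def)
    have "u \<ge> eps + b" using 3 b by simp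
    then have dens: "phase_density eps b u = 0" using phase_density_above b0 by simp
    \<comment> \<open>Droplet phase: up to \<open>a + eps\<close> the loss is bounded by the size of
      \<open>u\<close>; beyond, the potential itself exceeds \<open>l * u^2\<close> because
      \<open>4 * l \<le> eps^2\<close>.\<close>
    have W: "u\<^sup>2 * (u - a)\<^sup>2 / 4 - l * u\<^sup>2 \<ge> - (l * (2 + eps)\<^sup>2)"
    proof (cases "u \<le> a + eps")
      case True
      have "u\<^sup>2 \<le> (2 + eps)\<^sup>2" using 3 True eps a by (intro power_mono) auto
      then have "l * u\<^sup>2 \<le> l * (2 + eps)\<^sup>2" using l by (intro mult_left_mono) auto
      moreover have "0 \<le> u\<^sup>2 * (u - a)\<^sup>2 / 4" by simp
      ultimately show ?thesis by linarith
    next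
      case False
      have "eps\<^sup>2 \<le> (u - a)\<^sup>2" using False eps by (intro power_mono) auto
      moreover have "4 * l \<le> eps\<^sup>2" using l mult_right_mono[of 4 "4 + eps" l] eps by linarith
      ultimately have "l * u\<^sup>2 \<le> ((u - a)\<^sup>2 / 4) * u\<^sup>2" by (intro mult_right_mono) auto
      moreover have "l * (2 + eps)\<^sup>2 \<ge> 0" using l by simp
      ultimately show ?thesis by (simp add: mult.commute)
    qed
    have "2 * beta * tau * (2 - 3 * eps) \<le> 2 * beta * tau * u" using 3 a beta tau by (intro mult_left_mono) auto
    moreover have "0 \<le> beta * tau\<^sup>2" "0 \<le> g\<^sup>2 / 2" using beta by auto
    moreover have "l * ((2 + eps)\<^sup>2 + eps) = l * (2 + eps)\<^sup>2 + eps * l" by (simp add: algebra_simps)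
    \<comment> \<open>Variables stand for the nonlinear products, so that only linear arithmetic is
      left.\<close>
    moreover have "0 * g + k - q - r + 1 * (p - t) \<le> s + w - z"
      if "p \<le> q" "0 \<le> r" "0 \<le> s" "t = v + e" "- v \<le> w - z" "k \<le> e" for p q r s t v w z k e :: real
      using that by simp
    ultimately show ?thesis unfolding dens ind using W kappaf by blast
  qed
qed

text \<open>Integration of the pointwise bound, with \<open>V\<close> the volume of
  \<open>{u \<ge> a - eps}\<close>. The three terms are the penalty of the mean-zero background, the
  surface energy and the bulk gain; the gradient and \<open>kappa\<close> terms together form the
  right side of \<open>torus_isoperimetric\<close> for the phase primitive of
  \<open>u\<close>.\<close>

lemma torus_energy_bound:
  fixes u :: "real^'d \<Rightarrow> real"
  assumes L: "L > 0" and d: "CARD('d) \<ge> 2" and per: "periodic_L L u"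
    and der: "\<And>x. (u has_derivative (\<lambda>h. G x \<bullet> h)) (at x)" and cG: "continuous_on UNIV G"
    and mean: "cell_integral L u = 0"
    and eps: "0 < eps" "eps \<le> 1/10" and a: "2 - 2 * eps \<le> a" "a \<le> 2"
    and beta: "0 \<le> beta" "beta + l \<le> (2 - 3 * eps)\<^sup>2 / 4"
    and l: "0 \<le> l" "(4 + eps) * l \<le> eps\<^sup>2 / 4" and kappa: "2 * real CARD('d) / L \<le> eps * l"
  shows "\<exists>V\<ge>0. cell_integral L (\<lambda>x. (norm (G x))\<^sup>2 / 2 + (u x)\<^sup>2 * (u x - a)\<^sup>2 / 4 - l * (u x)\<^sup>2)
     \<ge> beta * (2 - 3 * eps)\<^sup>2 * V\<^sup>2 / L ^ CARD('d)
      + (2 - 4 * eps)^3 / (6 * sqrt 2) * (real CARD('d) * root CARD('d) (unit_ball_vol CARD('d)) * root CARD('d) V ^ (CARD('d) - 1))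
      - l * ((2 + eps)\<^sup>2 + eps) * V"
proof -
  let ?n = "CARD('d)" and ?M = "lebesgue_on (cell L) :: (real^'d) measure"
  let ?I = "integral\<^sup>L ?M :: (real^'d \<Rightarrow> real) \<Rightarrow> real"
  define b where "b = a - 2 * eps"
  define S where "S = b^3 / (6 * sqrt 2)"
  define f where "f x = phase_primitive eps b (u x)" for x
  define q where "q x = phase_density eps b (u x) *\<^sub>R G x" for x
  define V where "V = measure lebesgue {x\<in>cell L. u x \<ge> a - eps}"
  \<comment> \<open>This value maximises \<open>2 * beta * tau * (2 - 3 * eps) * V - beta * tau^2 *
    L ^ CARD('d)\<close>.\<close>
  define tau where "tau = (2 - 3 * eps) * V / L ^ ?n"
  define kappa' where "kappa' = 2 * real ?n / L"
  define lam where "lam = (2 + eps)\<^sup>2 + eps"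
  define W where "W = real ?n * root ?n (unit_ball_vol ?n) * root ?n V ^ (?n - 1)"
  have b0: "b > 0" using a eps by (simp add: b_def)
  have V0: "V \<ge> 0" by (simp add: V_def)
  have tau0: "tau \<ge> 0" using V0 L eps by (simp add: tau_def)
  have cu: "continuous_on UNIV u" by (rule continuous_on_gradient[OF der])
  have [measurable]: "u \<in> borel_measurable borel" using cu by (rule borel_measurable_continuous_onI)
  have fder: "(f has_derivative (\<lambda>h. q x \<bullet> h)) (at x)" for x
    unfolding f_def q_def
    using has_derivative_compose[OF der[of x], of "phase_primitive eps b" "\<lambda>y. phase_density eps b (u x) * y"] DERIV_phase_primitive[of eps b "u x"]
    by (simp add: has_field_derivative_def)
  have cq: "continuous_on UNIV q" unfolding q_def
    by (intro continuous_intros continuous_on_compose2[OF continuous_phase_density cu] cG) auto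
  have cf: "continuous_on UNIV f" by (rule continuous_on_gradient[OF fder])
  have pf: "periodic_L L f" using per by (simp add: periodic_L_def f_def)
  have Veq: "{x\<in>cell L. f x = S} = {x\<in>cell L. u x \<ge> a - eps}"
  proof -
    have "f x = S \<longleftrightarrow> a - eps \<le> u x" for x
      unfolding f_def S_def phase_primitive_bounds(3)[OF b0] by (auto simp: b_def)
    then show ?thesis by simp
  qed
  have iso: "S * W \<le> ?I (\<lambda>x. norm (q x)) + kappa' * integral\<^sup>L ?M f"
    unfolding W_def kappa'_def V_def Veq[symmetric]
    by (rule torus_isoperimetric[OF L d pf fder cq]) (use phase_primitive_bounds[OF b0] in \<open>auto simp: f_def S_def\<close>)
  have "b^3 \<le> 2^3" using b0 eps a by (intro power_mono) (auto simp: b_def)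
  \<comment> \<open>\<open>4/3\<close> is exactly what turns \<open>b^3 \<le> 8\<close> into
    \<open>S \<le> 1\<close>, so that the assumption on \<open>2 * real CARD('d) / L\<close> also
    bounds \<open>kappa' * S\<close>.\<close>
  have "sqrt 2 \<ge> 4/3" by (rule real_le_rsqrt) (simp add: power2_eq_square)
  then have S1: "S \<le> 1" unfolding S_def using \<open>b^3 \<le> 2^3\<close> by (simp add: divide_le_eq)
  have kappa0: "kappa' \<ge> 0" using L by (simp add: kappa'_def)
  have kappa1: "kappa' * S \<le> eps * l"
    using mult_left_mono[OF S1 kappa0] kappa unfolding kappa'_def by linarith
  have cellm: "{x\<in>cell L. u x \<ge> a - eps} \<in> sets lebesgue"
  proof -
    have "{x\<in>cell L. u x \<ge> a - eps} \<in> sets borel" by measurable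
    then show ?thesis by simp
  qed
  have Vint: "?I (\<lambda>x. indicator {a - eps..} (u x)) = V" "integrable ?M (\<lambda>x. indicator {a - eps..} (u x) :: real)"
  proof -
    have eq: "(\<lambda>x. indicator {a - eps..} (u x) :: real) = indicator {x. u x \<ge> a - eps}" by (auto simp: indicator_def)
    have "cell L \<in> (lmeasurable :: (real^'d) set set)" by (simp add: cell_def)
    then have fin: "{x\<in>cell L. u x \<ge> a - eps} \<in> lmeasurable"
      by (rule fmeasurableI2[OF _ _ cellm]) blast
    have "?I (indicator {x. u x \<ge> a - eps} :: _ \<Rightarrow> real) = integral\<^sup>L lebesgue (\<lambda>x. indicator (cell L) x *\<^sub>R indicator {x. u x \<ge> a - eps} x)"
      by (rule integral_restrict_space) simp
    also have "(\<lambda>x. indicator (cell L) x *\<^sub>R indicator {x. u x \<ge> a - eps} x :: real) = indicator {x\<in>cell L. u x \<ge> a - eps}"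
      by (auto simp: indicator_def)
    also have "integral\<^sup>L lebesgue (indicator {x\<in>cell L. u x \<ge> a - eps} :: _ \<Rightarrow> real) = V" unfolding V_def using fin by simp
    finally show "?I (\<lambda>x. indicator {a - eps..} (u x)) = V" unfolding eq .
    have "integrable lebesgue (\<lambda>x. indicator (cell L) x *\<^sub>R indicator {x. u x \<ge> a - eps} x :: real)"
      unfolding \<open>(\<lambda>x. indicator (cell L) x *\<^sub>R indicator {x. u x \<ge> a - eps} x :: real) = indicator {x\<in>cell L. u x \<ge> a - eps}\<close>
      using fin lmeasurable_iff_integrable by blast
    then show "integrable ?M (\<lambda>x. indicator {a - eps..} (u x) :: real)" unfolding eq
      by (subst integrable_restrict_space) auto
  qed
  let ?E = "\<lambda>x. (norm (G x))\<^sup>2 / 2 + (u x)\<^sup>2 * (u x - a)\<^sup>2 / 4 - l * (u x)\<^sup>2"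
  let ?c = "2 * beta * tau * (2 - 3 * eps) - l * lam"
  let ?R = "\<lambda>x. norm (q x) + kappa' * f x - 2 * beta * tau * u x - beta * tau\<^sup>2 + indicator {a - eps..} (u x) * ?c"
  have i: "integrable ?M u" "integrable ?M f" "integrable ?M (\<lambda>x. norm (q x))" "integrable ?M (\<lambda>x. beta * tau\<^sup>2)"
    using cu cf cq by (auto intro!: integrable_on_cell continuous_intros)
  have "integral\<^sup>L ?M ?E \<ge> integral\<^sup>L ?M ?R"
  proof (rule integral_mono)
    show "integrable ?M ?R" using i Vint(2) by (intro Bochner_Integration.integrable_add Bochner_Integration.integrable_diff) auto
    show "integrable ?M ?E" by (intro integrable_on_cell continuous_intros cG cu) auto
    show "?R x \<le> ?E x" for x
    proof -
      have "norm (q x) = phase_density eps b (u x) * norm (G x)" using phase_density_nonneg[OF b0] by (simp add: q_def)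
      then show ?thesis
        using pointwise_energy_bound[OF eps a b_def beta tau0 l kappa0 kappa1[unfolded S_def], of "norm (G x)" "u x"]
        by (simp add: f_def lam_def)
    qed
  qed
  moreover have "integral\<^sup>L ?M ?R = ?I (\<lambda>x. norm (q x)) + kappa' * integral\<^sup>L ?M f - beta * tau\<^sup>2 * L ^ ?n + V * ?c"
  proof -
    have "?I (\<lambda>x. beta * tau\<^sup>2) = beta * tau\<^sup>2 * L ^ ?n"
      using measure_lebesgue_on_cell[of L, where 'd='d] L by simp
    then show ?thesis using i Vint mean by simp
  qed
  moreover have "V * ?c - beta * tau\<^sup>2 * L ^ ?n = beta * (2 - 3 * eps)\<^sup>2 * V\<^sup>2 / L ^ ?n - l * lam * V"
    using L by (simp add: tau_def power2_eq_square field_simps)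
  moreover have "(2 - 4 * eps)^3 / (6 * sqrt 2) * W \<le> S * W"
    unfolding S_def using eps a V0 by (intro mult_right_mono divide_right_mono power_mono) (auto simp: b_def W_def)
  ultimately have "integral\<^sup>L ?M ?E \<ge> beta * (2 - 3 * eps)\<^sup>2 * V\<^sup>2 / L ^ ?n + (2 - 4 * eps)^3 / (6 * sqrt 2) * W - l * lam * V"
    using iso by linarith
  then show ?thesis unfolding W_def lam_def using V0 by blast
qed

section \<open>The critical constant\<close>

lemma sphere_area_eq_unit_ball_vol: "n \<ge> 1 \<Longrightarrow> sphere_area n / real n = unit_ball_vol (real n)"
proof -
  assume "n \<ge> 1"
  then have "Gamma (real n / 2 + 1) = real n / 2 * Gamma (real n / 2)" by (intro Gamma_plus1) (auto elim!: nonpos_Ints_cases')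
  then show ?thesis unfolding sphere_area_def unit_ball_vol_def by (simp only:) (simp add: mult.commute)
qed

lemma S_const_eq: "S_const = 2^3 / (6 * sqrt 2)"
proof -
  have "(2::real) powr (3/2) = 2 powr (1 + 1/2)" by simp
  also have "\<dots> = 2 * sqrt 2" by (subst powr_add) (simp add: powr_half_sqrt)
  finally have "S_const = 2 * sqrt 2 / 3" by (simp add: S_const_def)
  also have "\<dots> = 2^3 / (6 * sqrt 2)" by (simp add: field_simps)
  finally show ?thesis .
qed

text \<open>Weighted Young inequality with weights \<open>1 / (n + 1)\<close> and
  \<open>n / (n + 1)\<close>, scaled so that the right side comes out exactly. Equality holds for
  \<open>A * X ^ (n + 1) = sigma / n\<close>, so the constant is optimal; it is the source of the
  form of \<open>K_star\<close>.\<close>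

lemma young_power_bound:
  fixes A sigma X :: real and n :: nat
  assumes n: "n \<ge> 1" and A: "A > 0" and sigma: "sigma > 0" and X: "X \<ge> 0"
  shows "(real n + 1) * A powr (1 / (real n + 1)) * (sigma / real n) powr (real n / (real n + 1)) * X \<le> A * X ^ (n + 1) + sigma"
proof (cases "X = 0")
  case False
  then have X0: "X > 0" using X by simp
  define N where "N = real n + 1"
  have N: "N > 1" "real n > 0" using n by (auto simp: N_def)
  have s: "1 / N + real n / N = 1" using N by (simp add: N_def field_simps)
  have Xp: "(X ^ (n + 1)) powr (1 / N) = X"
  proof -
    have "X powr N = X ^ (n + 1)" using powr_realpow[of X "n + 1"] X0 by (simp add: N_def add_ac)
    then have "(X ^ (n + 1)) powr (1 / N) = (X powr N) powr (1 / N)" by simp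
    then show ?thesis using X0 N by (simp add: powr_powr)
  qed
  have "(N * (A * X ^ (n + 1))) powr (1 / N) * (N * (sigma / real n)) powr (real n / N)
      \<le> 1 / N * (N * (A * X ^ (n + 1))) + real n / N * (N * (sigma / real n))"
    by (rule Youngs_inequality_0) (use N A sigma X0 s in auto)
  also have "\<dots> = A * X ^ (n + 1) + sigma" using N by simp
  also have "(N * (A * X ^ (n + 1))) powr (1 / N) * (N * (sigma / real n)) powr (real n / N)
     = (N powr (1 / N) * N powr (real n / N)) * A powr (1 / N) * (sigma / real n) powr (real n / N) * (X ^ (n + 1)) powr (1 / N)"
    using N A sigma X0 by (simp add: powr_mult del: times_divide_eq_right)
  also have "N powr (1 / N) * N powr (real n / N) = N" using N s by (simp flip: powr_add)
  finally show ?thesis unfolding Xp unfolding N_def .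
qed (use sigma in simp)

text \<open>\<open>T eps\<close> is the largest coefficient that the Young inequality permits when
  all errors are measured by \<open>eps\<close>. As it is continuous with
  \<open>T 0 = K_star CARD('d)\<close>, some positive \<open>eps\<close> still leaves
  \<open>K' < T eps\<close>.\<close>

theorem torus_coercivity:
  fixes K' :: real
  assumes d: "CARD('d::finite) \<ge> 2" and K: "0 < K'" "K' < K_star CARD('d)"
  shows "\<exists>L0>0. \<forall>L\<ge>L0. \<forall>a (u :: real^'d \<Rightarrow> real) G.
     2 - 2 * (K' * L powr (- (real CARD('d) / (real CARD('d) + 1)))) \<le> a \<longrightarrow> a \<le> 2 \<longrightarrow> periodic_L L u \<longrightarrow>
     (\<forall>x. (u has_derivative (\<lambda>h. G x \<bullet> h)) (at x)) \<longrightarrow> continuous_on UNIV G \<longrightarrow>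
     cell_integral L u = 0 \<longrightarrow>
     0 \<le> cell_integral L (\<lambda>x. (norm (G x))\<^sup>2 / 2 + (u x)\<^sup>2 * (u x - a)\<^sup>2 / 4
            - K' * L powr (- (real CARD('d) / (real CARD('d) + 1))) * (u x)\<^sup>2)"
proof -
  let ?n = "CARD('d)"
  define N where "N = real ?n + 1"
  define w where "w = unit_ball_vol (real ?n)"
  have n: "?n \<ge> 1" "real ?n > 0" and N: "N > 0" using d by (auto simp: N_def)
  have w: "w > 0" by (simp add: w_def)
  define beta where "beta eps = (2 - 3 * eps)\<^sup>2 / 4 - eps" for eps :: real
  define A where "A eps = beta eps * (2 - 3 * eps)\<^sup>2" for eps
  define s where "s eps = (2 - 4 * eps)^3 / (6 * sqrt 2) * root ?n w" for eps :: real
  define lam where "lam eps = (2 + eps)\<^sup>2 + eps" for eps :: real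
  define T where "T eps = N * A eps powr (1 / N) * s eps powr (real ?n / N) / lam eps" for eps
  have "(T \<longlongrightarrow> T 0) (at_right 0)"
    unfolding T_def A_def s_def lam_def beta_def
    by (intro tendsto_intros) (use w n in auto)
  moreover have "T 0 = K_star ?n"
  proof -
    have A0: "A 0 = 4" and L0: "lam 0 = 4" and s0: "s 0 = S_const * root ?n w"
      by (simp_all add: A_def beta_def lam_def s_def S_const_eq)
    have S: "S_const > 0" by (simp add: S_const_def)
    have rw: "root ?n w powr (real ?n / N) = w powr (1 / N)"
      using w n by (simp add: root_powr_inverse powr_powr)
    \<comment> \<open>The background penalty and the bulk gain both have coefficient 4 at
      \<open>eps = 0\<close>. Together they turn \<open>S_const\<close> into
      \<open>S_const / 4\<close>, which is \<open>chi_const * S_const / 2\<close>.\<close>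
    have "(4::real) = 4 powr (1 / N) * 4 powr (real ?n / N)"
      using N by (simp add: N_def add_divide_distrib[symmetric] add.commute flip: powr_add)
    then have "4 powr (1 / N) / 4 = 1 / (4::real) powr (real ?n / N)" by (simp add: field_simps)
    then have 4: "4 powr (1 / N) * S_const powr (real ?n / N) / 4 = (S_const / 4) powr (real ?n / N)"
      using S by (simp add: powr_divide field_simps)
    have "T 0 = N * (4 powr (1 / N) * S_const powr (real ?n / N) / 4) * w powr (1 / N)"
      unfolding T_def A0 L0 s0 using S w by (simp add: powr_mult rw)
    also have "\<dots> = N * w powr (1 / N) * (S_const / 4) powr (real ?n / N)" unfolding 4 by simp
    also have "\<dots> = K_star ?n"
      unfolding K_star_def sphere_area_eq_unit_ball_vol[OF n(1)] N_def w_def by (simp add: chi_const_def)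
    finally show ?thesis .
  qed
  ultimately have "\<forall>\<^sub>F eps in at_right 0. K' < T eps" using order_tendstoD(1) K(2) by metis
  moreover have "\<forall>\<^sub>F eps::real in at_right 0. 0 < eps \<and> eps < 1/10"
    unfolding eventually_at_right_field by (intro exI[of _ "1/10"]) auto
  ultimately have "\<forall>\<^sub>F eps::real in at_right 0. K' < T eps \<and> 0 < eps \<and> eps < 1/10" by eventually_elim auto
  then obtain eps where eps: "K' < T eps" "0 < eps" "eps < 1/10"
    using eventually_happens'[OF trivial_limit_at_right_real] by blast
  have beta0: "beta eps > 0"
  proof -
    have "(17/10)\<^sup>2 \<le> (2 - 3 * eps)\<^sup>2" using eps by (intro power_mono) auto
    then show ?thesis unfolding beta_def using eps(3) by (simp add: power2_eq_square)
  qed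
  have A0: "A eps > 0" unfolding A_def using beta0 eps by (intro mult_pos_pos) auto
  have s0: "s eps > 0" unfolding s_def using eps w n by (intro mult_pos_pos divide_pos_pos) auto
  have lam0: "lam eps > 0" unfolding lam_def using eps by (intro add_pos_pos) auto
  define p where "p = real ?n / N"
  have p: "p > 0" "1 - p = 1 / N" using n N by (auto simp: p_def N_def field_simps)
  \<comment> \<open>The first power makes \<open>l\<close> small against \<open>eps^2\<close>. The
    second gives \<open>2 * real CARD('d) / L \<le> eps * l\<close>, since \<open>1 / L\<close> is
    the product of the two powers.\<close>
  have "((\<lambda>L::real. L powr (-p)) \<longlongrightarrow> 0) at_top" "((\<lambda>L::real. L powr (-(1/N))) \<longlongrightarrow> 0) at_top"
    using p N by (auto intro!: tendsto_neg_powr filterlim_ident)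
  then have "\<forall>\<^sub>F L::real in at_top. L powr (-p) < eps\<^sup>2 / (100 * K')" "\<forall>\<^sub>F L::real in at_top. L powr (-(1/N)) < eps * K' / (2 * real ?n)"
    using eps K n by (auto intro!: order_tendstoD(2))
  moreover have "\<forall>\<^sub>F L::real in at_top. L \<ge> 1" by (rule eventually_ge_at_top)
  ultimately have "\<forall>\<^sub>F L::real in at_top. L powr (-p) < eps\<^sup>2 / (100 * K') \<and> L powr (-(1/N)) < eps * K' / (2 * real ?n) \<and> L \<ge> 1"
    by eventually_elim auto
  then obtain L0 where L0: "\<And>L. L \<ge> L0 \<Longrightarrow> L powr (-p) < eps\<^sup>2 / (100 * K') \<and> L powr (-(1/N)) < eps * K' / (2 * real ?n) \<and> L \<ge> 1"
    unfolding eventually_at_top_linorder by blast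
  show ?thesis
  proof (intro exI[of _ "max L0 1"] conjI allI impI)
    fix L a :: real and u :: "real^'d \<Rightarrow> real" and G
    assume L: "L \<ge> max L0 1" and a1: "2 - 2 * (K' * L powr (- (real ?n / (real ?n + 1)))) \<le> a" and a2: "a \<le> 2"
      and per: "periodic_L L u" and der: "\<forall>x. (u has_derivative (\<lambda>h. G x \<bullet> h)) (at x)"
      and cG: "continuous_on UNIV G" and mean: "cell_integral L u = 0"
    define l where "l = K' * L powr (-p)"
    have l_eq: "K' * L powr (- (real ?n / (real ?n + 1))) = l" by (simp add: l_def p_def N_def)
    have Lpos: "L > 0" using L by simp
    have l0: "0 \<le> l" using K by (simp add: l_def)
    have l1: "l \<le> eps\<^sup>2 / 100"
      using L0[of L] L K unfolding l_def by (auto simp: field_simps)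
    have e2: "eps\<^sup>2 \<le> eps" using eps by (simp add: power2_eq_square mult_le_cancel_left2)
    have le: "l \<le> eps" using l1 e2 eps by simp
    have l4: "(4 + eps) * l \<le> eps\<^sup>2 / 4"
    proof -
      have "(4 + eps) * l \<le> 5 * l" using eps l0 by (intro mult_right_mono) auto
      also have "5 * l \<le> eps\<^sup>2 / 4" using l1 zero_le_power2[of eps] by linarith
      finally show ?thesis .
    qed
    have kappa: "2 * real ?n / L \<le> eps * l"
    proof -
      have "1 / L = L powr (-1)" using Lpos by (simp add: powr_minus divide_inverse)
      also have "\<dots> = L powr (-p) * L powr (-(1/N))"
      proof -
        have "-1 = -p + -(1/N)" using p(2) by simp
        then show ?thesis by (simp only: powr_add)
      qed
      finally have "2 * real ?n * (1 / L) = L powr (-p) * (2 * real ?n * L powr (-(1/N)))" by (simp only: mult_ac)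
      then have "2 * real ?n / L = L powr (-p) * (2 * real ?n * L powr (-(1/N)))" by simp
      also have "\<dots> \<le> L powr (-p) * (eps * K')"
        using L0[of L] L n by (intro mult_left_mono) (auto simp: field_simps)
      finally show ?thesis by (simp add: l_def mult_ac)
    qed
    have "\<exists>V\<ge>0. cell_integral L (\<lambda>x. (norm (G x))\<^sup>2 / 2 + (u x)\<^sup>2 * (u x - a)\<^sup>2 / 4 - l * (u x)\<^sup>2)
     \<ge> beta eps * (2 - 3 * eps)\<^sup>2 * V\<^sup>2 / L ^ ?n
      + (2 - 4 * eps)^3 / (6 * sqrt 2) * (real ?n * root ?n (unit_ball_vol ?n) * root ?n V ^ (?n - 1))
      - l * ((2 + eps)\<^sup>2 + eps) * V"
      by (rule torus_energy_bound[OF Lpos d per der[rule_format] cG mean eps(2) _ _ a2 _ _ l0 l4 kappa])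
         (use eps a1 beta0 le in \<open>auto simp: l_eq beta_def\<close>)
    then obtain V where V: "V \<ge> 0" "cell_integral L (\<lambda>x. (norm (G x))\<^sup>2 / 2 + (u x)\<^sup>2 * (u x - a)\<^sup>2 / 4 - l * (u x)\<^sup>2)
     \<ge> A eps * V\<^sup>2 / L ^ ?n + real ?n * s eps * root ?n V ^ (?n - 1) - l * lam eps * V"
      by (auto simp: A_def s_def lam_def w_def mult_ac)
    define r where "r = root ?n V"
    have r: "r \<ge> 0" "r ^ ?n = V" using V n by (auto simp: r_def real_root_pow_pos2)
    \<comment> \<open>\<open>X\<close> is the droplet radius on the critical scale, up to the volume
      constant of the ball; it turns \<open>V^2 / L ^ CARD('d)\<close> into
      \<open>r ^ (CARD('d) - 1) * X ^ (CARD('d) + 1)\<close>.\<close>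
    define X where "X = r * L powr (-p)"
    have X0: "X \<ge> 0" using r by (simp add: X_def)
    have XN: "X ^ (?n + 1) = r ^ (?n + 1) / L ^ ?n"
    proof -
      have "(L powr (-p)) ^ (?n + 1) = (L powr (-p)) powr real (?n + 1)" using Lpos by (subst powr_realpow) auto
      also have "\<dots> = L powr (-p * real (?n + 1))" by (rule powr_powr)
      also have "real (?n + 1) = N" by (simp add: N_def)
      also have "-p * N = - real ?n" using N by (simp add: p_def)
      also have "L powr (- real ?n) = 1 / L ^ ?n" using Lpos by (simp add: powr_minus powr_realpow divide_inverse)
      finally show ?thesis unfolding X_def power_mult_distrib by simp
    qed
    have "lam eps * (l * r) = lam eps * (K' * X)" by (simp add: l_def X_def mult_ac)
    also have "\<dots> \<le> lam eps * (T eps * X)" using lam0 eps(1) X0 by (intro mult_left_mono mult_right_mono) auto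
    also have "\<dots> = N * A eps powr (1 / N) * s eps powr (real ?n / N) * X" using lam0 by (simp add: T_def)
    also have "\<dots> \<le> A eps * X ^ (?n + 1) + real ?n * s eps"
      using young_power_bound[OF n(1) A0 _ X0, of "real ?n * s eps"] s0 n by (simp add: N_def)
    finally have "r ^ (?n - 1) * (lam eps * (l * r)) \<le> r ^ (?n - 1) * (A eps * X ^ (?n + 1) + real ?n * s eps)"
      using r by (intro mult_left_mono) auto
    then have "l * lam eps * (r ^ (?n - 1) * r) \<le> A eps * (r ^ (?n - 1) * X ^ (?n + 1)) + real ?n * s eps * r ^ (?n - 1)"
      by (simp only: distrib_left mult_ac)
    moreover have V1: "r ^ (?n - 1) * r = V" using r n by (metis power_minus_mult zero_less_card_finite)
    moreover have "r ^ (?n - 1) * X ^ (?n + 1) = V\<^sup>2 / L ^ ?n"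
    proof -
      have "r ^ (?n - 1) * r ^ (?n + 1) = (r ^ (?n - 1) * r) * r ^ ?n" by (simp only: power_add power_one_right mult_ac)
      also have "\<dots> = V\<^sup>2" unfolding V1 r(2) by (simp add: power2_eq_square)
      finally show ?thesis unfolding XN by simp
    qed
    ultimately have "l * lam eps * V \<le> A eps * V\<^sup>2 / L ^ ?n + real ?n * s eps * r ^ (?n - 1)"
      by simp
    then show "0 \<le> cell_integral L (\<lambda>x. (norm (G x))\<^sup>2 / 2 + (u x)\<^sup>2 * (u x - a)\<^sup>2 / 4
            - K' * L powr (- (real ?n / (real ?n + 1))) * (u x)\<^sup>2)"
      using V(2) unfolding l_eq r_def by linarith
  qed simp
qed

section \<open>Mollification on the torus\<close>

lemma finite_measure_cell: "finite_measure (lebesgue_on (cell L :: (real^'d) set))"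
  unfolding cell_def by (rule finite_measure_lebesgue_on) simp

lemma borel_measurable_on_cell:
  assumes "h \<in> borel_measurable (borel :: (real^'d) measure)"
  shows "h \<in> borel_measurable (lebesgue_on (cell L))"
  using assms by (intro measurable_restrict_space1 measurable_completion) simp

lemma integrable_continuous_scaleR:
  fixes f :: "real^'d \<Rightarrow> 'b::euclidean_space"
  assumes f: "integrable (lebesgue_on (cell L)) f" and h: "continuous_on UNIV h"
  shows "integrable (lebesgue_on (cell L)) (\<lambda>y. h y *\<^sub>R f y)"
proof -
  obtain C where C: "\<And>y. y \<in> cell L \<Longrightarrow> norm (h y) \<le> C"
    using continuous_bounded_on_cell[OF h, of L] by (metis real_norm_def)
  have hm: "h \<in> borel_measurable (lebesgue_on (cell L))"
    by (rule borel_measurable_on_cell) (rule borel_measurable_continuous_onI[OF h])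
  show ?thesis
  proof (rule Bochner_Integration.integrable_bound)
    show "integrable (lebesgue_on (cell L)) (\<lambda>y. C * norm (f y))" using f by simp
    show "(\<lambda>y. h y *\<^sub>R f y) \<in> borel_measurable (lebesgue_on (cell L))"
      using hm f by (intro borel_measurable_scaleR) auto
    show "AE y in lebesgue_on (cell L). norm (h y *\<^sub>R f y) \<le> norm (C * norm (f y))"
    proof (rule AE_I2)
      fix y assume "y \<in> space (lebesgue_on (cell L :: (real^'d) set))"
      then have "norm (h y) \<le> C" using C by simp
      then have "\<bar>h y\<bar> * norm (f y) \<le> C * norm (f y)" by (intro mult_right_mono) auto
      then show "norm (h y *\<^sub>R f y) \<le> norm (C * norm (f y))" by simp
    qed
  qed
qed

lemma integrable_continuous_mult:
  fixes f :: "real^'d \<Rightarrow> real"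
  assumes f: "integrable (lebesgue_on (cell L)) f" and h: "continuous_on UNIV h"
  shows "integrable (lebesgue_on (cell L)) (\<lambda>y. f y * h y)"
  using integrable_continuous_scaleR[OF f h] by (simp add: mult.commute)

lemma integrable_scaleR_continuous:
  fixes f :: "real^'d \<Rightarrow> real" and H :: "real^'d \<Rightarrow> 'b::euclidean_space"
  assumes f: "integrable (lebesgue_on (cell L)) f" and h: "continuous_on UNIV H"
  shows "integrable (lebesgue_on (cell L)) (\<lambda>y. f y *\<^sub>R H y)"
proof -
  have "integrable (lebesgue_on (cell L)) (\<lambda>y. f y * norm (H y))"
    by (rule integrable_continuous_mult[OF f]) (intro continuous_intros h)
  then show ?thesis
  proof (rule Bochner_Integration.integrable_bound)
    have "H \<in> borel_measurable (lebesgue_on (cell L))"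
      by (rule borel_measurable_on_cell) (rule borel_measurable_continuous_onI[OF h])
    then show "(\<lambda>y. f y *\<^sub>R H y) \<in> borel_measurable (lebesgue_on (cell L))"
      using f by (intro borel_measurable_scaleR) auto
  qed simp
qed

lemma square_integrable_imp_integrable:
  fixes f :: "real^'d \<Rightarrow> 'b::euclidean_space"
  assumes "f \<in> borel_measurable (lebesgue_on (cell L))" "integrable (lebesgue_on (cell L)) (\<lambda>x. (norm (f x))\<^sup>2)"
  shows "integrable (lebesgue_on (cell L)) f"
proof (rule Bochner_Integration.integrable_bound)
  interpret finite_measure "lebesgue_on (cell L :: (real^'d) set)" by (rule finite_measure_cell)
  show "integrable (lebesgue_on (cell L)) (\<lambda>x. 1 + (norm (f x))\<^sup>2)" using assms(2) by simp
  have "t \<le> 1 + t\<^sup>2" for t :: real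
    using zero_le_power2[of "t - 1/2"] by (simp add: power2_eq_square algebra_simps)
  then show "AE x in lebesgue_on (cell L). norm (f x) \<le> norm (1 + (norm (f x))\<^sup>2)"
    by (intro AE_I2) (metis abs_ge_self order_trans real_norm_def)
qed (use assms in auto)

text \<open>The gradient \<open>DP\<close> is carried along because the reflected kernel has to
  serve as a \<open>test_fun\<close>. Evenness makes mollification its own adjoint.\<close>

definition periodic_kernel :: "real \<Rightarrow> (real^'d \<Rightarrow> real) \<Rightarrow> (real^'d \<Rightarrow> real^'d) \<Rightarrow> bool" where
  "periodic_kernel L P DP \<longleftrightarrow> periodic_L L P \<and> (\<forall>x. (P has_derivative (\<lambda>h. DP x \<bullet> h)) (at x)) \<and> continuous_on UNIV DP
     \<and> (\<forall>x. P x \<ge> 0) \<and> (\<forall>x. P (- x) = P x) \<and> cell_integral L P = 1"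

definition mollify :: "real \<Rightarrow> (real^'d \<Rightarrow> real) \<Rightarrow> (real^'d \<Rightarrow> 'b::euclidean_space) \<Rightarrow> real^'d \<Rightarrow> 'b" where
  "mollify L P f x = cell_integral L (\<lambda>y. P (x - y) *\<^sub>R f y)"

lemma periodic_kernel_continuous: "periodic_kernel L P DP \<Longrightarrow> continuous_on UNIV P"
  unfolding periodic_kernel_def by (intro continuous_at_imp_continuous_on) (auto intro: has_derivative_continuous)

lemma integral_periodic_shift:
  fixes P :: "real^'d \<Rightarrow> real"
  assumes L: "L > 0" and P: "periodic_L L P" "continuous_on UNIV P" "\<And>x. P x \<ge> 0"
  shows "cell_integral L (\<lambda>x. P (x + a)) = cell_integral L P"
proof -
  have c: "continuous_on UNIV (\<lambda>x. P (x + a))"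
    by (rule continuous_on_compose2[OF P(2)]) (auto intro!: continuous_intros)
  have "ennreal (cell_integral L (\<lambda>x. P (x + a))) = (\<integral>\<^sup>+x\<in>cell L. P (x + a) \<partial>lborel)"
    by (rule nn_integral_cell_eq_integral[OF c, symmetric]) (rule P(3))
  also have "\<dots> = (\<integral>\<^sup>+x\<in>cell L. P x \<partial>lborel)"
    by (rule nn_integral_periodic_shift[OF L])
      (use P borel_measurable_continuous_onI[OF P(2)] in \<open>auto simp: periodic_L_def\<close>)
  also have "\<dots> = ennreal (cell_integral L P)"
    by (rule nn_integral_cell_eq_integral[OF P(2,3)])
  finally show ?thesis using P(3) by (simp add: integral_nonneg_AE)
qed

lemma periodic_kernel_integral:
  assumes L: "L > 0" and P: "periodic_kernel L P DP"
  shows "cell_integral L (\<lambda>x. P (x - y)) = 1"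
    "cell_integral L (\<lambda>y. P (x - y)) = 1"
proof -
  have *: "cell_integral L (\<lambda>x. P (x + a)) = 1" for a
    using integral_periodic_shift[OF L _ periodic_kernel_continuous[OF P]] P by (auto simp: periodic_kernel_def)
  show "cell_integral L (\<lambda>x. P (x - y)) = 1" using *[of "- y"] by simp
  have "P (x - y) = P (y + - x)" for y
    using P unfolding periodic_kernel_def by (metis minus_diff_eq uminus_add_conv_diff add.commute)
  then show "cell_integral L (\<lambda>y. P (x - y)) = 1" using *[of "- x"] by simp
qed

lemma continuous_reflect: "continuous_on UNIV P \<Longrightarrow> continuous_on UNIV (\<lambda>y. P (x - y))"
  for P :: "'a::real_normed_vector \<Rightarrow> 'b::topological_space"
  by (rule continuous_on_compose2[where g=P]) (auto intro!: continuous_intros)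

text \<open>The uniform expansion of the kernel is multiplied by \<open>f\<close> and integrated, so
  integrability of \<open>f\<close> is all that is asked of it.\<close>

lemma mollify_has_derivative:
  fixes f :: "real^'d \<Rightarrow> real"
  assumes L: "L > 0" and per: "periodic_L L P" and der: "\<And>x. (P has_derivative (\<lambda>h. DP x \<bullet> h)) (at x)"
    and cont: "continuous_on UNIV DP" and f: "integrable (lebesgue_on (cell L)) f"
  shows "(mollify L P f has_derivative (\<lambda>h. cell_integral L (\<lambda>y. f y *\<^sub>R DP (x - y)) \<bullet> h)) (at x)"
  unfolding has_derivative_at_alt
proof (intro conjI allI impI)
  let ?M = "lebesgue_on (cell L) :: (real^'d) measure"
  let ?G = "integral\<^sup>L ?M (\<lambda>y. f y *\<^sub>R DP (x - y))"
  show "bounded_linear (\<lambda>h. ?G \<bullet> h)" by (rule bounded_linear_inner_right)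
  fix e :: real assume e: "e > 0"
  have cP: "continuous_on UNIV P" by (rule continuous_on_gradient[OF der])
  define I where "I = integral\<^sup>L ?M (\<lambda>y. \<bar>f y\<bar>)"
  have I: "I \<ge> 0" by (simp add: I_def integral_nonneg_AE)
  \<comment> \<open>Adding 1 keeps the denominator positive even if \<open>f\<close> vanishes almost
    everywhere.\<close>
  have e': "e / (I + 1) > 0" using e I by simp
  obtain d where d: "d > 0" "\<And>z h. norm h < d \<Longrightarrow> \<bar>P (z + h) - P z - DP z \<bullet> h\<bar> \<le> e / (I + 1) * norm h"
    using periodic_C1_uniform_expansion[OF L per der cont e'] by blast
  show "\<exists>d>0. \<forall>y. norm (y - x) < d \<longrightarrow> norm (mollify L P f y - mollify L P f x - ?G \<bullet> (y - x)) \<le> e * norm (y - x)"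
  proof (intro exI[of _ d] conjI allI impI d(1))
    fix x' assume x': "norm (x' - x) < d"
    let ?h = "x' - x"
    have i1: "integrable ?M (\<lambda>y. P (z - y) *\<^sub>R f y)" for z
      by (rule integrable_continuous_scaleR[OF f continuous_reflect[OF cP]])
    have i2: "integrable ?M (\<lambda>y. f y *\<^sub>R DP (x - y))"
      by (rule integrable_scaleR_continuous[OF f continuous_reflect[OF cont]])
    have i3: "integrable ?M (\<lambda>y. (f y *\<^sub>R DP (x - y)) \<bullet> ?h)" using i2 by (rule integrable_inner_left)
    have "mollify L P f x' - mollify L P f x - ?G \<bullet> ?h
        = integral\<^sup>L ?M (\<lambda>y. P (x' - y) *\<^sub>R f y - P (x - y) *\<^sub>R f y - (f y *\<^sub>R DP (x - y)) \<bullet> ?h)"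
    proof -
      have "?G \<bullet> ?h = integral\<^sup>L ?M (\<lambda>y. (f y *\<^sub>R DP (x - y)) \<bullet> ?h)"
        by (rule integral_inner_left[symmetric]) (rule i2)
      then show ?thesis unfolding mollify_def using i1 i3
        by (simp only: Bochner_Integration.integral_diff Bochner_Integration.integrable_diff)
    qed
    also have "norm \<dots> \<le> integral\<^sup>L ?M (\<lambda>y. e / (I + 1) * norm ?h * \<bar>f y\<bar>)"
    proof (rule Bochner_Integration.integral_norm_bound_integral)
      show "integrable ?M (\<lambda>y. P (x' - y) *\<^sub>R f y - P (x - y) *\<^sub>R f y - (f y *\<^sub>R DP (x - y)) \<bullet> ?h)"
        by (intro Bochner_Integration.integrable_diff i1 i3)
      show "integrable ?M (\<lambda>y. e / (I + 1) * norm ?h * \<bar>f y\<bar>)" using f by simp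
      fix y
      have "\<bar>P ((x - y) + ?h) - P (x - y) - DP (x - y) \<bullet> ?h\<bar> \<le> e / (I + 1) * norm ?h" by (rule d(2)[OF x'])
      then have "\<bar>P (x' - y) - P (x - y) - DP (x - y) \<bullet> ?h\<bar> * \<bar>f y\<bar> \<le> e / (I + 1) * norm ?h * \<bar>f y\<bar>"
        by (intro mult_right_mono) (auto simp: algebra_simps)
      moreover have "P (x' - y) *\<^sub>R f y - P (x - y) *\<^sub>R f y - (f y *\<^sub>R DP (x - y)) \<bullet> ?h = (P (x' - y) - P (x - y) - DP (x - y) \<bullet> ?h) * f y"
        by (simp add: algebra_simps)
      ultimately show "norm (P (x' - y) *\<^sub>R f y - P (x - y) *\<^sub>R f y - (f y *\<^sub>R DP (x - y)) \<bullet> ?h) \<le> e / (I + 1) * norm ?h * \<bar>f y\<bar>"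
        by (simp add: abs_mult)
    qed
    also have "\<dots> = e * norm ?h * (I / (I + 1))" by (simp add: I_def)
    also have "\<dots> \<le> e * norm ?h * 1" using e I by (intro mult_left_mono) auto
    finally show "norm (mollify L P f x' - mollify L P f x - ?G \<bullet> (x' - x)) \<le> e * norm (x' - x)" by simp
  qed
qed

text \<open>The vector-valued \<open>H\<close> allows the same statement to serve for a kernel and
  for its gradient.\<close>

lemma mollify_continuous_gen:
  fixes f :: "real^'d \<Rightarrow> real" and H :: "real^'d \<Rightarrow> 'b::euclidean_space"
  assumes L: "L > 0" and per: "periodic_L L H" and cont: "continuous_on UNIV H" and f: "integrable (lebesgue_on (cell L)) f"
  shows "continuous_on UNIV (\<lambda>x. cell_integral L (\<lambda>y. f y *\<^sub>R H (x - y)))"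
  unfolding continuous_on_iff
proof (intro ballI allI impI)
  let ?M = "lebesgue_on (cell L) :: (real^'d) measure"
  fix x :: "real^'d" and e :: real assume e: "e > 0"
  define I where "I = integral\<^sup>L ?M (\<lambda>y. \<bar>f y\<bar>)"
  have I: "I \<ge> 0" by (simp add: I_def integral_nonneg_AE)
  have e': "e / (I + 1) > 0" using e I by simp
  obtain d where d: "d > 0" "\<And>z w. dist z w < d \<Longrightarrow> dist (H z) (H w) < e / (I + 1)"
    using periodic_uniformly_continuous[OF L per cont e'] by blast
  show "\<exists>d>0. \<forall>x'\<in>UNIV. dist x' x < d \<longrightarrow>
      dist (integral\<^sup>L ?M (\<lambda>y. f y *\<^sub>R H (x' - y))) (integral\<^sup>L ?M (\<lambda>y. f y *\<^sub>R H (x - y))) < e"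
  proof (intro exI[of _ d] conjI ballI impI d(1))
    fix x' assume x': "dist x' x < d"
    have i: "integrable ?M (\<lambda>y. f y *\<^sub>R H (z - y))" for z
      by (rule integrable_scaleR_continuous[OF f continuous_reflect[OF cont]])
    have "dist (integral\<^sup>L ?M (\<lambda>y. f y *\<^sub>R H (x' - y))) (integral\<^sup>L ?M (\<lambda>y. f y *\<^sub>R H (x - y)))
       = norm (integral\<^sup>L ?M (\<lambda>y. f y *\<^sub>R H (x' - y) - f y *\<^sub>R H (x - y)))"
      using i by (simp add: dist_norm)
    also have "\<dots> \<le> integral\<^sup>L ?M (\<lambda>y. e / (I + 1) * \<bar>f y\<bar>)"
    proof (rule Bochner_Integration.integral_norm_bound_integral)
      show "integrable ?M (\<lambda>y. f y *\<^sub>R H (x' - y) - f y *\<^sub>R H (x - y))" using i by auto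
      show "integrable ?M (\<lambda>y. e / (I + 1) * \<bar>f y\<bar>)" using f by simp
      fix y
      have "dist (H (x' - y)) (H (x - y)) < e / (I + 1)" by (rule d(2)) (use x' in \<open>simp add: dist_norm\<close>)
      then have "\<bar>f y\<bar> * norm (H (x' - y) - H (x - y)) \<le> \<bar>f y\<bar> * (e / (I + 1))"
        by (intro mult_left_mono) (auto simp: dist_norm)
      then show "norm (f y *\<^sub>R H (x' - y) - f y *\<^sub>R H (x - y)) \<le> e / (I + 1) * \<bar>f y\<bar>"
        by (simp add: mult.commute flip: scaleR_diff_right)
    qed
    also have "\<dots> = e / (I + 1) * I" by (simp add: I_def)
    also have "\<dots> < e" using e I by (simp add: field_simps)
    finally show "dist (integral\<^sup>L ?M (\<lambda>y. f y *\<^sub>R H (x' - y))) (integral\<^sup>L ?M (\<lambda>y. f y *\<^sub>R H (x - y))) < e" .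
  qed
qed

lemma mollify_continuous:
  fixes f :: "real^'d \<Rightarrow> real"
  assumes "L > 0" "periodic_kernel L P DP" "integrable (lebesgue_on (cell L)) f"
  shows "continuous_on UNIV (mollify L P f)"
  using mollify_continuous_gen[OF assms(1) _ periodic_kernel_continuous[OF assms(2)] assms(3)] assms(2)
  by (simp add: mollify_def[abs_def] periodic_kernel_def mult.commute)

text \<open>For fixed \<open>x\<close>, the kernel \<open>P (x - y)\<close> is a test function in
  \<open>y\<close> with gradient \<open>- DP (x - y)\<close>. The weak formulation thus identifies
  the convolution of \<open>m\<close> with \<open>DP\<close> as the mollified weak gradient, and its
  continuity is read off from that form.\<close>

lemma mollify_weak_gradient:
  fixes m :: "real^'d \<Rightarrow> real"
  assumes L: "L > 0" and P: "periodic_kernel L P DP" and H1: "torus_H1 L m g"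
  shows "(mollify L P m has_derivative (\<lambda>h. mollify L P g x \<bullet> h)) (at x)"
    and "continuous_on UNIV (mollify L P g)"
proof -
  let ?M = "lebesgue_on (cell L) :: (real^'d) measure"
  have P': "periodic_L L P" "\<And>x. (P has_derivative (\<lambda>h. DP x \<bullet> h)) (at x)" "continuous_on UNIV DP"
    using P by (auto simp: periodic_kernel_def)
  have cP: "continuous_on UNIV P" by (rule periodic_kernel_continuous[OF P])
  have m: "integrable ?M m"
    by (rule square_integrable_imp_integrable) (use H1 in \<open>simp_all add: torus_H1_def\<close>)
  have g: "integrable ?M g"
    by (rule square_integrable_imp_integrable) (use H1 in \<open>simp_all add: torus_H1_def\<close>)
  have perDP: "periodic_L L DP" by (rule periodic_gradient[OF P'(1,2)])
  have eq: "integral\<^sup>L ?M (\<lambda>y. m y *\<^sub>R DP (x - y)) = mollify L P g x" for x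
  proof -
    have i1: "integrable ?M (\<lambda>y. m y *\<^sub>R DP (x - y))"
      by (rule integrable_scaleR_continuous[OF m continuous_reflect[OF P'(3)]])
    have i2: "integrable ?M (\<lambda>y. P (x - y) *\<^sub>R g y)"
      by (rule integrable_continuous_scaleR[OF g continuous_reflect[OF cP]])
    have tf: "test_fun L (\<lambda>y. P (x - y)) (\<lambda>y. - DP (x - y))"
      unfolding test_fun_def
    proof (intro conjI allI)
      show "periodic_L L (\<lambda>y. P (x - y))"
        unfolding periodic_L_def
      proof (intro allI)
        fix y :: "real^'d" and i
        show "P (x - (y + L *\<^sub>R axis i 1)) = P (x - y)"
          using periodic_LD[OF P'(1), of "x - (y + L *\<^sub>R axis i 1)" i] by (simp add: algebra_simps)
      qed
      show "((\<lambda>y. P (x - y)) has_derivative (\<lambda>h. - DP (x - y) \<bullet> h)) (at y)" for y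
      proof -
        have "((\<lambda>y. x - y) has_derivative (\<lambda>h. - h)) (at y)" by (auto intro!: derivative_eq_intros)
        then have "((\<lambda>y. P (x - y)) has_derivative (\<lambda>h. DP (x - y) \<bullet> - h)) (at y)"
          by (rule has_derivative_compose[OF _ P'(2)])
        then show ?thesis by simp
      qed
      show "continuous_on UNIV (\<lambda>y. - DP (x - y))"
        by (intro continuous_intros continuous_reflect[OF P'(3)])
    qed
    show ?thesis
    proof (rule vec_eq_iff[THEN iffD2], rule allI)
      fix i
      have "integral\<^sup>L ?M (\<lambda>y. m y *\<^sub>R DP (x - y)) $ i = integral\<^sup>L ?M (\<lambda>y. m y * DP (x - y) $ i)"
        using i1 by (simp add: cart_eq_inner_axis flip: integral_inner_left)
      also have "\<dots> = - integral\<^sup>L ?M (\<lambda>y. m y * (- DP (x - y)) $ i)" by simp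
      also have "\<dots> = integral\<^sup>L ?M (\<lambda>y. g y $ i * P (x - y))"
        using H1 tf unfolding torus_H1_def by fastforce
      also have "\<dots> = mollify L P g x $ i"
        unfolding mollify_def using i2 by (simp add: cart_eq_inner_axis mult.commute flip: integral_inner_left)
      finally show "integral\<^sup>L ?M (\<lambda>y. m y *\<^sub>R DP (x - y)) $ i = mollify L P g x $ i" .
    qed
  qed
  show "(mollify L P m has_derivative (\<lambda>h. mollify L P g x \<bullet> h)) (at x)"
    using mollify_has_derivative[OF L P' m, of x] by (simp add: eq)
  show "continuous_on UNIV (mollify L P g)"
    using mollify_continuous_gen[OF L perDP P'(3) m] by (simp add: eq)
qed

lemma mollify_periodic: "periodic_L L P \<Longrightarrow> periodic_L L (mollify L P f)"
proof -
  assume P: "periodic_L L P"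
  have "P (x + L *\<^sub>R axis i 1 - y) = P (x - y)" for x y i
    using periodic_LD[OF P, of "x - y" i] by (simp add: algebra_simps)
  then show ?thesis by (simp add: periodic_L_def mollify_def)
qed

lemma mollify_Fubini:
  fixes f psi :: "real^'d \<Rightarrow> real"
  assumes L: "L > 0" and f: "integrable (lebesgue_on (cell L)) f" and P: "periodic_L L P" "continuous_on UNIV P"
    and psi: "continuous_on UNIV psi"
  shows "cell_integral L (\<lambda>x. mollify L P f x * psi x)
     = cell_integral L (\<lambda>y. f y * cell_integral L (\<lambda>x. P (x - y) * psi x))"
proof -
  let ?M = "lebesgue_on (cell L) :: (real^'d) measure"
  let ?I = "integral\<^sup>L ?M :: (real^'d \<Rightarrow> real) \<Rightarrow> real"
  interpret M: finite_measure ?M by (rule finite_measure_cell)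
  interpret pair_sigma_finite ?M ?M by standard
  obtain B where B: "\<And>x. \<bar>P x\<bar> \<le> B" using periodic_bounded[OF L P] by (auto simp: bounded_iff)
  obtain C where C: "\<And>y. y \<in> cell L \<Longrightarrow> \<bar>psi y\<bar> \<le> C"
    using continuous_bounded_on_cell[OF psi, of L] by (metis real_norm_def)
  have [measurable]: "P \<in> borel_measurable borel" "psi \<in> borel_measurable borel" "f \<in> borel_measurable ?M"
    using borel_measurable_continuous_onI[OF P(2)] borel_measurable_continuous_onI[OF psi] f by auto
  \<comment> \<open>The factors carry the Lebesgue sigma-algebra while \<open>P\<close> and
    \<open>psi\<close> are Borel; the projections are therefore shown to be Borel measurable
    first.\<close>
  have id: "(\<lambda>x. x) \<in> ?M \<rightarrow>\<^sub>M borel" by (rule borel_measurable_on_cell) simp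
  have [measurable]: "fst \<in> borel_measurable (?M \<Otimes>\<^sub>M ?M)" "snd \<in> borel_measurable (?M \<Otimes>\<^sub>M ?M)"
    using measurable_compose[OF measurable_fst id] measurable_compose[OF measurable_snd id] by auto
  have fs: "(\<lambda>p. f (snd p)) \<in> borel_measurable (?M \<Otimes>\<^sub>M ?M)"
    by (rule measurable_compose[OF measurable_snd]) simp
  let ?F = "\<lambda>p. (P (fst p - snd p) * psi (fst p)) * f (snd p)"
  have Fm: "?F \<in> borel_measurable (?M \<Otimes>\<^sub>M ?M)"
    by (intro borel_measurable_times fs) measurable
  have int1: "integrable (?M \<Otimes>\<^sub>M ?M) (\<lambda>p. f (snd p))"
    by (rule Fubini_integrable) (use fs f in auto)
  have int: "integrable (?M \<Otimes>\<^sub>M ?M) ?F"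
  proof (rule Bochner_Integration.integrable_bound[OF _ Fm])
    show "integrable (?M \<Otimes>\<^sub>M ?M) (\<lambda>p. (B * C) * f (snd p))" using int1 by simp
    show "AE p in ?M \<Otimes>\<^sub>M ?M. norm (?F p) \<le> norm ((B * C) * f (snd p))"
    proof (rule AE_I2)
      fix p assume "p \<in> space (?M \<Otimes>\<^sub>M ?M)"
      then have "fst p \<in> cell L" by (auto simp: space_pair_measure)
      then have "\<bar>P (fst p - snd p)\<bar> * \<bar>psi (fst p)\<bar> \<le> B * C"
        using B C by (intro mult_mono) (auto intro: order_trans[OF abs_ge_zero])
      also have "\<dots> \<le> \<bar>B * C\<bar>" by simp
      finally have "\<bar>P (fst p - snd p)\<bar> * \<bar>psi (fst p)\<bar> * \<bar>f (snd p)\<bar> \<le> \<bar>B * C\<bar> * \<bar>f (snd p)\<bar>" by (rule mult_right_mono) simp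
      then show "norm (?F p) \<le> norm ((B * C) * f (snd p))" by (simp add: abs_mult)
    qed
  qed
  have "?I (\<lambda>x. mollify L P f x * psi x) = ?I (\<lambda>x. ?I (\<lambda>y. (P (x - y) * psi x) * f y))"
  proof (rule Bochner_Integration.integral_cong[OF refl])
    fix x
    have "mollify L P f x * psi x = ?I (\<lambda>y. (P (x - y) *\<^sub>R f y) * psi x)"
      unfolding mollify_def by simp
    then show "mollify L P f x * psi x = ?I (\<lambda>y. (P (x - y) * psi x) * f y)" by (simp add: mult_ac)
  qed
  also have "\<dots> = ?I (\<lambda>y. ?I (\<lambda>x. (P (x - y) * psi x) * f y))"
    by (rule Fubini_integral[symmetric]) (use int in \<open>simp add: case_prod_beta'\<close>)
  also have "\<dots> = ?I (\<lambda>y. f y * ?I (\<lambda>x. P (x - y) * psi x))"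
    by (simp add: mult.commute)
  finally show ?thesis .
qed

lemma mollify_integral:
  fixes f :: "real^'d \<Rightarrow> real"
  assumes L: "L > 0" and P: "periodic_kernel L P DP" and f: "integrable (lebesgue_on (cell L)) f"
  shows "cell_integral L (mollify L P f) = cell_integral L f"
  using mollify_Fubini[OF L f _ periodic_kernel_continuous[OF P], of "\<lambda>_. 1"] P periodic_kernel_integral(1)[OF L P]
  by (simp add: periodic_kernel_def)

text \<open>Jensen by the tangent of the fourth power at \<open>r\<close>, integrated against the
  probability density \<open>P (x - y)\<close>. Integrating in \<open>x\<close> then uses that
  mollification preserves integrals.\<close>

lemma mollify_jensen_power4:
  fixes m :: "real^'d \<Rightarrow> real"
  assumes L: "L > 0" and P: "periodic_kernel L P DP" and m: "integrable (lebesgue_on (cell L)) m"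
    and m4: "integrable (lebesgue_on (cell L)) (\<lambda>x. (m x)^4)"
  shows "cell_integral L (\<lambda>x. (mollify L P m x)^4) \<le> cell_integral L (\<lambda>x. (m x)^4)"
proof -
  let ?M = "lebesgue_on (cell L) :: (real^'d) measure"
  let ?I = "integral\<^sup>L ?M :: (real^'d \<Rightarrow> real) \<Rightarrow> real"
  have cP: "continuous_on UNIV P" by (rule periodic_kernel_continuous[OF P])
  have "(mollify L P m x)^4 \<le> mollify L P (\<lambda>x. (m x)^4) x" for x
  proof -
    define r where "r = mollify L P m x"
    have i: "integrable ?M (\<lambda>y. P (x - y) *\<^sub>R (m y)^4)" "integrable ?M (\<lambda>y. P (x - y) *\<^sub>R m y)" "integrable ?M (\<lambda>y. P (x - y))"
      using integrable_continuous_scaleR[OF m4 continuous_reflect[OF cP]]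
        integrable_continuous_scaleR[OF m continuous_reflect[OF cP]] integrable_on_cell[OF continuous_reflect[OF cP]] by auto
    have tangent: "s^4 \<ge> 4 * r^3 * s - 3 * r^4" for s :: real
    proof -
      have "s^4 - (4 * r^3 * s - 3 * r^4) = (s - r)\<^sup>2 * ((s + r)\<^sup>2 + 2 * r\<^sup>2)"
        by (simp add: power2_eq_square power3_eq_cube power4_eq_xxxx algebra_simps)
      also have "\<dots> \<ge> 0" by simp
      finally show ?thesis by simp
    qed
    have "?I (\<lambda>y. 4 * r^3 * (P (x - y) *\<^sub>R m y) - 3 * r^4 * P (x - y)) \<le> ?I (\<lambda>y. P (x - y) *\<^sub>R (m y)^4)"
    proof (rule integral_mono)
      fix y
      have "P (x - y) * (4 * r^3 * m y - 3 * r^4) \<le> P (x - y) * (m y)^4"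
        using P tangent by (intro mult_left_mono) (auto simp: periodic_kernel_def)
      then show "4 * r^3 * (P (x - y) *\<^sub>R m y) - 3 * r^4 * P (x - y) \<le> P (x - y) *\<^sub>R (m y)^4"
        by (simp add: algebra_simps)
    qed (use i in auto)
    also have "?I (\<lambda>y. 4 * r^3 * (P (x - y) *\<^sub>R m y) - 3 * r^4 * P (x - y)) = 4 * r^3 * r - 3 * r^4"
      using i periodic_kernel_integral(2)[OF L P, of x] by (simp add: r_def mollify_def)
    also have "\<dots> = r^4" by (simp add: power3_eq_cube power4_eq_xxxx)
    finally show ?thesis by (simp add: r_def mollify_def)
  qed
  then have "?I (\<lambda>x. (mollify L P m x)^4) \<le> ?I (mollify L P (\<lambda>x. (m x)^4))"
    by (intro integral_mono integrable_on_cell continuous_intros mollify_continuous[OF L P] m m4)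
  then show ?thesis using mollify_integral[OF L P m4] by simp
qed

text \<open>As for the fourth power, with the affine minorant of the squared norm at
  \<open>r\<close>. The continuity assumption is supplied by
  \<open>mollify_weak_gradient\<close>.\<close>

lemma mollify_jensen_norm2:
  fixes g :: "real^'d \<Rightarrow> real^'d"
  assumes L: "L > 0" and P: "periodic_kernel L P DP" and g: "integrable (lebesgue_on (cell L)) g"
    and g2: "integrable (lebesgue_on (cell L)) (\<lambda>x. (norm (g x))\<^sup>2)" and cont: "continuous_on UNIV (mollify L P g)"
  shows "cell_integral L (\<lambda>x. (norm (mollify L P g x))\<^sup>2) \<le> cell_integral L (\<lambda>x. (norm (g x))\<^sup>2)"
proof -
  let ?M = "lebesgue_on (cell L) :: (real^'d) measure"
  let ?I = "integral\<^sup>L ?M :: (real^'d \<Rightarrow> real) \<Rightarrow> real"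
  have cP: "continuous_on UNIV P" by (rule periodic_kernel_continuous[OF P])
  have "(norm (mollify L P g x))\<^sup>2 \<le> mollify L P (\<lambda>x. (norm (g x))\<^sup>2) x" for x
  proof -
    define r where "r = mollify L P g x"
    have i: "integrable ?M (\<lambda>y. P (x - y) *\<^sub>R (norm (g y))\<^sup>2)" "integrable ?M (\<lambda>y. P (x - y) *\<^sub>R g y)" "integrable ?M (\<lambda>y. P (x - y))"
      using integrable_continuous_scaleR[OF g2 continuous_reflect[OF cP]]
        integrable_continuous_scaleR[OF g continuous_reflect[OF cP]] integrable_on_cell[OF continuous_reflect[OF cP]] by auto
    have i': "integrable ?M (\<lambda>y. r \<bullet> (P (x - y) *\<^sub>R g y))" using i(2) by (rule integrable_inner_right)
    have tangent: "(norm s)\<^sup>2 \<ge> 2 * (r \<bullet> s) - (norm r)\<^sup>2" for s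
    proof -
      have "(norm (s - r))\<^sup>2 \<ge> 0" by simp
      then show ?thesis by (simp add: power2_norm_eq_inner inner_diff_left inner_diff_right inner_commute)
    qed
    have "?I (\<lambda>y. 2 * (r \<bullet> (P (x - y) *\<^sub>R g y)) - (norm r)\<^sup>2 * P (x - y)) \<le> ?I (\<lambda>y. P (x - y) *\<^sub>R (norm (g y))\<^sup>2)"
    proof (rule integral_mono)
      fix y
      have "P (x - y) * (2 * (r \<bullet> g y) - (norm r)\<^sup>2) \<le> P (x - y) * (norm (g y))\<^sup>2"
        using P tangent by (intro mult_left_mono) (auto simp: periodic_kernel_def)
      then show "2 * (r \<bullet> (P (x - y) *\<^sub>R g y)) - (norm r)\<^sup>2 * P (x - y) \<le> P (x - y) *\<^sub>R (norm (g y))\<^sup>2"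
        by (simp add: algebra_simps)
    qed (use i i' in auto)
    also have "?I (\<lambda>y. 2 * (r \<bullet> (P (x - y) *\<^sub>R g y)) - (norm r)\<^sup>2 * P (x - y)) = 2 * (r \<bullet> r) - (norm r)\<^sup>2"
    proof -
      have "?I (\<lambda>y. r \<bullet> (P (x - y) *\<^sub>R g y)) = r \<bullet> r"
        unfolding r_def[unfolded mollify_def] using i(2) by (subst integral_inner_right) auto
      then show ?thesis using i i' periodic_kernel_integral(2)[OF L P, of x] by simp
    qed
    also have "\<dots> = (norm r)\<^sup>2" by (simp add: power2_norm_eq_inner)
    finally show ?thesis by (simp add: r_def mollify_def)
  qed
  then have "?I (\<lambda>x. (norm (mollify L P g x))\<^sup>2) \<le> ?I (mollify L P (\<lambda>x. (norm (g x))\<^sup>2))"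
    by (intro integral_mono integrable_on_cell continuous_intros mollify_continuous[OF L P] g2 cont)
  then show ?thesis using mollify_integral[OF L P g2] by simp
qed

section \<open>Approximate identity and density\<close>

lemma measure_lebesgue_on_subset:
  assumes "U \<subseteq> cell L" "U \<in> sets lebesgue"
  shows "measure (lebesgue_on (cell L)) U = measure lebesgue U"
  using assms by (intro measure_restrict_space) (auto simp: cell_def)

text \<open>By continuity \<open>kappa\<close> exceeds \<open>q\<close> on a nonempty open set,
  whose measure is the constant. It does not depend on \<open>N\<close>, which is what the lower
  bound for the normalisation requires.\<close>

lemma open_box_measure_bound:
  fixes kappa :: "real^'d \<Rightarrow> real"
  assumes kappa: "continuous_on UNIV kappa" "\<And>x. kappa x \<ge> 0" and y: "y \<in> box 0 (\<chi> i. L)" and q: "0 \<le> q" "q < kappa y"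
  shows "\<exists>\<mu>>0. \<forall>N. cell_integral L (\<lambda>x. kappa x ^ N) \<ge> q ^ N * \<mu>"
proof -
  let ?M = "lebesgue_on (cell L) :: (real^'d) measure"
  let ?I = "integral\<^sup>L ?M :: (real^'d \<Rightarrow> real) \<Rightarrow> real"
  interpret M: finite_measure ?M by (rule finite_measure_cell)
  define U where "U = box 0 (\<chi> i. L) \<inter> {x. q < kappa x}"
  have "open {x. q < kappa x}" using kappa(1) by (intro open_Collect_less) auto
  then have oU: "open U" "bounded U" by (auto simp: U_def intro: bounded_subset[OF bounded_box])
  have "y \<in> U" using y q by (simp add: U_def)
  then have mu: "measure lebesgue U > 0" using measure_open_pos[OF oU] by blast
  have sub: "U \<subseteq> cell L" unfolding U_def cell_def using box_subset_cbox by blast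
  have sM: "U \<in> sets ?M" using oU sub by (auto simp: sets_restrict_space_iff cell_def)
  show ?thesis
  proof (intro exI[of _ "measure lebesgue U"] conjI allI mu)
    fix N
    have "q ^ N * measure lebesgue U = ?I (\<lambda>x. q ^ N * indicator U x)"
      using sM measure_lebesgue_on_subset[OF sub] oU Int_absorb2[OF sub]
      by (simp add: M.emeasure_finite less_top[symmetric])
    also have "\<dots> \<le> ?I (\<lambda>x. kappa x ^ N)"
    proof (rule integral_mono)
      show "integrable ?M (\<lambda>x. q ^ N * indicator U x)" using sM Int_absorb2[OF sub] by (intro integrable_mult_right) (simp add: integrable_indicator_iff M.emeasure_finite less_top[symmetric])
      show "integrable ?M (\<lambda>x. kappa x ^ N)" by (intro integrable_on_cell continuous_intros kappa)
      show "q ^ N * indicator U x \<le> kappa x ^ N" for x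
        using q kappa(2)[of x] by (auto simp: indicator_def U_def intro!: power_mono)
    qed
    finally show "?I (\<lambda>x. kappa x ^ N) \<ge> q ^ N * measure lebesgue U" .
  qed
qed

text \<open>Laplace's method: away from the strict maximum \<open>kappa\<close> is at most
  \<open>q\<close>, while near it \<open>kappa\<close> exceeds some \<open>q' > q\<close> on a set
  of positive measure. The outer part of the normalised integral therefore decays like
  \<open>(q / q') ^ N\<close>.\<close>

lemma power_concentration:
  fixes kappa psi :: "real^'d \<Rightarrow> real"
  assumes L: "L > 0" and kappa: "continuous_on UNIV kappa" "\<And>x. kappa x \<ge> 0" and psi: "continuous_on UNIV psi"
    and y: "y \<in> box 0 (\<chi> i. L)" and max: "\<And>x. x \<in> cell L \<Longrightarrow> x \<noteq> y \<Longrightarrow> kappa x < kappa y"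
  shows "(\<lambda>N. cell_integral L (\<lambda>x. kappa x ^ N * psi x) / cell_integral L (\<lambda>x. kappa x ^ N)) \<longlonglongrightarrow> psi y"
proof (rule LIMSEQ_I)
  let ?M = "lebesgue_on (cell L) :: (real^'d) measure"
  let ?I = "integral\<^sup>L ?M :: (real^'d \<Rightarrow> real) \<Rightarrow> real"
  fix e :: real assume e: "e > 0"
  have ycell: "y \<in> cell L" using y box_subset_cbox unfolding cell_def by blast
  have "0 \<noteq> y" using y by (auto simp: mem_box_cart)
  moreover have "(0::real^'d) \<in> cell L" using L by (simp add: mem_cell)
  ultimately have cpos: "kappa y > 0" using max[of 0] kappa(2)[of 0] by (meson order_le_less_trans)
  obtain delta where delta: "delta > 0" "\<And>x. dist x y < delta \<Longrightarrow> \<bar>psi x - psi y\<bar> < e / 2"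
    using psi e unfolding continuous_on_iff dist_real_def by (metis UNIV_I half_gt_zero)
  define A where "A = cell L - ball y delta"
  have cA: "compact A" unfolding A_def cell_def by (intro compact_diff) auto
  obtain q where q: "0 \<le> q" "q < kappa y" "\<And>x. x \<in> A \<Longrightarrow> kappa x \<le> q"
  proof (cases "A = {}")
    case True
    then show ?thesis using that[of 0] cpos by auto
  next
    case False
    then obtain x0 where "x0 \<in> A" "\<And>x. x \<in> A \<Longrightarrow> kappa x \<le> kappa x0"
      using continuous_attains_sup[OF cA False] kappa(1) continuous_on_subset by (metis subset_UNIV)
    moreover have "kappa x0 < kappa y" using \<open>x0 \<in> A\<close> delta(1) by (intro max) (auto simp: A_def)
    ultimately show ?thesis using that[of "kappa x0"] kappa(2) by blast
  qed
  define q' where "q' = (q + kappa y) / 2"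
  have q': "q < q'" "q' < kappa y" "q' > 0" using q cpos by (auto simp: q'_def)
  obtain \<mu> where \<mu>: "\<mu> > 0" "\<And>N. ?I (\<lambda>x. kappa x ^ N) \<ge> q' ^ N * \<mu>"
    using open_box_measure_bound[OF kappa y, of q'] q' by auto
  obtain B where B: "\<And>y. y \<in> cell L \<Longrightarrow> \<bar>psi y\<bar> \<le> B"
    using continuous_bounded_on_cell[OF psi, of L] by (metis real_norm_def)
  have B0: "B \<ge> 0" using B[OF ycell] by linarith
  define C where "C = 2 * B * L ^ CARD('d) / \<mu>"
  have bound: "\<bar>?I (\<lambda>x. kappa x ^ N * psi x) / ?I (\<lambda>x. kappa x ^ N) - psi y\<bar> \<le> e / 2 + C * (q / q') ^ N" for N
  proof -
    let ?J = "?I (\<lambda>x. kappa x ^ N)"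
    have q'N: "q' ^ N * \<mu> > 0" using q' \<mu> by simp
    have J: "?J > 0" using \<mu>(2)[of N] q'N by linarith
    have i1: "integrable ?M (\<lambda>x. kappa x ^ N)" "integrable ?M (\<lambda>x. kappa x ^ N * psi x)" "integrable ?M (\<lambda>x. kappa x ^ N * (psi x - psi y))"
      "integrable ?M (\<lambda>x. e / 2 * kappa x ^ N + 2 * B * q ^ N)"
      by (intro integrable_on_cell continuous_intros kappa psi)+
    have "?I (\<lambda>x. kappa x ^ N * psi x) / ?J - psi y = ?I (\<lambda>x. kappa x ^ N * (psi x - psi y)) / ?J"
      using J i1 by (simp add: right_diff_distrib diff_divide_distrib)
    also have "\<bar>\<dots>\<bar> = \<bar>?I (\<lambda>x. kappa x ^ N * (psi x - psi y))\<bar> / ?J" using J by simp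
    also have "\<dots> \<le> (e / 2 * ?J + 2 * B * q ^ N * L ^ CARD('d)) / ?J"
    proof (rule divide_right_mono)
      have "norm (?I (\<lambda>x. kappa x ^ N * (psi x - psi y))) \<le> ?I (\<lambda>x. e / 2 * kappa x ^ N + 2 * B * q ^ N)"
      proof (rule Bochner_Integration.integral_norm_bound_integral[OF i1(3,4)])
        fix x assume "x \<in> space ?M"
        then have x: "x \<in> cell L" by simp
        show "norm (kappa x ^ N * (psi x - psi y)) \<le> e / 2 * kappa x ^ N + 2 * B * q ^ N"
        proof (cases "dist x y < delta")
          case True
          then have "\<bar>psi x - psi y\<bar> * kappa x ^ N \<le> e / 2 * kappa x ^ N" using delta(2)[OF True] kappa(2) by (intro mult_right_mono) auto
          moreover have "0 \<le> 2 * B * q ^ N" using B0 q by simp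
          moreover have "norm (kappa x ^ N * (psi x - psi y)) = \<bar>psi x - psi y\<bar> * kappa x ^ N"
            using kappa(2)[of x] by (simp add: abs_mult)
          ultimately show ?thesis by linarith
        next
          case False
          then have "x \<in> A" using x by (auto simp: A_def dist_commute)
          then have "kappa x ^ N \<le> q ^ N" using q kappa(2) by (intro power_mono) auto
          moreover have "\<bar>psi x - psi y\<bar> \<le> 2 * B" using B[OF x] B[OF ycell] by linarith
          ultimately have "kappa x ^ N * \<bar>psi x - psi y\<bar> \<le> q ^ N * (2 * B)" using q kappa(2) by (intro mult_mono) auto
          moreover have "0 \<le> e / 2 * kappa x ^ N" using e kappa(2) by simp
          moreover have "norm (kappa x ^ N * (psi x - psi y)) = kappa x ^ N * \<bar>psi x - psi y\<bar>"
            using kappa(2)[of x] by (simp add: abs_mult)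
          ultimately show ?thesis by (simp add: mult_ac)
        qed
      qed
      also have "\<dots> = e / 2 * ?J + 2 * B * q ^ N * L ^ CARD('d)"
      proof -
        have "?I (\<lambda>x. 2 * B * q ^ N) = 2 * B * q ^ N * L ^ CARD('d)"
          using measure_lebesgue_on_cell[of L, where 'd='d] L by simp
        moreover have "integrable ?M (\<lambda>x. 2 * B * q ^ N)" by (intro integrable_on_cell continuous_intros)
        ultimately show ?thesis using i1(1) by simp
      qed
      finally show "\<bar>?I (\<lambda>x. kappa x ^ N * (psi x - psi y))\<bar> \<le> e / 2 * ?J + 2 * B * q ^ N * L ^ CARD('d)" by simp
    qed (use J in auto)
    also have "\<dots> = e / 2 + 2 * B * q ^ N * L ^ CARD('d) / ?J" using J by (simp add: add_divide_distrib)
    also have "2 * B * q ^ N * L ^ CARD('d) / ?J \<le> 2 * B * q ^ N * L ^ CARD('d) / (q' ^ N * \<mu>)"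
      using \<mu>(2)[of N] q'N B0 q L by (intro divide_left_mono) (auto intro!: mult_pos_pos J)
    also have "\<dots> = C * (q / q') ^ N" by (simp add: C_def power_divide mult_ac)
    finally show ?thesis by simp
  qed
  have "(\<lambda>N. C * (q / q') ^ N) \<longlonglongrightarrow> C * 0"
    using q q' by (intro tendsto_intros LIMSEQ_realpow_zero) auto
  then obtain N0 where N0: "\<And>N. N \<ge> N0 \<Longrightarrow> norm (C * (q / q') ^ N - C * 0) < e / 2"
    using LIMSEQ_D[of _ _ "e / 2"] e by (metis half_gt_zero)
  show "\<exists>no. \<forall>N\<ge>no. norm (?I (\<lambda>x. kappa x ^ N * psi x) / ?I (\<lambda>x. kappa x ^ N) - psi y) < e"
  proof (intro exI[of _ N0] allI impI)
    fix N assume "N \<ge> N0"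
    then have "C * (q / q') ^ N < e / 2" using N0[of N] by simp
    then show "norm (?I (\<lambda>x. kappa x ^ N * psi x) / ?I (\<lambda>x. kappa x ^ N) - psi y) < e"
      using bound[of N] by simp
  qed
qed

section \<open>The cosine kernel and its powers\<close>

text \<open>A nonnegative even trigonometric polynomial that on the torus attains its maximum only
  at the origin. Its normalised powers are an approximate identity in the spirit of the de la
  Vallee-Poussin kernels.\<close>

definition cos_kernel :: "real \<Rightarrow> real^'d \<Rightarrow> real" where
  "cos_kernel L z = (\<Sum>i\<in>UNIV. 1 + cos (2 * pi / L * z $ i))"

lemma cos_kernel_nonneg: "cos_kernel L z \<ge> 0"
  unfolding cos_kernel_def by (intro sum_nonneg) (smt (verit) cos_ge_minus_one)

lemma cos_kernel_even: "cos_kernel L (- z) = cos_kernel L z"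
  by (simp add: cos_kernel_def)

lemma cos_kernel_periodic: "L > 0 \<Longrightarrow> periodic_L L (cos_kernel L)"
proof -
  assume L: "L > 0"
  have *: "cos (2 * pi / L * (z + L *\<^sub>R axis j 1) $ i) = cos (2 * pi / L * z $ i)" for z :: "real^'d" and i j
    using L by (cases "i = j") (auto simp: axis_def ring_distribs)
  show ?thesis unfolding periodic_L_def cos_kernel_def by (intro allI) (simp only: *)
qed

lemma continuous_cos_kernel: "continuous_on UNIV (cos_kernel L)"
  unfolding cos_kernel_def[abs_def] by (intro continuous_intros)

text \<open>A cosine equal to 1 makes the coordinate an integer multiple of \<open>L\<close>, hence
  0. The range of \<open>z\<close> is that of differences between a point of the closed cell and one
  of its interior.\<close>

lemma cos_kernel_max:
  fixes z :: "real^'d"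
  assumes L: "L > 0" and z: "z \<noteq> 0" "\<And>i. \<bar>z $ i\<bar> < L"
  shows "cos_kernel L z < cos_kernel L (0 :: real^'d)"
proof -
  obtain i where i: "z $ i \<noteq> 0" using z(1) by (auto simp: vec_eq_iff)
  have "cos (2 * pi / L * z $ i) \<noteq> 1"
  proof
    assume "cos (2 * pi / L * z $ i) = 1"
    then have "\<exists>n::int. 2 * pi / L * z $ i = of_int n * 2 * pi" by (simp only: cos_one_2pi_int)
    then obtain n :: int where "2 * pi / L * z $ i = of_int n * 2 * pi" by blast
    then have n: "z $ i = of_int n * L" using L by (simp add: field_simps)
    then have "\<bar>of_int n :: real\<bar> * L < 1 * L" using z(2)[of i] L by (simp add: abs_mult)
    then have "\<bar>of_int n :: real\<bar> < 1" using L by (simp only: mult_less_cancel_right_pos)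
    then have "n = 0" by linarith
    then show False using n i by simp
  qed
  then have lt: "cos (2 * pi / L * z $ i) < 1" using cos_le_one[of "2 * pi / L * z $ i"] by linarith
  have "(\<Sum>j\<in>UNIV. 1 + cos (2 * pi / L * z $ j)) < (\<Sum>j\<in>(UNIV :: 'd set). 2)"
    by (rule sum_strict_mono_ex1) (use lt in \<open>auto intro!: exI[of _ i]\<close>)
  then show ?thesis by (simp add: cos_kernel_def)
qed

lemma cos_kernel_power_kernel:
  assumes L: "L > 0"
  shows "\<exists>DP. periodic_kernel L (\<lambda>z::real^'d. cos_kernel L z ^ N / cell_integral L (\<lambda>z::real^'d. cos_kernel L z ^ N)) DP"
    and "cell_integral L (\<lambda>z::real^'d. cos_kernel L z ^ N) > 0"
proof -
  let ?M = "lebesgue_on (cell L) :: (real^'d) measure"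
  let ?k = "cos_kernel L :: real^'d \<Rightarrow> real"
  define Z where "Z = integral\<^sup>L ?M (\<lambda>z. ?k z ^ N)"
  \<comment> \<open>At a quarter period every cosine vanishes, so the kernel equals the dimension,
    safely above \<open>1/2\<close>, and the normalisation is positive.\<close>
  define y :: "real^'d" where "y = (\<chi> i. L / 4)"
  have "?k y = real CARD('d)" using L by (simp add: cos_kernel_def y_def)
  then have "?k y \<ge> 1" by (simp add: Suc_leI)
  moreover have "y \<in> box 0 (\<chi> i. L)" using L by (simp add: y_def mem_box_cart)
  ultimately obtain \<mu> where "\<mu> > 0" "Z \<ge> (1/2) ^ N * \<mu>"
    using open_box_measure_bound[where kappa="cos_kernel L" and y=y and L=L and q="1/2", OF continuous_cos_kernel cos_kernel_nonneg] unfolding Z_def by auto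
  then show Z: "integral\<^sup>L ?M (\<lambda>z. ?k z ^ N) > 0"
    unfolding Z_def[symmetric] by (smt (verit) mult_pos_pos zero_less_power zero_less_divide_1_iff)
  define w where "w = 2 * pi / L"
  define Dk where "Dk z = (\<chi> i. - w * sin (w * z $ i))" for z :: "real^'d"
  define DP where "DP z = (real N * ?k z ^ (N - 1) / Z) *\<^sub>R Dk z" for z
  have dk: "(?k has_derivative (\<lambda>h. Dk z \<bullet> h)) (at z)" for z
  proof -
    have "((\<lambda>z. cos (w * z $ i)) has_derivative (\<lambda>h. - sin (w * z $ i) * (w * h $ i))) (at z)" for i
      by (auto intro!: derivative_eq_intros bounded_linear.has_derivative[OF bounded_linear_vec_nth] simp: fun_eq_iff)
    then have "((\<lambda>z. \<Sum>i\<in>UNIV. 1 + cos (w * z $ i)) has_derivative (\<lambda>h. \<Sum>i\<in>UNIV. 0 + - sin (w * z $ i) * (w * h $ i))) (at z)"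
      by (intro has_derivative_sum has_derivative_add has_derivative_const)
    moreover have "(\<lambda>z. \<Sum>i\<in>UNIV. 1 + cos (w * z $ i)) = ?k" by (simp add: cos_kernel_def fun_eq_iff w_def)
    moreover have "(\<lambda>h. \<Sum>i\<in>UNIV. 0 + - sin (w * z $ i) * (w * h $ i)) = (\<lambda>h. Dk z \<bullet> h)"
      by (simp add: fun_eq_iff Dk_def inner_vec_def mult_ac)
    ultimately show ?thesis by simp
  qed
  have "periodic_kernel L (\<lambda>z. ?k z ^ N / Z) DP"
    unfolding periodic_kernel_def
  proof (intro conjI allI)
    show "periodic_L L (\<lambda>z. ?k z ^ N / Z)" by (simp add: periodic_L_def periodic_LD[OF cos_kernel_periodic[OF L]])
    have "((\<lambda>z. ?k z ^ N / Z) has_derivative (\<lambda>h. (real N * ?k z ^ (N - 1) * (Dk z \<bullet> h)) / Z)) (at z)" for z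
      using bounded_linear.has_derivative[OF bounded_linear_divide[of Z] has_derivative_power[OF dk[of z], of N]] by (simp add: mult_ac)
    then show "((\<lambda>z. ?k z ^ N / Z) has_derivative (\<lambda>h. DP z \<bullet> h)) (at z)" for z
      by (simp add: DP_def)
    show "continuous_on UNIV DP" unfolding DP_def Dk_def
      using continuous_cos_kernel[of L] Z by (intro continuous_intros) (auto simp: Z_def intro!: continuous_intros)
    show "?k x ^ N / Z \<ge> 0" for x
      using Z cos_kernel_nonneg[of L x] unfolding Z_def by (intro divide_nonneg_pos zero_le_power)
    show "?k (- x) ^ N / Z = ?k x ^ N / Z" for x by (simp add: cos_kernel_even)
    show "integral\<^sup>L ?M (\<lambda>z. ?k z ^ N / Z) = 1" using Z by (simp add: Z_def)
  qed
  then show "\<exists>DP. periodic_kernel L (\<lambda>z::real^'d. cos_kernel L z ^ N / cell_integral L (\<lambda>z::real^'d. cos_kernel L z ^ N)) DP"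
    unfolding Z_def by blast
qed

text \<open>Only interior \<open>y\<close> are treated: for \<open>y\<close> on a face of the cell
  the maximum would recur on the opposite face. The excluded set is null.\<close>

lemma approximate_identity:
  assumes L: "L > 0"
  shows "\<exists>P DP. (\<forall>N::nat. periodic_kernel L (P N :: real^'d \<Rightarrow> real) (DP N)) \<and>
    (\<forall>psi y. continuous_on UNIV psi \<longrightarrow> y \<in> box 0 (\<chi> i. L) \<longrightarrow>
       (\<lambda>N. cell_integral L (\<lambda>x. P N (x - y) * psi x)) \<longlonglongrightarrow> psi y)"
proof -
  let ?M = "lebesgue_on (cell L) :: (real^'d) measure"
  let ?k = "cos_kernel L :: real^'d \<Rightarrow> real"
  define P where "P N z = ?k z ^ N / integral\<^sup>L ?M (\<lambda>z. ?k z ^ N)" for N z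
  obtain DP where DP: "\<And>N. periodic_kernel L (P N) (DP N)"
    using cos_kernel_power_kernel(1)[OF L] unfolding P_def[abs_def] by metis
  have "(\<lambda>N. integral\<^sup>L ?M (\<lambda>x. P N (x - y) * psi x)) \<longlonglongrightarrow> psi y"
    if psi: "continuous_on UNIV psi" and y: "y \<in> box 0 (\<chi> i. L)" for psi y
  proof -
    have c: "continuous_on UNIV (\<lambda>x. ?k (x - y))"
      by (rule continuous_on_compose2[OF continuous_cos_kernel]) (auto intro!: continuous_intros)
    have max: "?k (x - y) < ?k (y - y)" if "x \<in> cell L" "x \<noteq> y" for x
    proof -
      have "\<bar>(x - y) $ i\<bar> < L" for i
      proof -
        have "0 \<le> x $ i" "x $ i \<le> L" "0 < y $ i" "y $ i < L" using that(1) y by (auto simp: mem_cell mem_box_cart)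
        then show ?thesis unfolding vector_minus_component by linarith
      qed
      then show ?thesis using cos_kernel_max[OF L, of "x - y"] that(2) by simp
    qed
    have "integral\<^sup>L ?M (\<lambda>x. ?k (x - y) ^ N) = integral\<^sup>L ?M (\<lambda>z. ?k z ^ N)" for N
    proof -
      have "periodic_L L (\<lambda>z. ?k z ^ N)" by (simp add: periodic_L_def periodic_LD[OF cos_kernel_periodic[OF L]])
      moreover have "continuous_on UNIV (\<lambda>z. ?k z ^ N)" by (intro continuous_intros continuous_cos_kernel)
      moreover have "?k z ^ N \<ge> 0" for z by (simp add: cos_kernel_nonneg)
      ultimately show ?thesis using integral_periodic_shift[OF L, of "\<lambda>z. ?k z ^ N" "- y"] by simp
    qed
    then have "integral\<^sup>L ?M (\<lambda>x. ?k (x - y) ^ N * psi x) / integral\<^sup>L ?M (\<lambda>x. ?k (x - y) ^ N)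
        = integral\<^sup>L ?M (\<lambda>x. P N (x - y) * psi x)" for N
      by (simp add: P_def)
    then show ?thesis
      using power_concentration[OF L c cos_kernel_nonneg psi y max] by simp
  qed
  then show ?thesis using DP by blast
qed

text \<open>First \<open>m\<close> is truncated at height \<open>k\<close>. The truncation is then
  approximated almost everywhere by continuous functions truncated at the same height, so the
  constant \<open>(2 * k)^2\<close> dominates on the cell.\<close>

lemma continuous_dense_L2:
  fixes m :: "real^'d \<Rightarrow> real"
  assumes m: "m \<in> borel_measurable (lebesgue_on (cell L))" "integrable (lebesgue_on (cell L)) (\<lambda>x. (m x)\<^sup>2)" and e: "e > 0"
  shows "\<exists>psi. continuous_on UNIV psi \<and> cell_integral L (\<lambda>x. (m x - psi x)\<^sup>2) < e"
proof -
  let ?M = "lebesgue_on (cell L) :: (real^'d) measure"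
  let ?I = "integral\<^sup>L ?M :: (real^'d \<Rightarrow> real) \<Rightarrow> real"
  interpret M: finite_measure ?M by (rule finite_measure_cell)
  define T where "T k s = max (- real k) (min s (real k))" for k and s :: real
  have Tb: "\<bar>T k s\<bar> \<le> real k" for k s by (auto simp: T_def)
  have Tc: "continuous_on UNIV (T k)" for k unfolding T_def[abs_def] by (intro continuous_intros)
  have Tm: "(\<lambda>x. T k (f x)) \<in> borel_measurable ?M" if "f \<in> borel_measurable ?M" for k f
    using that unfolding T_def by measurable
  have "(\<lambda>k. ?I (\<lambda>x. (m x - T k (m x))\<^sup>2)) \<longlonglongrightarrow> ?I (\<lambda>x. 0)"
  proof (rule integral_dominated_convergence[OF _ _ m(2)])
    show "AE x in ?M. (\<lambda>k. (m x - T k (m x))\<^sup>2) \<longlonglongrightarrow> 0"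
    proof (rule AE_I2)
      fix x
      obtain k0 :: nat where "\<bar>m x\<bar> \<le> real k0" using real_arch_simple by blast
      then have "(m x - T k (m x))\<^sup>2 = 0" if "k \<ge> k0" for k using that by (auto simp: T_def)
      then show "(\<lambda>k. (m x - T k (m x))\<^sup>2) \<longlonglongrightarrow> 0"
        by (intro tendsto_eventually) (auto simp: eventually_sequentially)
    qed
    show "AE x in ?M. norm ((m x - T k (m x))\<^sup>2) \<le> (m x)\<^sup>2" for k
    proof (rule AE_I2)
      fix x
      have "\<bar>m x - T k (m x)\<bar> \<le> \<bar>m x\<bar>" by (auto simp: T_def)
      then show "norm ((m x - T k (m x))\<^sup>2) \<le> (m x)\<^sup>2" by (simp add: abs_le_square_iff)
    qed
    show "(\<lambda>x. (m x - T k (m x))\<^sup>2) \<in> borel_measurable ?M" for k using Tm[OF m(1)] m(1) by measurable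
  qed simp
  then have "\<forall>\<^sub>F k in sequentially. ?I (\<lambda>x. (m x - T k (m x))\<^sup>2) < e / 4"
    using e by (intro order_tendstoD(2)) auto
  then obtain k where k: "?I (\<lambda>x. (m x - T k (m x))\<^sup>2) < e / 4"
    using eventually_happens'[OF sequentially_bot] by blast
  have cl: "cell L \<in> sets (lebesgue :: (real^'d) measure)" by (simp add: cell_def)
  have "(\<lambda>x. if x \<in> cell L then m x else 0) \<in> borel_measurable lebesgue"
    using m(1) borel_measurable_if[OF cl] by blast
  then have "(\<lambda>x. if x \<in> cell L then m x else 0) measurable_on UNIV"
    by (rule lebesgue_measurable_imp_measurable_on_real) simp
  then obtain X g where X: "negligible X" and g: "\<And>n. continuous_on UNIV (g n)"
    and lim: "\<And>x. x \<notin> X \<Longrightarrow> (\<lambda>n. g n x) \<longlonglongrightarrow> (if x \<in> cell L then m x else 0)"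
    unfolding measurable_on_def by auto
  have cTg: "continuous_on UNIV (\<lambda>x. T k (g n x))" for n
    by (rule continuous_on_compose2[OF Tc g]) auto
  have gm: "(\<lambda>x. T k (g n x)) \<in> borel_measurable ?M" for n
    by (rule borel_measurable_on_cell) (rule borel_measurable_continuous_onI[OF cTg])
  have "AE x in lebesgue. x \<notin> X" using X by (simp add: negligible_iff_null_sets AE_not_in)
  then have "AE x in lebesgue. x \<in> cell L \<longrightarrow> x \<notin> X" by eventually_elim simp
  then have AEX: "AE x in ?M. x \<notin> X" using cl by (simp add: AE_restrict_space_iff)
  have "(\<lambda>n. ?I (\<lambda>x. (T k (m x) - T k (g n x))\<^sup>2)) \<longlonglongrightarrow> ?I (\<lambda>x. 0)"
  proof (rule integral_dominated_convergence[where w="\<lambda>_. (2 * real k)\<^sup>2"])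
    show "AE x in ?M. (\<lambda>n. (T k (m x) - T k (g n x))\<^sup>2) \<longlonglongrightarrow> 0"
      using AEX AE_space
    proof eventually_elim
      case (elim x)
      then have "(\<lambda>n. g n x) \<longlonglongrightarrow> m x" using lim[of x] by simp
      then have "(\<lambda>n. T k (g n x)) \<longlonglongrightarrow> T k (m x)"
        using continuous_on_tendsto_compose[OF Tc] by (simp add: comp_def)
      then have "(\<lambda>n. (T k (m x) - T k (g n x))\<^sup>2) \<longlonglongrightarrow> (T k (m x) - T k (m x))\<^sup>2" by (intro tendsto_intros)
      then show ?case by simp
    qed
    show "AE x in ?M. norm ((T k (m x) - T k (g n x))\<^sup>2) \<le> (2 * real k)\<^sup>2" for n
    proof (rule AE_I2)
      fix x
      have "\<bar>T k (m x) - T k (g n x)\<bar> \<le> \<bar>2 * real k\<bar>" using Tb[of k "m x"] Tb[of k "g n x"] by linarith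
      then have "(T k (m x) - T k (g n x))\<^sup>2 \<le> (2 * real k)\<^sup>2" by (simp only: abs_le_square_iff)
      then show "norm ((T k (m x) - T k (g n x))\<^sup>2) \<le> (2 * real k)\<^sup>2" by simp
    qed
    show "(\<lambda>x. (T k (m x) - T k (g n x))\<^sup>2) \<in> borel_measurable ?M" for n using Tm[OF m(1)] gm by measurable
  qed auto
  then have "\<forall>\<^sub>F n in sequentially. ?I (\<lambda>x. (T k (m x) - T k (g n x))\<^sup>2) < e / 4"
    using e by (intro order_tendstoD(2)) auto
  then obtain n where n: "?I (\<lambda>x. (T k (m x) - T k (g n x))\<^sup>2) < e / 4"
    using eventually_happens'[OF sequentially_bot] by blast
  have i1: "integrable ?M (\<lambda>x. (m x - T k (m x))\<^sup>2)"
  proof (rule Bochner_Integration.integrable_bound[OF m(2)])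
    show "(\<lambda>x. (m x - T k (m x))\<^sup>2) \<in> borel_measurable ?M" using Tm[OF m(1)] m(1) by measurable
    have "\<bar>m x - T k (m x)\<bar> \<le> \<bar>m x\<bar>" for x by (auto simp: T_def)
    then show "AE x in ?M. norm ((m x - T k (m x))\<^sup>2) \<le> norm ((m x)\<^sup>2)" by (simp add: abs_le_square_iff)
  qed
  have i2: "integrable ?M (\<lambda>x. (T k (m x) - T k (g n x))\<^sup>2)"
  proof (rule M.integrable_const_bound[where B="(2 * real k)\<^sup>2"])
    show "(\<lambda>x. (T k (m x) - T k (g n x))\<^sup>2) \<in> borel_measurable ?M" using Tm[OF m(1)] gm by measurable
    have "\<bar>T k (m x) - T k (g n x)\<bar> \<le> \<bar>2 * real k\<bar>" for x using Tb[of k "m x"] Tb[of k "g n x"] by linarith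
    then have "(T k (m x) - T k (g n x))\<^sup>2 \<le> (2 * real k)\<^sup>2" for x by (simp only: abs_le_square_iff)
    then show "AE x in ?M. norm ((T k (m x) - T k (g n x))\<^sup>2) \<le> (2 * real k)\<^sup>2" by simp
  qed
  have "?I (\<lambda>x. (m x - T k (g n x))\<^sup>2) \<le> ?I (\<lambda>x. 2 * (m x - T k (m x))\<^sup>2 + 2 * (T k (m x) - T k (g n x))\<^sup>2)"
  proof (rule integral_mono')
    show "integrable ?M (\<lambda>x. 2 * (m x - T k (m x))\<^sup>2 + 2 * (T k (m x) - T k (g n x))\<^sup>2)" using i1 i2 by simp
    have "(a - c)\<^sup>2 \<le> 2 * (a - b)\<^sup>2 + 2 * (b - c)\<^sup>2" for a b c :: real
      using zero_le_power2[of "a - 2 * b + c"] by (simp add: power2_eq_square algebra_simps)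
    then show "(m x - T k (g n x))\<^sup>2 \<le> 2 * (m x - T k (m x))\<^sup>2 + 2 * (T k (m x) - T k (g n x))\<^sup>2" for x by blast
  qed simp
  also have "\<dots> < e" using i1 i2 k n by simp
  finally show ?thesis using cTg by blast
qed

section \<open>Passage to the Sobolev class\<close>

text \<open>A continuous periodic function is bounded, so adding a constant reduces to the
  nonnegative case.\<close>

lemma integral_periodic_shift_signed:
  fixes f :: "real^'d \<Rightarrow> real"
  assumes L: "L > 0" and f: "periodic_L L f" "continuous_on UNIV f"
  shows "cell_integral L (\<lambda>x. f (x + a)) = cell_integral L f"
proof -
  let ?M = "lebesgue_on (cell L) :: (real^'d) measure"
  let ?I = "integral\<^sup>L ?M :: (real^'d \<Rightarrow> real) \<Rightarrow> real"
  obtain B where B: "\<And>x. \<bar>f x\<bar> \<le> B" using periodic_bounded[OF L f] by (auto simp: bounded_iff)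
  have c: "continuous_on UNIV (\<lambda>x. f (x + a))"
    by (rule continuous_on_compose2[OF f(2)]) (auto intro!: continuous_intros)
  have i: "integrable ?M f" "integrable ?M (\<lambda>x. f (x + a))" "integrable ?M (\<lambda>x. B)"
    using f c by (auto intro!: integrable_on_cell continuous_intros)
  have "f x + B \<ge> 0" for x using B[of x] by linarith
  then have "?I (\<lambda>x. f (x + a) + B) = ?I (\<lambda>x. f x + B)"
    by (intro integral_periodic_shift[OF L, of "\<lambda>x. f x + B"]) (use f in \<open>auto simp: periodic_L_def intro!: continuous_intros\<close>)
  then show ?thesis using i by simp
qed

text \<open>Increments of a periodic function integrate to zero, and the uniform expansion passes
  this on to the derivative. It is the weak formulation for a constant function with gradient
  0.\<close>

lemma test_fun_gradient_integral:
  fixes phi :: "real^'d \<Rightarrow> real"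
  assumes L: "L > 0" and t: "test_fun L phi G"
  shows "cell_integral L (\<lambda>x. G x $ i) = 0"
proof -
  let ?M = "lebesgue_on (cell L) :: (real^'d) measure"
  let ?I = "integral\<^sup>L ?M :: (real^'d \<Rightarrow> real) \<Rightarrow> real"
  have per: "periodic_L L phi" and der: "\<And>x. (phi has_derivative (\<lambda>h. G x \<bullet> h)) (at x)" and cG: "continuous_on UNIV G"
    using t by (auto simp: test_fun_def)
  have c: "continuous_on UNIV phi" by (rule continuous_on_gradient[OF der])
  have "\<bar>?I (\<lambda>x. G x $ i)\<bar> \<le> e" if "e > 0" for e
  proof -
    define e' where "e' = e / L ^ CARD('d)"
    have e': "e' > 0" using that L by (simp add: e'_def)
    obtain d where d: "d > 0" "\<And>x h. norm h < d \<Longrightarrow> \<bar>phi (x + h) - phi x - G x \<bullet> h\<bar> \<le> e' * norm h"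
      using periodic_C1_uniform_expansion[OF L per der cG e'] by blast
    define s where "s = d / 2"
    define h where "h = s *\<^sub>R (axis i 1 :: real^'d)"
    have h: "norm h = s" "s > 0" "s < d" using d by (auto simp: h_def s_def)
    have Gh: "G x \<bullet> h = s * G x $ i" for x by (simp add: h_def inner_axis)
    have ch: "continuous_on UNIV (\<lambda>x. phi (x + h))"
      by (rule continuous_on_compose2[OF c]) (auto intro!: continuous_intros)
    have i: "integrable ?M (\<lambda>x. phi (x + h))" "integrable ?M phi" "integrable ?M (\<lambda>x. G x $ i)" "integrable ?M (\<lambda>x. e' * s)"
      using c ch cG by (auto intro!: integrable_on_cell continuous_intros)
    have "norm (?I (\<lambda>x. phi (x + h) - phi x - s * G x $ i)) \<le> ?I (\<lambda>x. e' * s)"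
      by (rule Bochner_Integration.integral_norm_bound_integral) (use i d(2)[of h] h Gh in auto)
    also have "?I (\<lambda>x. e' * s) = s * e"
      using measure_lebesgue_on_cell[of L, where 'd='d] L by (simp add: e'_def)
    also have "?I (\<lambda>x. phi (x + h) - phi x - s * G x $ i) = - s * ?I (\<lambda>x. G x $ i)"
      using i integral_periodic_shift_signed[OF L per c, of h] by simp
    finally have "s * \<bar>?I (\<lambda>x. G x $ i)\<bar> \<le> s * e" using h by (simp add: abs_mult)
    then show ?thesis using h by simp
  qed
  then have "\<bar>?I (\<lambda>x. G x $ i)\<bar> \<le> 0" by (rule field_le_epsilon[of _ 0, simplified])
  then show ?thesis by simp
qed

lemma admissible_const:
  assumes L: "L > 0"
  shows "admissible L n (\<lambda>_::real^'d. n) (\<lambda>_. 0)"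
proof -
  interpret M: finite_measure "lebesgue_on (cell L :: (real^'d) set)" by (rule finite_measure_cell)
  show ?thesis
    unfolding admissible_def torus_H1_def
    using test_fun_gradient_integral[OF L] measure_lebesgue_on_cell[of L, where 'd='d] L
    by (auto simp: periodic_L_def)
qed

lemma Fdw_expand: "Fdw v = v^4 / 4 - v\<^sup>2 / 2 + 1 / 4"
  by (simp add: Fdw_def power2_eq_square power4_eq_xxxx field_simps)

lemma energy_const:
  assumes L: "L > 0"
  shows "energy L (\<lambda>_::real^'d. n) (\<lambda>_. 0) = ennreal (Fdw n * L ^ CARD('d))"
proof -
  have "emeasure (lebesgue_on (cell L)) (space (lebesgue_on (cell L)) :: (real^'d) set) = ennreal (L ^ CARD('d))"
    using emeasure_cell[of L, where 'd='d] L by (subst emeasure_restrict_space) auto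
  moreover have "Fdw n \<ge> 0" by (simp add: Fdw_def)
  ultimately show ?thesis using L by (simp add: energy_def ennreal_mult)
qed

text \<open>Fubini moves the mollification onto \<open>psi\<close>, where it converges at every
  interior point and stays within the bound of \<open>psi\<close>; dominated convergence needs only
  that \<open>m\<close> is integrable.\<close>

lemma mollify_weak_limit:
  fixes m :: "real^'d \<Rightarrow> real"
  assumes L: "L > 0" and P: "\<And>N::nat. periodic_kernel L (P N) (DP N)"
    and lim: "\<And>psi y. continuous_on UNIV psi \<Longrightarrow> y \<in> box 0 (\<chi> i. L) \<Longrightarrow>
       (\<lambda>N. cell_integral L (\<lambda>x. P N (x - y) * psi x)) \<longlonglongrightarrow> psi y"
    and m: "integrable (lebesgue_on (cell L)) m" and psi: "continuous_on UNIV psi"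
  shows "(\<lambda>N. cell_integral L (\<lambda>x. mollify L (P N) m x * psi x))
     \<longlonglongrightarrow> cell_integral L (\<lambda>x. m x * psi x)"
proof -
  let ?M = "lebesgue_on (cell L) :: (real^'d) measure"
  let ?I = "integral\<^sup>L ?M :: (real^'d \<Rightarrow> real) \<Rightarrow> real"
  have cP: "continuous_on UNIV (P N)" for N using periodic_kernel_continuous[OF P] .
  have perP: "periodic_L L (P N)" "P N (- z) = P N z" "P N z \<ge> 0" for N z using P[of N] by (auto simp: periodic_kernel_def)
  have ipsi: "integrable ?M psi" by (rule integrable_on_cell[OF psi])
  define \<Psi> where "\<Psi> N y = ?I (\<lambda>x. P N (x - y) * psi x)" for N y
  have "\<Psi> N = mollify L (P N) psi" for N
  proof
    fix y
    have "P N (x - y) = P N (y - x)" for x using perP(2)[of N "y - x"] by simp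
    then show "\<Psi> N y = mollify L (P N) psi y" by (simp add: \<Psi>_def mollify_def)
  qed
  then have c\<Psi>: "continuous_on UNIV (\<Psi> N)" for N using mollify_continuous[OF L P ipsi] by simp
  obtain B where B: "\<And>y. y \<in> cell L \<Longrightarrow> \<bar>psi y\<bar> \<le> B"
    using continuous_bounded_on_cell[OF psi, of L] by (metis real_norm_def)
  have \<Psi>B: "\<bar>\<Psi> N y\<bar> \<le> B" for N y
  proof -
    have cr: "continuous_on UNIV (\<lambda>x. P N (x - y))"
      by (rule continuous_on_compose2[OF cP]) (auto intro!: continuous_intros)
    have "norm (\<Psi> N y) \<le> ?I (\<lambda>x. P N (x - y) * B)"
      unfolding \<Psi>_def
    proof (rule Bochner_Integration.integral_norm_bound_integral)
      show "integrable ?M (\<lambda>x. P N (x - y) * psi x)" "integrable ?M (\<lambda>x. P N (x - y) * B)"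
        by (intro integrable_on_cell continuous_intros cr psi)+
      show "norm (P N (x - y) * psi x) \<le> P N (x - y) * B" if "x \<in> space ?M" for x
        using B[of x] that perP(3) by (simp add: abs_mult mult_left_mono)
    qed
    also have "\<dots> = B" using periodic_kernel_integral(1)[OF L P, of N y] by simp
    finally show ?thesis by simp
  qed
  have "(\<lambda>N. ?I (\<lambda>y. m y * \<Psi> N y)) \<longlonglongrightarrow> ?I (\<lambda>y. m y * psi y)"
  proof (rule integral_dominated_convergence[where w="\<lambda>y. B * \<bar>m y\<bar>"])
    show "integrable ?M (\<lambda>y. B * \<bar>m y\<bar>)" using m by simp
    have "AE y :: real^'d in lebesgue. y \<in> cell L \<longrightarrow> y \<in> box 0 (\<chi> i. L)"
      using AE_cell_in_box by (rule AE_completion)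
    then have "AE y in ?M. y \<in> box 0 (\<chi> i. L)" by (subst AE_restrict_space_iff) (auto simp: cell_def)
    then show "AE y in ?M. (\<lambda>N. m y * \<Psi> N y) \<longlonglongrightarrow> m y * psi y"
      by eventually_elim (auto simp: \<Psi>_def intro!: tendsto_intros lim[OF psi])
    show "AE y in ?M. norm (m y * \<Psi> N y) \<le> B * \<bar>m y\<bar>" for N
      using mult_right_mono[OF \<Psi>B abs_ge_zero] by (intro AE_I2) (simp add: abs_mult mult.commute)
    show "(\<lambda>y. m y * psi y) \<in> borel_measurable ?M" using integrable_continuous_mult[OF m psi] by simp
    show "(\<lambda>y. m y * \<Psi> N y) \<in> borel_measurable ?M" for N using integrable_continuous_mult[OF m c\<Psi>] by simp
  qed
  then show ?thesis unfolding mollify_Fubini[OF L m perP(1) cP psi] \<Psi>_def .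
qed

text \<open>Coercivity is applied to the mollifications of \<open>m\<close> minus their mean
  \<open>n\<close>. Since the quadratic integral stands alone on the small side of the resulting
  inequality, it need only be recovered from below in the limit.\<close>

lemma energy_gap:
  fixes m :: "real^'d \<Rightarrow> real"
  assumes L: "L > 0" and n: "-1 < n" "n \<le> -1 + l0" and l: "l0 \<le> l"
    and coer: "\<And>(u :: real^'d \<Rightarrow> real) G. periodic_L L u \<Longrightarrow> (\<And>x. (u has_derivative (\<lambda>h. G x \<bullet> h)) (at x)) \<Longrightarrow>
       continuous_on UNIV G \<Longrightarrow> cell_integral L u = 0 \<Longrightarrow>
       0 \<le> cell_integral L (\<lambda>x. (norm (G x))\<^sup>2 / 2 + (u x)\<^sup>2 * (u x + 2 * n)\<^sup>2 / 4 - l * (u x)\<^sup>2)"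
    and H1: "torus_H1 L m g" and mean: "cell_integral L m = n * L ^ CARD('d)"
    and fin: "integrable (lebesgue_on (cell L)) (\<lambda>x. 1/2 * (norm (g x))\<^sup>2 + Fdw (m x))"
  shows "Fdw n * L ^ CARD('d) + (l - l0) * cell_integral L (\<lambda>x. (m x - n)\<^sup>2)
     \<le> cell_integral L (\<lambda>x. 1/2 * (norm (g x))\<^sup>2 + Fdw (m x))"
proof -
  let ?M = "lebesgue_on (cell L) :: (real^'d) measure"
  let ?I = "integral\<^sup>L ?M :: (real^'d \<Rightarrow> real) \<Rightarrow> real"
  interpret M: finite_measure ?M by (rule finite_measure_cell)
  define Q where "Q = L ^ CARD('d)"
  have Qm: "measure ?M (cell L) = Q"
    using measure_lebesgue_on_cell[of L, where 'd='d] L by (simp add: Q_def)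
  have mm: "m \<in> borel_measurable ?M" and gm: "g \<in> borel_measurable ?M"
    and m2: "integrable ?M (\<lambda>x. (m x)\<^sup>2)" and g2: "integrable ?M (\<lambda>x. (norm (g x))\<^sup>2)"
    using H1 by (simp_all add: torus_H1_def)
  have im: "integrable ?M m" by (rule square_integrable_imp_integrable) (use mm m2 in simp_all)
  have ig: "integrable ?M g" by (rule square_integrable_imp_integrable) (use gm g2 in simp_all)
  have m4: "integrable ?M (\<lambda>x. (m x)^4)"
  proof -
    have "integrable ?M (\<lambda>x. (1/2 * (norm (g x))\<^sup>2 + Fdw (m x)) - 1/2 * (norm (g x))\<^sup>2)"
      by (rule Bochner_Integration.integrable_diff[OF fin]) (use g2 in simp)
    then have F: "integrable ?M (\<lambda>x. Fdw (m x))" by simp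
    have "integrable ?M (\<lambda>x. 4 * Fdw (m x) + 2 * (m x)\<^sup>2 - 1)"
      by (intro Bochner_Integration.integrable_diff Bochner_Integration.integrable_add integrable_mult_right F m2) simp
    moreover have "(\<lambda>x. 4 * Fdw (m x) + 2 * (m x)\<^sup>2 - 1) = (\<lambda>x. (m x)^4)" by (simp add: fun_eq_iff Fdw_expand)
    ultimately show ?thesis by simp
  qed
  \<comment> \<open>What is left of \<open>l\<close> after the coefficient
    \<open>(1 - n^2) / 2\<close> of the negative quadratic term. As \<open>1 - n < 2\<close>, that
    coefficient is at most \<open>1 + n\<close>, hence at most \<open>l0\<close>.\<close>
  define c where "c = l - (1 - n\<^sup>2) / 2"
  have cl: "l - l0 \<le> c" "0 \<le> c"
  proof -
    have "(1 - n\<^sup>2) / 2 = (1 + n) * ((1 - n) / 2)" by (simp add: power2_eq_square algebra_simps)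
    also have "\<dots> \<le> (1 + n) * 1" using n by (intro mult_left_mono) auto
    finally show "l - l0 \<le> c" "0 \<le> c" using n l by (auto simp: c_def)
  qed
  define a2 where "a2 = ?I (\<lambda>x. (m x)\<^sup>2)"
  define a4 where "a4 = ?I (\<lambda>x. (m x)^4)"
  define b2 where "b2 = ?I (\<lambda>x. (norm (g x))\<^sup>2)"
  define R where "R = b2 / 2 + a4 / 4 + Q / 4 + c * (n\<^sup>2 * Q) - Fdw n * Q"
  \<comment> \<open>With \<open>u = v - n\<close> the potential is \<open>(v^2 - n^2)^2 / 4\<close>.
    The linear term is fixed by the mean, and Jensen replaces the gradient and quartic integrals by
    those of \<open>m\<close>, so that \<open>R\<close> is the same for every kernel.\<close>
  have smooth: "(1/2 + c) * ?I (\<lambda>x. (mollify L P m x)\<^sup>2) \<le> R" if P: "periodic_kernel L P DP" for P DP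
  proof -
    define v where "v = mollify L P m"
    define w where "w = mollify L P g"
    have der: "(v has_derivative (\<lambda>h. w x \<bullet> h)) (at x)" for x
      unfolding v_def w_def by (rule mollify_weak_gradient(1)[OF L P H1])
    have cw: "continuous_on UNIV w" unfolding w_def by (rule mollify_weak_gradient(2)[OF L P H1])
    have cv: "continuous_on UNIV v" unfolding v_def by (rule mollify_continuous[OF L P im])
    have perv: "periodic_L L v" unfolding v_def using P by (intro mollify_periodic) (simp add: periodic_kernel_def)
    have iv: "integrable ?M v" "integrable ?M (\<lambda>x. (v x)\<^sup>2)" "integrable ?M (\<lambda>x. (v x)^4)" "integrable ?M (\<lambda>x. (norm (w x))\<^sup>2)"
      by (intro integrable_on_cell continuous_intros cv cw)+
    have vmean: "integral\<^sup>L ?M v = n * Q" using mollify_integral[OF L P im] mean by (simp add: v_def Q_def)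
    have umean: "?I (\<lambda>x. v x - n) = 0" using iv(1) vmean Qm by simp
    have "0 \<le> ?I (\<lambda>x. (norm (w x))\<^sup>2 / 2 + (v x - n)\<^sup>2 * (v x - n + 2 * n)\<^sup>2 / 4 - l * (v x - n)\<^sup>2)"
    proof (rule coer[OF _ _ cw umean])
      show "periodic_L L (\<lambda>x. v x - n)" using perv by (simp add: periodic_L_def)
      show "((\<lambda>x. v x - n) has_derivative (\<lambda>h. w x \<bullet> h)) (at x)" for x
        using has_derivative_diff[OF der[of x] has_derivative_const[of n]] by simp
    qed
    also have "(\<lambda>x. (norm (w x))\<^sup>2 / 2 + (v x - n)\<^sup>2 * (v x - n + 2 * n)\<^sup>2 / 4 - l * (v x - n)\<^sup>2)
      = (\<lambda>x. (norm (w x))\<^sup>2 / 2 + (v x)^4 / 4 - (1/2 + c) * (v x)\<^sup>2 + (n - n^3 + 2 * c * n) * v x + (1/4 - Fdw n + (n^3 - n) * n - c * n\<^sup>2))"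
      by (simp add: fun_eq_iff Fdw_def c_def power2_eq_square power3_eq_cube power4_eq_xxxx field_simps)
    also have "integral\<^sup>L ?M \<dots> = ?I (\<lambda>x. (norm (w x))\<^sup>2) / 2 + ?I (\<lambda>x. (v x)^4) / 4
        - (1/2 + c) * ?I (\<lambda>x. (v x)\<^sup>2) + (n - n^3 + 2 * c * n) * (n * Q) + (1/4 - Fdw n + (n^3 - n) * n - c * n\<^sup>2) * Q"
      using iv vmean Qm by simp
    finally have 1: "(1/2 + c) * ?I (\<lambda>x. (v x)\<^sup>2) \<le> ?I (\<lambda>x. (norm (w x))\<^sup>2) / 2 + ?I (\<lambda>x. (v x)^4) / 4
        + (n - n^3 + 2 * c * n) * (n * Q) + (1/4 - Fdw n + (n^3 - n) * n - c * n\<^sup>2) * Q" by simp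
    have 2: "(n - n^3 + 2 * c * n) * (n * Q) + (1/4 - Fdw n + (n^3 - n) * n - c * n\<^sup>2) * Q = Q / 4 + c * (n\<^sup>2 * Q) - Fdw n * Q"
      by (simp add: power2_eq_square power3_eq_cube algebra_simps)
    have "?I (\<lambda>x. (norm (w x))\<^sup>2) \<le> b2"
      unfolding w_def b2_def by (rule mollify_jensen_norm2[OF L P ig g2]) (use cw w_def in simp)
    moreover have "?I (\<lambda>x. (v x)^4) \<le> a4"
      unfolding v_def a4_def by (rule mollify_jensen_power4[OF L P im m4])
    ultimately show ?thesis using 1 2 unfolding R_def v_def[symmetric] by linarith
  qed
  obtain P :: "nat \<Rightarrow> real^'d \<Rightarrow> real" and DP where P: "\<And>N. periodic_kernel L (P N) (DP N)"
    and lim: "\<And>psi y. continuous_on UNIV psi \<Longrightarrow> y \<in> box 0 (\<chi> i. L) \<Longrightarrow>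
       (\<lambda>N. ?I (\<lambda>x. P N (x - y) * psi x)) \<longlonglongrightarrow> psi y"
    using approximate_identity[OF L, where 'd='d] by blast
  \<comment> \<open>\<open>2 * v * psi - psi^2 \<le> v^2\<close> replaces the square by something
    affine in \<open>v\<close>, which passes to the weak limit. The price is the squared distance
    from \<open>m\<close> to \<open>psi\<close>, made small afterwards by density.\<close>
  have weak: "(1/2 + c) * (a2 - ?I (\<lambda>x. (m x - psi x)\<^sup>2)) \<le> R" if psi: "continuous_on UNIV psi" for psi
  proof -
    have i: "integrable ?M (\<lambda>x. m x * psi x)" "integrable ?M (\<lambda>x. (psi x)\<^sup>2)"
      using integrable_continuous_mult[OF im psi] psi by (auto intro!: integrable_on_cell continuous_intros)
    have "(1/2 + c) * (2 * ?I (\<lambda>x. mollify L (P N) m x * psi x) - ?I (\<lambda>x. (psi x)\<^sup>2)) \<le> R" for N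
    proof -
      have cv: "continuous_on UNIV (mollify L (P N) m)" by (rule mollify_continuous[OF L P im])
      have iv: "integrable ?M (\<lambda>x. (mollify L (P N) m x)\<^sup>2)" "integrable ?M (\<lambda>x. mollify L (P N) m x * psi x)"
        by (intro integrable_on_cell continuous_intros cv psi)+
      have "0 \<le> ?I (\<lambda>x. (mollify L (P N) m x - psi x)\<^sup>2)" by (intro integral_nonneg_AE) simp
      also have "(\<lambda>x. (mollify L (P N) m x - psi x)\<^sup>2) = (\<lambda>x. (mollify L (P N) m x)\<^sup>2 - 2 * (mollify L (P N) m x * psi x) + (psi x)\<^sup>2)"
        by (simp add: fun_eq_iff power2_eq_square algebra_simps)
      finally have "2 * ?I (\<lambda>x. mollify L (P N) m x * psi x) - ?I (\<lambda>x. (psi x)\<^sup>2)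
          \<le> ?I (\<lambda>x. (mollify L (P N) m x)\<^sup>2)" using iv i by simp
      then have "(1/2 + c) * (2 * ?I (\<lambda>x. mollify L (P N) m x * psi x) - ?I (\<lambda>x. (psi x)\<^sup>2))
          \<le> (1/2 + c) * ?I (\<lambda>x. (mollify L (P N) m x)\<^sup>2)" using cl by (intro mult_left_mono) auto
      also have "\<dots> \<le> R" by (rule smooth[OF P])
      finally show ?thesis .
    qed
    moreover have "(\<lambda>N. (1/2 + c) * (2 * ?I (\<lambda>x. mollify L (P N) m x * psi x) - ?I (\<lambda>x. (psi x)\<^sup>2)))
        \<longlonglongrightarrow> (1/2 + c) * (2 * ?I (\<lambda>x. m x * psi x) - ?I (\<lambda>x. (psi x)\<^sup>2))"
      by (intro tendsto_intros mollify_weak_limit[OF L P lim im psi])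
    ultimately have "(1/2 + c) * (2 * ?I (\<lambda>x. m x * psi x) - ?I (\<lambda>x. (psi x)\<^sup>2)) \<le> R"
      by (intro LIMSEQ_le_const2) auto
    moreover have "?I (\<lambda>x. (m x - psi x)\<^sup>2) = a2 - (2 * ?I (\<lambda>x. m x * psi x) - ?I (\<lambda>x. (psi x)\<^sup>2))"
    proof -
      have "(\<lambda>x. (m x - psi x)\<^sup>2) = (\<lambda>x. (m x)\<^sup>2 - 2 * (m x * psi x) + (psi x)\<^sup>2)"
        by (simp add: fun_eq_iff power2_eq_square algebra_simps)
      then show ?thesis using i m2 by (simp add: a2_def)
    qed
    ultimately show ?thesis by simp
  qed
  have main: "(1/2 + c) * a2 \<le> R"
  proof (rule field_le_epsilon)
    fix e :: real assume e: "e > 0"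
    then have "e / (1/2 + c) > 0" using cl by simp
    then obtain psi where psi: "continuous_on UNIV psi" "?I (\<lambda>x. (m x - psi x)\<^sup>2) < e / (1/2 + c)"
      using continuous_dense_L2[OF mm m2] by blast
    have "(1/2 + c) * ?I (\<lambda>x. (m x - psi x)\<^sup>2) \<le> (1/2 + c) * (e / (1/2 + c))"
      using psi(2) cl by (intro mult_left_mono) auto
    also have "\<dots> = e" using cl by simp
    finally show "(1/2 + c) * a2 \<le> R + e" using weak[OF psi(1)] by (simp only: right_diff_distrib)
  qed
  have E: "?I (\<lambda>x. 1/2 * (norm (g x))\<^sup>2 + Fdw (m x)) = b2 / 2 + a4 / 4 - a2 / 2 + Q / 4"
  proof -
    have "(\<lambda>x. 1/2 * (norm (g x))\<^sup>2 + Fdw (m x)) = (\<lambda>x. (norm (g x))\<^sup>2 / 2 + (m x)^4 / 4 - (m x)\<^sup>2 / 2 + 1 / 4)"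
      by (simp add: fun_eq_iff Fdw_expand)
    then show ?thesis using g2 m4 m2 Qm by (simp add: a2_def a4_def b2_def)
  qed
  have V: "?I (\<lambda>x. (m x - n)\<^sup>2) = a2 - n\<^sup>2 * Q"
  proof -
    have "(\<lambda>x. (m x - n)\<^sup>2) = (\<lambda>x. (m x)\<^sup>2 - 2 * n * m x + n\<^sup>2)"
      by (simp add: fun_eq_iff power2_eq_square algebra_simps)
    then show ?thesis using m2 im mean Qm by (simp add: a2_def Q_def power2_eq_square)
  qed
  have V0: "?I (\<lambda>x. (m x - n)\<^sup>2) \<ge> 0" by (intro integral_nonneg_AE) simp
  have "(l - l0) * ?I (\<lambda>x. (m x - n)\<^sup>2) \<le> c * ?I (\<lambda>x. (m x - n)\<^sup>2)"
    using cl(1) V0 by (rule mult_right_mono)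
  also have "\<dots> = c * a2 - c * (n\<^sup>2 * Q)" unfolding V by (simp add: algebra_simps)
  finally show ?thesis using main unfolding E R_def Q_def[symmetric] by (simp add: algebra_simps)
qed

theorem theorem1p2:
  fixes K :: real
  assumes "CARD('d::finite) \<ge> 2"
    and "0 < K" and "K < K_star CARD('d)"
  shows "\<exists>L0. \<forall>L. L \<ge> L0 \<longrightarrow> L > 0 \<longrightarrow>
           (\<forall>n::real. -1 < n \<and> n \<le> -1 + K * L powr (- (real CARD('d) / (real CARD('d) + 1))) \<longrightarrow>
              is_minimizer L n (\<lambda>_::real^'d. n) (\<lambda>_. 0) \<and>
              (\<forall>(m::real^'d \<Rightarrow> real) g. is_minimizer L n m g \<longrightarrow>
                  (AE x in lebesgue_on (cell L). m x = n)))"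
proof -
  let ?p = "real CARD('d) / (real CARD('d) + 1)"
  \<comment> \<open>Any value strictly between would do; \<open>K' - K\<close> becomes the
    coefficient of the quadratic gap.\<close>
  define K' where "K' = (K + K_star CARD('d)) / 2"
  have K': "0 < K'" "K' < K_star CARD('d)" "K < K'" using assms by (auto simp: K'_def)
  obtain L0 where L0: "\<And>L a (u :: real^'d \<Rightarrow> real) G. L \<ge> L0 \<Longrightarrow> 2 - 2 * (K' * L powr (- ?p)) \<le> a \<Longrightarrow> a \<le> 2 \<Longrightarrow> periodic_L L u \<Longrightarrow>
     (\<And>x. (u has_derivative (\<lambda>h. G x \<bullet> h)) (at x)) \<Longrightarrow> continuous_on UNIV G \<Longrightarrow>
     cell_integral L u = 0 \<Longrightarrow>
     0 \<le> cell_integral L (\<lambda>x. (norm (G x))\<^sup>2 / 2 + (u x)\<^sup>2 * (u x - a)\<^sup>2 / 4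
            - K' * L powr (- ?p) * (u x)\<^sup>2)"
    using torus_coercivity[OF assms(1) K'(1,2)] by meson
  show ?thesis
  proof (intro exI[of _ L0] allI impI)
    fix L n :: real
    assume LL0: "L \<ge> L0" and L: "L > 0" and n: "-1 < n \<and> n \<le> -1 + K * L powr (- ?p)"
    let ?M = "lebesgue_on (cell L) :: (real^'d) measure"
    let ?I = "integral\<^sup>L ?M :: (real^'d \<Rightarrow> real) \<Rightarrow> real"
    let ?lo = "K * L powr (- ?p)" and ?hi = "K' * L powr (- ?p)"
    have ll: "?lo < ?hi" using L by (intro mult_strict_right_mono[OF K'(3)]) simp
    \<comment> \<open>Here \<open>a = - 2 * n\<close>; it lies in the range required by
      \<open>torus_coercivity\<close> because \<open>n\<close> is between -1 and
      \<open>-1 + ?lo\<close>, and \<open>?lo < ?hi\<close>.\<close>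
    have coer: "0 \<le> ?I (\<lambda>x. (norm (G x))\<^sup>2 / 2 + (u x)\<^sup>2 * (u x + 2 * n)\<^sup>2 / 4 - ?hi * (u x)\<^sup>2)"
      if "periodic_L L u" "\<And>x. (u has_derivative (\<lambda>h. G x \<bullet> h)) (at x)" "continuous_on UNIV G" "integral\<^sup>L ?M u = 0"
      for u G
      using L0[OF LL0, of "- 2 * n" u G] that n ll by simp
    have gap: "energy L m g = ennreal (?I (\<lambda>x. 1/2 * (norm (g x))\<^sup>2 + Fdw (m x))) \<and>
        integrable ?M (\<lambda>x. (m x - n)\<^sup>2) \<and>
        Fdw n * L ^ CARD('d) + (?hi - ?lo) * ?I (\<lambda>x. (m x - n)\<^sup>2)
          \<le> ?I (\<lambda>x. 1/2 * (norm (g x))\<^sup>2 + Fdw (m x))"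
      if adm: "admissible L n m g" and fin: "energy L m g < \<infinity>" for m :: "real^'d \<Rightarrow> real" and g
    proof -
      interpret M: finite_measure ?M by (rule finite_measure_cell)
      have H1: "torus_H1 L m g" and mean: "integral\<^sup>L ?M m = n * L ^ CARD('d)"
        using adm L by (auto simp: admissible_def field_simps)
      have [measurable]: "m \<in> borel_measurable ?M" "g \<in> borel_measurable ?M"
        and m2: "integrable ?M (\<lambda>x. (m x)\<^sup>2)"
        using H1 by (simp_all add: torus_H1_def)
      have im: "integrable ?M m" by (rule square_integrable_imp_integrable) (use m2 in simp_all)
      have nn: "0 \<le> 1/2 * (norm (g x))\<^sup>2 + Fdw (m x)" for x by (simp add: Fdw_def)
      have i: "integrable ?M (\<lambda>x. 1/2 * (norm (g x))\<^sup>2 + Fdw (m x))"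
      proof (rule integrableI_nonneg)
        show "(\<lambda>x. 1/2 * (norm (g x))\<^sup>2 + Fdw (m x)) \<in> borel_measurable ?M" unfolding Fdw_def by measurable
        show "(\<integral>\<^sup>+x. ennreal (1/2 * (norm (g x))\<^sup>2 + Fdw (m x)) \<partial>?M) < \<infinity>" using fin unfolding energy_def .
      qed (use nn in auto)
      have "(\<lambda>x. (m x - n)\<^sup>2) = (\<lambda>x. (m x)\<^sup>2 - 2 * n * m x + n\<^sup>2)"
        by (simp add: fun_eq_iff power2_eq_square algebra_simps)
      then have "integrable ?M (\<lambda>x. (m x - n)\<^sup>2)" using m2 im by simp
      moreover have "energy L m g = ennreal (?I (\<lambda>x. 1/2 * (norm (g x))\<^sup>2 + Fdw (m x)))"
        unfolding energy_def by (rule nn_integral_eq_integral[OF i]) (use nn in auto)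
      moreover have "Fdw n * L ^ CARD('d) + (?hi - ?lo) * ?I (\<lambda>x. (m x - n)\<^sup>2)
          \<le> ?I (\<lambda>x. 1/2 * (norm (g x))\<^sup>2 + Fdw (m x))"
        by (rule energy_gap[OF L conjunct1[OF n] conjunct2[OF n] less_imp_le[OF ll] coer H1 mean i])
      ultimately show ?thesis by blast
    qed
    have F0: "Fdw n * L ^ CARD('d) \<ge> 0" using L by (simp add: Fdw_def)
    have adm: "admissible L n (\<lambda>_::real^'d. n) (\<lambda>_. 0)" by (rule admissible_const[OF L])
    have lower: "ennreal (Fdw n * L ^ CARD('d)) \<le> energy L m g" if "admissible L n m g" for m :: "real^'d \<Rightarrow> real" and g
    proof (cases "energy L m g < \<infinity>")
      case True
      have "0 \<le> (?hi - ?lo) * ?I (\<lambda>x. (m x - n)\<^sup>2)"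
        using ll by (intro mult_nonneg_nonneg integral_nonneg_AE) auto
      then show ?thesis using gap[OF that True] by (auto intro!: ennreal_leI)
    qed (auto simp: not_less top_unique)
    have fL: "f_L TYPE('d) L n = ennreal (Fdw n * L ^ CARD('d))"
      unfolding f_L_def
    proof (rule antisym)
      show "Inf {energy L m g |(m :: real^'d \<Rightarrow> real) g. admissible L n m g} \<le> ennreal (Fdw n * L ^ CARD('d))"
        by (rule Inf_lower) (use adm energy_const[OF L, of n, where 'd='d] in force)
      show "ennreal (Fdw n * L ^ CARD('d)) \<le> Inf {energy L m g |(m :: real^'d \<Rightarrow> real) g. admissible L n m g}"
        by (rule Inf_greatest) (use lower in auto)
    qed
    show "is_minimizer L n (\<lambda>_::real^'d. n) (\<lambda>_. 0) \<and>
              (\<forall>(m::real^'d \<Rightarrow> real) g. is_minimizer L n m g \<longrightarrow> (AE x in lebesgue_on (cell L). m x = n))"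
    proof (intro conjI allI impI)
      show "is_minimizer L n (\<lambda>_::real^'d. n) (\<lambda>_. 0)"
        unfolding is_minimizer_def using adm fL energy_const[OF L, of n, where 'd='d] by simp
    next
      fix m :: "real^'d \<Rightarrow> real" and g assume mg: "is_minimizer L n m g"
      then have e: "energy L m g = ennreal (Fdw n * L ^ CARD('d))" and a: "admissible L n m g"
        using fL by (auto simp: is_minimizer_def)
      have fin: "energy L m g < \<infinity>" using e by simp
      let ?E = "?I (\<lambda>x. 1/2 * (norm (g x))\<^sup>2 + Fdw (m x))"
      have g1: "energy L m g = ennreal ?E" and g2: "integrable ?M (\<lambda>x. (m x - n)\<^sup>2)"
        and g3: "Fdw n * L ^ CARD('d) + (?hi - ?lo) * ?I (\<lambda>x. (m x - n)\<^sup>2) \<le> ?E"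
        using gap[OF a fin] by blast+
      have "ennreal ?E \<le> ennreal (Fdw n * L ^ CARD('d))" unfolding g1[symmetric] e ..
      then have "?E \<le> Fdw n * L ^ CARD('d)" using F0 by (simp only: ennreal_le_iff)
      \<comment> \<open>Equality of the energies leaves no room for the quadratic gap, whose
        coefficient is strictly positive.\<close>
      then have "(?hi - ?lo) * ?I (\<lambda>x. (m x - n)\<^sup>2) \<le> 0" using g3 by linarith
      then have "?I (\<lambda>x. (m x - n)\<^sup>2) \<le> 0" using ll by (simp add: mult_le_0_iff)
      moreover have "?I (\<lambda>x. (m x - n)\<^sup>2) \<ge> 0" by (intro integral_nonneg_AE) simp
      ultimately have "?I (\<lambda>x. (m x - n)\<^sup>2) = 0" by simp
      then have "AE x in ?M. (m x - n)\<^sup>2 = 0"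
        using integral_nonneg_eq_0_iff_AE[of ?M "\<lambda>x. (m x - n)\<^sup>2"] g2 by simp
      then show "AE x in lebesgue_on (cell L). m x = n" by simp
    qed
  qed
qed

end
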